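(* Let $P_1,\dots,P_s\in\mathbb{P}^2$ be $s\geq 4$ general points of the complex projective plane. Let $m_1\geq m_2\geq\dots\geq m_s\geq 1$ be fixed integers and let $t$ be an integer. If $$t\geq m_1+m_2 \quad\text{and}\quad \operatorname{vdim}(\mathcal{L}_2(t;m_1,\dots,m_s))\geq\frac12\left(3m_4^2-7m_4+2\right),$$ then $$h^1\left(\mathbb{P}^2,\mathcal{O}_{\mathbb{P}^2}(t)\otimes\mathfrak{m}_{P_1}^{m_1}\otimes\dots\otimes\mathfrak{m}_{P_s}^{m_s}\right)=0,$$ i.e. the system $\mathcal{L}_2(t;m_1,\dots,m_s)$ is non-special.
   Context: We work over $\mathbb{C}$. $\mathfrak{m}_P$ denotes the maximal ideal (sheaf) of a point $P\in\mathbb{P}^2$. $\mathcal{L}_2(t;m_1,\dots,m_s)$ denotes the linear system of plane curves of degree $t$ vanishing at $P_i$ to order at least $m_i$, for $i=1,\dots,s$. Its virtual dimension is $$\operatorname{vdim}(\mathcal{L}_2(t;m_1,\dots,m_s))=\binom{t+2}{2}-\sum_{i=1}^s\binom{m_i+1}{2}-1,$$ and its expected dimension is $\operatorname{edim}=\max\{\operatorname{vdim},-1\}$. Dimension is projective dimension, and the empty system has dimension $-1$. The system is non-special if its dimension equals its expected dimension. "General points" means: for all $(P_1,\dots,P_s)$ in some nonempty Zariski open subset of $(\mathbb{P}^2)^s$ (depending on the numerical data). *)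

theory Defs
  imports "HOL-Analysis.Analysis" "HOL-Library.Poly_Mapping"
begin

section \<open>The projective plane\<close>

typedef proj2 = "{L :: (complex ^ 3) set. \<exists>v. v \<noteq> 0 \<and> L = range (\<lambda>c. c *s v)}"
  morphisms line_of Abs_proj2
  by (rule exI[of _ "range (\<lambda>c. c *s axis 1 1)"]) (auto intro!: exI[of _ "axis 1 1"] simp: axis_eq_0_iff)

definition hcoords :: "proj2 \<Rightarrow> (complex ^ 3) set" where
  "hcoords P = line_of P - {0}"


section \<open>Ternary Laurent polynomials\<close>

text \<open>An exponent vector is an element of the additive group \<^typ>\<open>int ^ 3\<close>, so that the
  multiplication of finitely supported functions is the multiplication of
  \<open>\<complex>[x\<^sub>1\<^sup>\<plusminus>, x\<^sub>2\<^sup>\<plusminus>, x\<^sub>3\<^sup>\<plusminus>]\<close>.  All rings of functions on the standard affine open subsets of the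
  plane and on their intersections are subrings of this ring.\<close>

type_synonym laurent = "(int ^ 3) \<Rightarrow>\<^sub>0 complex"

definition lscale :: "complex \<Rightarrow> laurent \<Rightarrow> laurent" where
  "lscale c f = Poly_Mapping.single 0 c * f"

global_interpretation laurent: vector_space lscale
proof
  fix a b :: complex and x y :: laurent
  show "lscale a (x + y) = lscale a x + lscale a y"
    by (simp add: lscale_def distrib_left)
  show "lscale (a + b) x = lscale a x + lscale b x"
    by (simp add: lscale_def single_add distrib_right)
  show "lscale a (lscale b x) = lscale (a * b) x"
    by (simp add: lscale_def mult.assoc[symmetric] mult_single)
  show "lscale 1 x = x"
    by (simp add: lscale_def)
qed

text \<open>\<open>coord_ring S\<close> is \<open>\<complex>[x\<^sub>1, x\<^sub>2, x\<^sub>3]\<close> localized at \<open>x\<^sub>k\<close> for \<open>k \<in> S\<close>; in particular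
  \<open>coord_ring {}\<close> is the polynomial ring.\<close>

definition coord_ring :: "3 set \<Rightarrow> laurent set" where
  "coord_ring S = {f. \<forall>e\<in>Poly_Mapping.keys f. \<forall>k. k \<notin> S \<longrightarrow> 0 \<le> e $ k}"

definition homogeneous :: "int \<Rightarrow> laurent \<Rightarrow> bool" where
  "homogeneous d f \<longleftrightarrow> (\<forall>e\<in>Poly_Mapping.keys f. (\<Sum>k\<in>UNIV. e $ k) = d)"

definition forms :: "int \<Rightarrow> laurent set" where
  "forms d = {f \<in> coord_ring {}. homogeneous d f}"

definition leval :: "laurent \<Rightarrow> complex ^ 3 \<Rightarrow> complex" where
  "leval f v = (\<Sum>e\<in>Poly_Mapping.keys f. Poly_Mapping.lookup f e * (\<Prod>k\<in>UNIV. (v $ k) powi (e $ k)))"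

definition partial :: "3 \<Rightarrow> laurent \<Rightarrow> laurent" where
  "partial k f = (\<Sum>e\<in>Poly_Mapping.keys f.
     Poly_Mapping.single (e - axis k 1) (of_int (e $ k) * Poly_Mapping.lookup f e))"


section \<open>Linear systems of plane curves\<close>

text \<open>A form vanishes at a point to order at least \<open>m\<close> if all its iterated partial derivatives
  of order less than \<open>m\<close> vanish there; \<open>fold partial ks f\<close> is the iterated derivative in the
  directions listed in \<open>ks\<close>.\<close>

definition vanishes_to_order :: "nat \<Rightarrow> proj2 \<Rightarrow> laurent \<Rightarrow> bool" where
  "vanishes_to_order m P f \<longleftrightarrow>
     (\<forall>v\<in>hcoords P. \<forall>ks :: 3 list. length ks < m \<longrightarrow> leval (fold partial ks f) v = 0)"

text \<open>The points and multiplicities carry the indices \<open>1, \<dots>, s\<close>.  The vector space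
  \<open>system_forms\<close> consists of \<open>0\<close> and the equations of the members of the linear system.\<close>

definition system_forms :: "int \<Rightarrow> nat \<Rightarrow> (nat \<Rightarrow> nat) \<Rightarrow> (nat \<Rightarrow> proj2) \<Rightarrow> laurent set" where
  "system_forms t s m P = {f \<in> forms t. \<forall>i\<in>{1..s}. vanishes_to_order (m i) (P i) f}"

definition system_dim :: "int \<Rightarrow> nat \<Rightarrow> (nat \<Rightarrow> nat) \<Rightarrow> (nat \<Rightarrow> proj2) \<Rightarrow> int" where
  "system_dim t s m P = int (laurent.dim (system_forms t s m P)) - 1"

definition vdim :: "int \<Rightarrow> nat \<Rightarrow> (nat \<Rightarrow> nat) \<Rightarrow> int" where
  "vdim t s m = int (nat (t + 2) choose 2) - (\<Sum>i=1..s. int ((m i + 1) choose 2)) - 1"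

definition edim :: "int \<Rightarrow> nat \<Rightarrow> (nat \<Rightarrow> nat) \<Rightarrow> int" where
  "edim t s m = max (vdim t s m) (-1)"

definition non_special :: "int \<Rightarrow> nat \<Rightarrow> (nat \<Rightarrow> nat) \<Rightarrow> (nat \<Rightarrow> proj2) \<Rightarrow> bool" where
  "non_special t s m P \<longleftrightarrow> system_dim t s m P = edim t s m"


section \<open>The first cohomology of the twisted ideal sheaf of fat points\<close>

text \<open>The homogeneous prime ideal of a point \<open>P\<close> is generated by the forms that vanish at \<open>P\<close>.\<close>

definition forms_vanishing_at :: "proj2 \<Rightarrow> laurent set" where
  "forms_vanishing_at P = {f. (\<exists>d. f \<in> forms d) \<and> (\<forall>v\<in>hcoords P. leval f v = 0)}"

text \<open>Generators of the product of the \<open>m i\<close>-th powers of the homogeneous ideals of the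
  points \<open>P i\<close>.\<close>

definition fat_ideal_generators :: "nat \<Rightarrow> (nat \<Rightarrow> nat) \<Rightarrow> (nat \<Rightarrow> proj2) \<Rightarrow> laurent set" where
  "fat_ideal_generators s m P =
     {\<Prod>i=1..s. \<Prod>j<m i. l i j | l. \<forall>i\<in>{1..s}. \<forall>j<m i. l i j \<in> forms_vanishing_at (P i)}"

definition generated_ideal :: "laurent set \<Rightarrow> laurent set \<Rightarrow> laurent set" where
  "generated_ideal R B = {\<Sum>b\<in>A. r b * b | A r. finite A \<and> A \<subseteq> B \<and> (\<forall>b\<in>A. r b \<in> R)}"

text \<open>For nonempty \<open>S\<close>, \<open>fat_sections t s m P S\<close> is the space of sections of
  \<open>\<O>(t) \<otimes> \<mm>\<^bsub>P 1\<^esub>\<^bsup>m 1\<^esup> \<otimes> \<dots> \<otimes> \<mm>\<^bsub>P s\<^esub>\<^bsup>m s\<^esup>\<close> over the open set where \<open>x\<^sub>k \<noteq> 0\<close> for all \<open>k \<in> S\<close>, the points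
  \<open>P 1, \<dots>, P s\<close> being distinct.  The tensor product is then the product ideal sheaf, which is
  the sheaf associated with the product \<open>I\<close> of the powers of the homogeneous ideals; the sections
  of its \<open>t\<close>-th twist over that open set are the elements of degree \<open>t\<close> of the localization
  of \<open>I\<close> at the \<open>x\<^sub>k\<close>, \<open>k \<in> S\<close>.\<close>

definition fat_sections ::
    "int \<Rightarrow> nat \<Rightarrow> (nat \<Rightarrow> nat) \<Rightarrow> (nat \<Rightarrow> proj2) \<Rightarrow> 3 set \<Rightarrow> laurent set" where
  "fat_sections t s m P S =
     {f \<in> generated_ideal (coord_ring S) (fat_ideal_generators s m P). homogeneous t f}"

text \<open>First Cech cohomology with respect to the three standard affine open sets \<open>x\<^sub>k \<noteq> 0\<close>.  A
  sheaf is given by its sections over the intersections of these sets, the restriction maps being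
  inclusions.  For quasi-coherent sheaves this is the sheaf cohomology, as the cover is affine.\<close>

definition cech_cocycles1 :: "(3 set \<Rightarrow> laurent set) \<Rightarrow> (3 \<Rightarrow> 3 \<Rightarrow> laurent) set" where
  "cech_cocycles1 F = {c. (\<forall>i j. c i j \<in> F {i, j}) \<and> (\<forall>i j k. c j k - c i k + c i j = 0)}"

definition cech_coboundaries1 :: "(3 set \<Rightarrow> laurent set) \<Rightarrow> (3 \<Rightarrow> 3 \<Rightarrow> laurent) set" where
  "cech_coboundaries1 F = {\<lambda>i j. g j - g i | g. \<forall>i. g i \<in> F {i}}"

definition h1_vanishes :: "int \<Rightarrow> nat \<Rightarrow> (nat \<Rightarrow> nat) \<Rightarrow> (nat \<Rightarrow> proj2) \<Rightarrow> bool" where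
  "h1_vanishes t s m P \<longleftrightarrow>
     cech_cocycles1 (fat_sections t s m P) = cech_coboundaries1 (fat_sections t s m P)"


section \<open>The Zariski topology on products of projective planes\<close>

text \<open>Polynomials in the variables \<open>x\<^bsub>i,k\<^esub>\<close>, the \<open>k\<close>-th homogeneous coordinate on the \<open>i\<close>-th
  factor.\<close>

type_synonym mpoly = "((nat \<times> 3) \<Rightarrow>\<^sub>0 nat) \<Rightarrow>\<^sub>0 complex"

definition multihomogeneous :: "nat \<Rightarrow> (nat \<Rightarrow> nat) \<Rightarrow> mpoly \<Rightarrow> bool" where
  "multihomogeneous s d F \<longleftrightarrow>
     (\<forall>e\<in>Poly_Mapping.keys F. Poly_Mapping.keys e \<subseteq> {1..s} \<times> UNIV \<and>
        (\<forall>i\<in>{1..s}. (\<Sum>k\<in>UNIV. Poly_Mapping.lookup e (i, k)) = d i))"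

definition mpoly_eval :: "mpoly \<Rightarrow> (nat \<Rightarrow> complex ^ 3) \<Rightarrow> complex" where
  "mpoly_eval F x = (\<Sum>e\<in>Poly_Mapping.keys F. Poly_Mapping.lookup F e *
     (\<Prod>(i, k)\<in>Poly_Mapping.keys e. (x i $ k) ^ Poly_Mapping.lookup e (i, k)))"

definition common_zeros :: "nat \<Rightarrow> mpoly set \<Rightarrow> (nat \<Rightarrow> proj2) set" where
  "common_zeros s \<F> = {P \<in> {1..s} \<rightarrow>\<^sub>E UNIV.
     \<forall>F\<in>\<F>. \<forall>x. (\<forall>i\<in>{1..s}. x i \<in> hcoords (P i)) \<longrightarrow> mpoly_eval F x = 0}"

definition zariski_open :: "nat \<Rightarrow> (nat \<Rightarrow> proj2) set \<Rightarrow> bool" where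
  "zariski_open s U \<longleftrightarrow>
     (\<exists>\<F>. (\<forall>F\<in>\<F>. \<exists>d. multihomogeneous s d F) \<and> U = ({1..s} \<rightarrow>\<^sub>E UNIV) - common_zeros s \<F>)"

end

theory Submission
  imports Defs "HOL-Computational_Algebra.Polynomial" "Jordan_Normal_Form.Determinant"
begin

hide_const (open) Module.smult
no_notation vec_index (infixl "$" 100)

text \<open>A form of degree \<open>t\<close> is a sum \<open>\<Sum>j. y\<^sup>j F\<^sub>j(x)\<close> in which the slice \<open>F\<^sub>j\<close> has \<open>t + 1 - j\<close>
  coefficients.  When \<open>b\<close> tends to \<open>0\<close>, the conditions imposed by an \<open>m\<close>-fold point \<open>(a, b)\<close> become
  the vanishing of distinct slices at \<open>a\<close> to the orders \<open>m, m - 1, \<dots>, 1\<close>; the slices may be chosen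
  freely, except that one of them may receive a smaller order than a later one only if all its
  coefficients are used up by that.  By compactness, if no nonzero form satisfies the limit
  conditions and those of the other points, then the same holds for some \<open>b\<close>.  Degenerating one
  point after the other, a greedy choice of the slices absorbs the conditions of all the points, the
  hypothesis on the virtual dimension ensuring that it never gets stuck.  So the conditions are
  independent for some configuration.

  The derivatives of order exactly \<open>m\<^sub>p - 1\<close> at the points then have a nonzero determinant on a
  suitable set of monomials.  It is multihomogeneous in the points, and \<open>U\<close> is the set where it does
  not vanish.  Over \<open>U\<close> all jets of orders \<open>m\<^sub>p\<close> are interpolated by forms of degree \<open>t\<close>, which
  yields the dimension.  For the cohomology, write a cocycle as a coboundary \<open>g\<^sub>j - g\<^sub>i\<close> of \<open>\<O>(t)\<close>;
  the jets of the \<open>g\<^sub>i\<close> at the points agree, and subtracting from all \<open>g\<^sub>i\<close> a form with these jets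
  moves them into the product ideal, by Taylor expansion and comaximality of the ideals of distinct
  points.\<close>

text \<open>The choice of slices can fail only at neighbouring slices that do not increase in length
  while the second is shorter than the multiplicity \<open>m\<close>. Untouched lengths drop by one
  from slice to slice, and each point that touches a slice without using it up raises the difference
  to the next one by at least one. So twice-touched slices increase, and the danger lies where few
  points have arrived.

  The hypothesis \<open>t \<ge> m 1 + m 2\<close> leaves slices that are nonempty and increase
  before index \<open>m 2\<close> after the first two points, which makes room for the third point
  by itself. From the fourth point on all multiplicities are at most \<open>M = m 4\<close>, so only
  \<open>m 4\<close> enters the bound on the virtual dimension.

  The bound is what the case \<open>m = M\<close> demands: when a point of multiplicity
  \<open>M\<close> is placed, at least one coefficient more is left than a triangle of side
  \<open>2 * M - 2\<close> contains, and any configuration in which the choice fails fits into that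
  many places.

  Coefficients that remain at the end are discarded, so that there are as many monomials as
  conditions and independence becomes the nonvanishing of one determinant.\<close>

section \<open>Distributing the conditions over the slices\<close>

text \<open>\<open>b j\<close> is the number of coefficients available in slice \<open>j\<close>, and \<open>v j\<close> the order to which the
  degenerated \<open>m\<close>-fold point makes it vanish.\<close>

definition valid :: "(nat \<Rightarrow> nat) \<Rightarrow> nat \<Rightarrow> (nat \<Rightarrow> nat) \<Rightarrow> bool" where
  "valid b m v \<longleftrightarrow> (\<forall>j. v j \<le> b j) \<and> bij_betw v {j. 0 < v j} {1..m} \<and>
     (\<forall>j J. j < J \<longrightarrow> v j < v J \<longrightarrow> v j = b j)"

inductive reducible :: "(nat \<Rightarrow> nat) \<Rightarrow> nat list \<Rightarrow> bool" where
  reducible_Nil: "reducible b []"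
| reducible_Cons: "valid b m v \<Longrightarrow> reducible (\<lambda>j. b j - v j) ms \<Longrightarrow> reducible b (m # ms)"

text \<open>Unlike \<open>reducible\<close>, this leaves no coefficient over, so the matrix of the
  conditions is square.\<close>

inductive exact :: "(nat \<Rightarrow> nat) \<Rightarrow> nat list \<Rightarrow> bool" where
  exact_Nil: "exact (\<lambda>j. 0) []"
| exact_Cons: "valid c m v \<Longrightarrow> exact (\<lambda>j. c j - v j) ms \<Longrightarrow> exact c (m # ms)"

text \<open>Keep only the coefficients that are consumed at some stage. A slice used up by a point
  provides nothing to later points, so it is used up in the smaller array as well, and
  \<open>valid\<close> survives.\<close>

lemma reducible_exact: "reducible b ms \<Longrightarrow> \<exists>c. exact c ms \<and> (\<forall>j. c j \<le> b j)"
proof (induction rule: reducible.induct)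
  case (reducible_Nil b)
  then show ?case using exact_Nil by (intro exI[of _ "\<lambda>j. 0"]) simp
next
  case (reducible_Cons b m v ms)
  then obtain c where c: "exact c ms" "\<And>j. c j \<le> b j - v j" by blast
  have vb: "v j \<le> b j" for j using reducible_Cons(1) by (simp add: valid_def)
  have "valid (\<lambda>j. c j + v j) m v"
    using reducible_Cons(1) c(2) unfolding valid_def
    by (metis add_0 bot_nat_0.extremum_uniqueI diff_self_eq_0 le_add2)
  then have "exact (\<lambda>j. c j + v j) (m # ms)"
    by (rule exact_Cons) (use c(1) in simp)
  moreover have "c j + v j \<le> b j" for j using c(2)[of j] vb[of j] by linarith
  ultimately show ?case by blast
qed

lemma valid_sum:
  assumes "valid c m v" "\<And>j. t < j \<Longrightarrow> c j = 0"
  shows "(\<Sum>j\<le>t. v j) = Suc m choose 2"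
proof -
  have v0: "v j = 0" if "t < j" for j
    using assms that by (metis le_zero_eq valid_def)
  have "(\<Sum>j\<le>t. v j) = (\<Sum>j\<in>{j. 0 < v j}. v j)"
    by (rule sum.mono_neutral_right) (use v0 in \<open>auto simp: not_less[symmetric]\<close>)
  also have "\<dots> = \<Sum>{1..m}"
    using sum.reindex_bij_betw[of v "{j. 0 < v j}" "{1..m}" "\<lambda>x. x"] assms(1)
    by (simp add: valid_def)
  also have "\<dots> = Suc m choose 2"
    using gauss_sum_from_Suc_0[of m, where 'a=nat] by (simp add: choose_two mult.commute)
  finally show ?thesis .
qed

lemma valid_sum_diff:
  assumes "valid b m v" "\<And>j. t < j \<Longrightarrow> b j = 0"
  shows "2 * int (\<Sum>j\<le>t. b j) = int m * (int m + 1) + 2 * int (\<Sum>j\<le>t. b j - v j)"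
proof -
  have vb: "v j \<le> b j" for j using assms by (simp add: valid_def)
  have "(\<Sum>j\<le>t. b j) = (\<Sum>j\<le>t. v j + (b j - v j))"
    by (rule sum.cong) (use vb in auto)
  also have "\<dots> = (Suc m choose 2) + (\<Sum>j\<le>t. b j - v j)"
    using valid_sum[OF assms] by (simp add: sum.distrib)
  finally have "2 * (\<Sum>j\<le>t. b j) = 2 * (Suc m choose 2) + 2 * (\<Sum>j\<le>t. b j - v j)" by simp
  also have "2 * (Suc m choose 2) = m * (m + 1)" by (simp add: choose_two mult.commute)
  finally have "int (2 * (\<Sum>j\<le>t. b j)) = int (m * (m + 1) + 2 * (\<Sum>j\<le>t. b j - v j))"
    by (rule arg_cong)
  then show ?thesis unfolding of_nat_add of_nat_mult by simp
qed

lemma exact_sum: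
  assumes "exact c ms" "\<And>j. t < j \<Longrightarrow> c j = 0"
  shows "(\<Sum>j\<le>t. c j) = (\<Sum>m\<leftarrow>ms. Suc m choose 2)"
  using assms
proof (induction rule: exact.induct)
  case exact_Nil
  then show ?case by simp
next
  case (exact_Cons c m v ms)
  have vc: "v j \<le> c j" for j using exact_Cons by (simp add: valid_def)
  have "(\<Sum>j\<le>t. c j) = (\<Sum>j\<le>t. v j + (c j - v j))"
    by (rule sum.cong) (use vc in auto)
  also have "\<dots> = (\<Sum>j\<le>t. v j) + (\<Sum>j\<le>t. c j - v j)" by (rule sum.distrib)
  finally show ?case using exact_Cons valid_sum[of c m v t] by simp
qed

lemma ex_decreasing_enum:
  assumes "finite (T :: nat set)"
  shows "\<exists>w. bij_betw w {..<card T} T \<and> (\<forall>i j. i < j \<longrightarrow> j < card T \<longrightarrow> w j < w i)"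
proof -
  let ?xs = "rev (sorted_list_of_set T)"
  have "bij_betw ((!) ?xs) {..<length ?xs} (set ?xs)"
    by (rule bij_betw_nth) auto
  moreover have "sorted_wrt (\<lambda>x y. y < x) ?xs"
    by (simp add: sorted_wrt_rev strict_sorted_list_of_set)
  ultimately show ?thesis using assms
    by (intro exI[of _ "(!) ?xs"]) (auto simp: sorted_wrt_iff_nth_less)
qed

text \<open>The slices with fewer than \<open>m\<close> entries are used up completely, and the unused numbers
  of \<open>{1..m}\<close> are taken in decreasing order from the following slices.\<close>

lemma valid_step:
  assumes m: "1 \<le> m" and p: "0 < b p" "\<And>i. i < p \<Longrightarrow> b i = 0"
    and win: "\<And>j. p \<le> j \<Longrightarrow> j + 1 < p + m \<Longrightarrow> b (j + 1) < m \<Longrightarrow> b j < b (j + 1)"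
  shows "\<exists>v q. valid b m v \<and> p \<le> q \<and> (\<forall>i<q. v i = b i) \<and> (\<forall>i\<ge>p + m. v i = 0) \<and>
    (\<forall>i\<ge>q. i < p + m \<longrightarrow> v (i + 1) < v i \<and> v i + (i - q) \<le> m)"
proof -
  define q where "q = (LEAST i. p \<le> i \<and> (i = p + m \<or> m \<le> b i))"
  have q: "p \<le> q" "q = p + m \<or> m \<le> b q"
    using LeastI[of "\<lambda>i. p \<le> i \<and> (i = p + m \<or> m \<le> b i)" "p + m"] by (auto simp: q_def)
  have qm: "q \<le> p + m" unfolding q_def by (rule Least_le) auto
  have small: "b i < m" if "p \<le> i" "i < q" for i
    using not_less_Least[of i "\<lambda>i. p \<le> i \<and> (i = p + m \<or> m \<le> b i)"] that
    unfolding q_def[symmetric] by auto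
  \<comment> \<open>Past \<open>q\<close> no length below \<open>m\<close> can recur: by
    \<open>win\<close> the slice before it would be shorter still.\<close>
  have large: "m \<le> b i" if "q \<le> i" "i < p + m" for i
    using that
  proof (induction i rule: dec_induct)
    case base
    then show ?case using q by auto
  next
    case (step i)
    then show ?case using win[of i] q by fastforce
  qed
  have inc: "b i < b (Suc (i + d))" if "p \<le> i" "Suc (i + d) < q" for i d
    using that(2)
  proof (induction d)
    case 0
    then show ?case using win[of i] small[of "Suc i"] that(1) qm by auto
  next
    case (Suc d)
    then show ?case using win[of "Suc (i + d)"] small[of "Suc (Suc (i + d))"] that(1) qm by auto
  qed
  have inc': "b i < b j" if "p \<le> i" "i < j" "j < q" for i j
    using inc[of i "j - Suc i"] that by simp
  have pos: "0 < b i" if "p \<le> i" "i < q" for i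
    using inc'[of p i] that p(1) by (cases "i = p") auto
  have inj: "inj_on b {p..<q}"
    by (rule inj_onI) (metis atLeastLessThan_iff inc' less_irrefl linorder_neqE_nat)
  have sub: "b ` {p..<q} \<subseteq> {1..m}" using pos small by (force simp: Suc_le_eq)
  \<comment> \<open>As many numbers remain here as there are slices from \<open>q\<close> to
    \<open>p + m - 1\<close>.\<close>
  define T where "T = {1..m} - b ` {p..<q}"
  have cT: "card T = p + m - q"
    unfolding T_def by (subst card_Diff_subset) (use sub inj q qm in \<open>auto simp: card_image\<close>)
  obtain w where w: "bij_betw w {..<card T} T" "\<And>i j. i < j \<Longrightarrow> j < card T \<Longrightarrow> w j < w i"
    using ex_decreasing_enum[of T] by (auto simp: T_def)
  have wT: "w i \<in> {1..m}" if "i < card T" for i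
    using bij_betwE[OF w(1)] that by (auto simp: T_def)
  define v where "v i = (if i < q then b i else if i < p + m then w (i - q) else 0)" for i
  have vdec: "v (i + 1) < v i" if "q \<le> i" "i < p + m" for i
    using that w(2)[of "i - q" "Suc i - q"] wT[of "i - q"] cT
    by (cases "Suc i < p + m") (simp_all add: v_def Suc_diff_le less_diff_conv2 Suc_le_eq)
  have vle: "v i \<le> m" if "q \<le> i" for i
    using that wT[of "i - q"] cT by (auto simp: v_def)
  have vm: "v i + (i - q) \<le> m" if "q \<le> i" "i < p + m" for i
    using that
  proof (induction i rule: dec_induct)
    case base
    then show ?case using vle by simp
  next
    case (step i)
    then show ?case using vdec[of i] by (simp add: Suc_diff_le)
  qed
  have vb: "v j \<le> b j" for j
  proof (cases "q \<le> j \<and> j < p + m")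
    case True
    then show ?thesis using vle[of j] large[of j] by simp
  qed (auto simp: v_def)
  have supp: "{j. 0 < v j} = {p..<q} \<union> {q..<p + m}"
  proof (intro Set.set_eqI iffI)
    fix j assume "j \<in> {j. 0 < v j}"
    then show "j \<in> {p..<q} \<union> {q..<p + m}"
      using p(2)[of j] by (cases "j < p") (auto simp: v_def q(1) less_le_trans split: if_splits)
  next
    fix j assume "j \<in> {p..<q} \<union> {q..<p + m}"
    then show "j \<in> {j. 0 < v j}"
    proof
      assume "j \<in> {q..<p + m}"
      then show ?thesis using vdec[of j] by simp
    qed (use pos in \<open>simp add: v_def\<close>)
  qed
  have "bij_betw v {p..<q} (b ` {p..<q})"
    using inj by (auto simp: bij_betw_def v_def inj_on_def)
  moreover have "bij_betw v {q..<p + m} T"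
  proof -
    have "bij_betw (\<lambda>i. i - q) {q..<p + m} {..<card T}"
      by (rule bij_betw_byWitness[where f' = "\<lambda>i. i + q"]) (use cT in auto)
    then have "bij_betw (\<lambda>i. w (i - q)) {q..<p + m} T"
      using bij_betw_trans[OF _ w(1)] by (simp add: comp_def)
    then show ?thesis by (rule bij_betw_cong[THEN iffD1, rotated]) (auto simp: v_def)
  qed
  ultimately have "bij_betw v {j. 0 < v j} (b ` {p..<q} \<union> T)"
    unfolding supp by (rule bij_betw_combine) (auto simp: T_def)
  moreover have "b ` {p..<q} \<union> T = {1..m}" using sub by (auto simp: T_def)
  \<comment> \<open>The values decrease from \<open>q\<close> on, so a smaller value can precede a
    larger one only in a slice that is used up.\<close>
  moreover have "v j = b j" if "j < J" "v j < v J" for j J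
  proof (rule ccontr)
    assume "v j \<noteq> b j"
    then have j: "q \<le> j" by (auto simp: v_def not_less[symmetric])
    moreover have "J < p + m" using that qm by (auto simp: v_def split: if_splits)
    moreover have "j - q < J - q" "J - q < card T" using calculation that cT by linarith+
    ultimately show False using that w(2)[of "j - q" "J - q"] by (simp add: v_def)
  qed
  ultimately have "valid b m v" using vb by (auto simp: valid_def)
  moreover have "\<forall>i<q. v i = b i" "\<forall>i\<ge>p + m. v i = 0" using qm by (auto simp: v_def)
  ultimately show ?thesis using q(1) vdec vm by blast
qed

text \<open>The state during the reduction: \<open>p\<close> is the first slice that may be nonempty.  A slice that
  was never touched has its original length \<open>t + 1 - i\<close>, every reduction touching slice \<open>i\<close>
  increases \<open>b (i + 1) - b i\<close>.\<close>

definition slices :: "nat \<Rightarrow> nat \<Rightarrow> nat \<Rightarrow> (nat \<Rightarrow> nat) \<Rightarrow> bool" where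
  "slices t M p b \<longleftrightarrow> (\<forall>i<p. b i = 0) \<and> (\<forall>i. b i \<le> t + 1 - i) \<and>
     (\<forall>i\<ge>p. b i < b (i + 1) \<or> (b i \<le> b (i + 1) \<and> (M \<le> b i \<or> t + 1 - p \<le> b i + M)) \<or>
       (\<forall>i'\<ge>i. b i' = t + 1 - i'))"

text \<open>In a touched pair weak growth becomes strict. An untouched pair has difference -1 and
  becomes flat at worst; since \<open>v i \<le> m - (i - q)\<close>, at least
  \<open>t + 1 - q - m\<close> coefficients stay in slice \<open>i\<close>, which is the origin of
  the alternative \<open>t + 1 - p \<le> b i + M\<close>. The second case of \<open>mM\<close>
  serves the third point, whose multiplicity may exceed \<open>M\<close> but which touches only
  increasing slices.\<close>

lemma slices_step:
  assumes s: "slices t M p b" and v: "valid b m v" "p \<le> q"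
    "\<forall>i<q. v i = b i" "\<forall>i\<ge>p + m. v i = 0"
    "\<forall>i\<ge>q. i < p + m \<longrightarrow> v (i + 1) < v i \<and> v i + (i - q) \<le> m"
    and mM: "\<And>i. p \<le> i \<Longrightarrow> i < p + m \<Longrightarrow> m \<le> M \<or> b i \<le> b (i + 1)"
  shows "slices t M q (\<lambda>i. b i - v i)"
  unfolding slices_def
proof (intro conjI allI impI)
  show "b i - v i = 0" if "i < q" for i using v(3) that by simp
  show "b i - v i \<le> t + 1 - i" for i using s by (metis diff_le_self le_trans slices_def)
next
  fix i assume i: "q \<le> i"
  have vb: "v i \<le> b i" for i using v(1) by (simp add: valid_def)
  let ?g = "b i - v i < b (i + 1) - v (i + 1) \<or>
    b i - v i \<le> b (i + 1) - v (i + 1) \<and> (M \<le> b i - v i \<or> t + 1 - q \<le> b i - v i + M) \<or>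
    (\<forall>i'\<ge>i. b i' - v i' = t + 1 - i')"
  have cases: "b i < b (i + 1) \<or> (b i \<le> b (i + 1) \<and> (M \<le> b i \<or> t + 1 - p \<le> b i + M)) \<or>
       (\<forall>i'\<ge>i. b i' = t + 1 - i')" using s i v(2) by (auto simp: slices_def)
  show ?g
  proof (cases "i < p + m")
    case False
    then have "v i' = 0" if "i' \<ge> i" for i' using v(4) that by simp
    then show ?thesis using cases v(2) by fastforce
  next
    case True
    then have d: "v (i + 1) < v i" and e: "v i + (i - q) \<le> m" using v(5) i by auto
    show ?thesis
    proof (cases "b i \<le> b (i + 1)")
      case True
      then show ?thesis using d vb[of i] vb[of "i + 1"] by linarith
    next
      case False
      then have b: "b i = t + 1 - i" "b (i + 1) = t - i" using cases by auto
      moreover have "m \<le> M" using mM[of i] False True i v(2) by auto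
      ultimately show ?thesis using d e vb[of i] i by linarith
    qed
  qed
qed

lemma slices_mono:
  assumes s: "slices t M p b" and p: "p \<le> p'" "\<And>i. i < p' \<Longrightarrow> b i = 0"
  shows "slices t M p' b"
  unfolding slices_def
proof (intro conjI allI impI)
  fix i assume "p' \<le> i"
  moreover have "t + 1 - p' \<le> t + 1 - p" using p by simp
  ultimately show "b i < b (i + 1) \<or> (b i \<le> b (i + 1) \<and> (M \<le> b i \<or> t + 1 - p' \<le> b i + M)) \<or>
       (\<forall>i'\<ge>i. b i' = t + 1 - i')"
    using s p unfolding slices_def by (meson le_trans)
qed (use s p in \<open>auto simp: slices_def\<close>)

lemma slices_first:
  assumes "slices t M p b" "b j \<noteq> 0"
  obtains p' where "slices t M p' b" "0 < b p'" "\<And>i. i < p' \<Longrightarrow> b i = 0"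
proof -
  define p' where "p' = (LEAST i. b i \<noteq> 0)"
  have p': "b p' \<noteq> 0" unfolding p'_def by (rule LeastI[of _ j]) (fact assms(2))
  moreover have z: "b i = 0" if "i < p'" for i
    using not_less_Least[of i "\<lambda>i. b i \<noteq> 0"] that by (auto simp: p'_def)
  moreover have "p \<le> p'" using assms(1) p' by (metis not_less slices_def)
  ultimately show ?thesis using slices_mono[OF assms(1) _ z] that[of p'] by simp
qed

lemma sum_le_triangle:
  assumes "\<And>i. i < p \<Longrightarrow> b i = (0::nat)" "\<And>i. p \<le> i \<Longrightarrow> b i \<le> t + 1 - i"
  shows "2 * (\<Sum>i\<le>t. b i) \<le> (t + 1 - p) * (t + 2 - p)"
proof -
  have "(\<Sum>i\<le>t. b i) = (\<Sum>i\<in>{p..t}. b i)"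
    by (rule sum.mono_neutral_right) (use assms in auto)
  also have "\<dots> \<le> (\<Sum>i\<in>{p..t}. t + 1 - i)"
    by (rule sum_mono) (use assms in auto)
  also have "\<dots> = \<Sum>{1..t + 1 - p}"
    by (rule sum.reindex_bij_witness[of _ "\<lambda>i. t + 1 - i" "\<lambda>i. t + 1 - i"]) auto
  also have "2 * \<dots> \<le> (t + 1 - p) * (t + 2 - p)"
    using gauss_sum_from_Suc_0[of "t + 1 - p", where 'a=nat]
    by (cases "p \<le> t + 1") (auto simp: Suc_diff_le)
  finally show ?thesis by simp
qed

text \<open>A violation of the condition of \<open>valid_step\<close> confines the slices to a
  region with too few entries.\<close>

lemma slices_window:
  assumes s: "slices t M p b" and p: "0 < b p" and m: "1 \<le> m" "m \<le> M"
    and total: "3 * int M ^ 2 + 4 + int m * (int m + 1) \<le> 2 * int (\<Sum>i\<le>t. b i) + 7 * int M"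
    and j: "p \<le> j" "j + 1 < p + m" "b (j + 1) < m"
  shows "b j < b (j + 1)"
proof (rule ccontr)
  assume n: "\<not> b j < b (j + 1)"
  have b0: "\<And>i. i < p \<Longrightarrow> b i = 0" and bt: "\<And>i. b i \<le> t + 1 - i"
    using s by (auto simp: slices_def)
  have m2: "2 \<le> m" using j by linarith
  have *: "(b i < b (i + 1) \<or> (b i \<le> b (i + 1) \<and> (M \<le> b i \<or> t + 1 - p \<le> b i + M)) \<or>
       (\<forall>i'\<ge>i. b i' = t + 1 - i'))" if "p \<le> i" for i
    using s that by (auto simp: slices_def)
  \<comment> \<open>This settles the untouched tail: \<open>t - j < m\<close> and
    \<open>j + 1 < p + m\<close> confine all entries to a triangle of side
    \<open>2 * m - 2\<close>.\<close>
  have contra1: False if J: "t + 1 - p \<le> 2 * m - 2"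
  proof -
    have "2 * (\<Sum>i\<le>t. b i) \<le> (t + 1 - p) * (t + 2 - p)"
      by (rule sum_le_triangle) (use b0 bt in auto)
    also have "\<dots> \<le> (2 * m - 2) * (2 * m - 1)"
      by (rule mult_mono) (use J m2 in auto)
    finally have "2 * int (\<Sum>i\<le>t. b i) \<le> int ((2 * m - 2) * (2 * m - 1))"
      by (metis of_nat_le_iff of_nat_mult of_nat_numeral)
    also have "\<dots> = (2 * int m - 2) * (2 * int m - 1)"
      using m2 by (simp add: of_nat_diff)
    finally have "3 * int M ^ 2 + 4 + int m * (int m + 1) \<le> (2 * int m - 2) * (2 * int m - 1) + 7 * int M"
      using total by linarith
    then have "(int M - int m) * (3 * (int M + int m) - 7) + 2 \<le> 0"
      by (simp add: algebra_simps power2_eq_square)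
    moreover have "0 \<le> (int M - int m) * (3 * (int M + int m) - 7)"
      by (rule mult_nonneg_nonneg) (use m m2 in auto)
    ultimately show False by linarith
  qed
  show False
  proof (cases "\<forall>i'\<ge>j. b i' = t + 1 - i'")
    case True
    then have "b (j + 1) = t - j" by simp
    then have "t + 1 - p \<le> 2 * m - 2" using j by linarith
    then show False by (rule contra1)
  next
    case False
    then have bj: "b j = b (j + 1)" "t + 1 - p \<le> b j + M"
      using *[of j] n j m by auto
    have mono: "b i \<le> b (i + 1)" if "p \<le> i" "i \<le> j" for i
      using *[of i] False that by auto
    have mono': "b i \<le> b (i + d)" if "p \<le> i" "i + d \<le> j + 1" for i d
      using that(2)
    proof (induction d)
      case (Suc d)
      then show ?case using mono[of "i + d"] that(1) by simp
    qed simp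
    \<comment> \<open>At a flat pair the two slices \<open>p\<close> and \<open>p + 1\<close> are
      split off: by monotonicity they have at most \<open>b j \<le> m - 1\<close> entries each, far
      fewer than the enclosing triangle would allow. The others lie in a triangle of side
      \<open>M + m - 3\<close>.\<close>
    define c where "c i = (if i < p + 2 then 0 else b i)" for i
    have "(\<Sum>i\<le>t. b i) \<le> (\<Sum>i\<le>t. c i + (if i = p then b p else 0) + (if i = p + 1 then b (p + 1) else 0))"
      by (rule sum_mono) (use b0 in \<open>auto simp: c_def\<close>)
    also have "\<dots> \<le> (\<Sum>i\<le>t. c i) + b p + b (p + 1)"
      by (simp add: sum.distrib)
    also have "\<dots> \<le> (\<Sum>i\<le>t. c i) + 2 * b j"
      using mono'[of p "j - p"] mono'[of "p + 1" "j - p"] bj j by simp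
    finally have a: "(\<Sum>i\<le>t. b i) \<le> (\<Sum>i\<le>t. c i) + 2 * b j" .
    have "2 * (\<Sum>i\<le>t. c i) \<le> (t + 1 - (p + 2)) * (t + 2 - (p + 2))"
      by (rule sum_le_triangle) (use bt in \<open>auto simp: c_def\<close>)
    also have "\<dots> \<le> (M + m - 3) * (M + m - 2)"
      by (rule mult_mono) (use bj j m in auto)
    finally have "2 * (\<Sum>i\<le>t. b i) \<le> (M + m - 3) * (M + m - 2) + 4 * (m - 1)"
      using a bj j by linarith
    then have "2 * int (\<Sum>i\<le>t. b i) \<le> int ((M + m - 3) * (M + m - 2) + 4 * (m - 1))"
      by (metis of_nat_le_iff of_nat_mult of_nat_numeral)
    also have "\<dots> = (int M + int m - 3) * (int M + int m - 2) + 4 * (int m - 1)"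
      using m m2 by (simp add: of_nat_diff)
    finally have "3 * int M ^ 2 + 4 + int m * (int m + 1)
        \<le> (int M + int m - 3) * (int M + int m - 2) + 4 * (int m - 1) + 7 * int M"
      using total by linarith
    then have "2 * ((int M - 1) * (int M - int m)) + 2 \<le> 0"
      by (simp add: algebra_simps power2_eq_square)
    moreover have "0 \<le> (int M - 1) * (int M - int m)"
      by (rule mult_nonneg_nonneg) (use m m2 in auto)
    ultimately show False by linarith
  qed
qed

text \<open>Placing a point lowers both sides of the last hypothesis by \<open>m * (m + 1)\<close>,
  twice the number of its conditions, so the hypothesis is inherited by the remaining
  points.\<close>

lemma slices_reducible:
  assumes "slices t M p b" "\<And>m. m \<in> set ms \<Longrightarrow> 1 \<le> m \<and> m \<le> M" "1 \<le> M"
    "3 * int M ^ 2 + 4 + (\<Sum>m\<leftarrow>ms. int m * (int m + 1)) \<le> 2 * int (\<Sum>i\<le>t. b i) + 7 * int M"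
  shows "reducible b ms"
  using assms
proof (induction ms arbitrary: b p)
  case Nil
  show ?case by (rule reducible_Nil)
next
  case (Cons m ms)
  have m: "1 \<le> m" "m \<le> M" using Cons by auto
  have "0 \<le> (\<Sum>m\<leftarrow>ms. int m * (int m + 1))" by (rule sum_list_nonneg) auto
  then have total: "3 * int M ^ 2 + 4 + int m * (int m + 1) \<le> 2 * int (\<Sum>i\<le>t. b i) + 7 * int M"
    using Cons.prems(4) by simp
  have bt: "b i = 0" if "t < i" for i
    using Cons.prems(1) that by (metis Suc_eq_plus1 Suc_leI diff_is_0_eq' le_zero_eq slices_def)
  \<comment> \<open>This guarantees a nonempty slice to start from, even for \<open>M = 1\<close>
    and \<open>M = 2\<close>, where the bound without \<open>m * (m + 1)\<close> is at its
    smallest.\<close>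
  have "0 < 3 * int M ^ 2 - 7 * int M + 6"
  proof (cases "M = 1")
    case False
    then have "0 \<le> (int M - 2) * (3 * int M - 1)" using m by (intro mult_nonneg_nonneg) auto
    then show ?thesis by (simp add: algebra_simps power2_eq_square)
  qed simp
  moreover have "2 \<le> int m * (int m + 1)"
    using m mult_mono[of 1 "int m" 2 "int m + 1"] by simp
  ultimately have "(\<Sum>i\<le>t. b i) \<noteq> 0" using total by linarith
  then obtain j where "b j \<noteq> 0" by (metis sum.neutral)
  then obtain p' where p': "slices t M p' b" "0 < b p'" "\<And>i. i < p' \<Longrightarrow> b i = 0"
    using slices_first[OF Cons.prems(1)] by blast
  have "\<exists>v q. valid b m v \<and> p' \<le> q \<and> (\<forall>i<q. v i = b i) \<and> (\<forall>i\<ge>p' + m. v i = 0) \<and>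
    (\<forall>i\<ge>q. i < p' + m \<longrightarrow> v (i + 1) < v i \<and> v i + (i - q) \<le> m)"
    by (rule valid_step[of m b p', OF m(1) p'(2) p'(3) slices_window[OF p'(1,2) m total]])
  then obtain v q where v: "valid b m v" and q: "p' \<le> q" "\<forall>i<q. v i = b i"
    "\<forall>i\<ge>p' + m. v i = 0" "\<forall>i\<ge>q. i < p' + m \<longrightarrow> v (i + 1) < v i \<and> v i + (i - q) \<le> m"
    by blast
  have s': "slices t M q (\<lambda>i. b i - v i)"
    by (rule slices_step[OF p'(1) v q]) (use m in auto)
  have "reducible (\<lambda>i. b i - v i) ms"
    by (intro Cons.IH[OF s']) (use Cons.prems valid_sum_diff[OF v bt] in auto)
  then show ?case by (rule reducible_Cons[OF v])
qed

section \<open>The first three points, starting from the triangle of all monomials\<close>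

lemma valid_decreasing:
  assumes "\<And>j. j < m \<Longrightarrow> m - j \<le> b j"
  shows "valid b m (\<lambda>j. m - j)"
proof -
  have "bij_betw (\<lambda>j. m - j) {j. 0 < m - j} {1..m}"
    by (rule bij_betw_byWitness[where f' = "\<lambda>j. m - j"]) auto
  moreover have "m - j \<le> b j" for j using assms[of j] by (cases "j < m") auto
  ultimately show ?thesis by (auto simp: valid_def)
qed

text \<open>The first two points take \<open>m1 - j\<close> and \<open>m2 - j\<close> from slice
  \<open>j\<close>, leaving \<open>t + 1 - m1 - m2 + j\<close> for \<open>j < m2\<close>. This
  increases and is positive at \<open>j = 0\<close> because \<open>m1 + m2 \<le> t\<close>, so
  \<open>valid_step\<close> applies to the third point directly. Only then does the estimate in
  terms of \<open>M\<close> take over.\<close>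

lemma triangle_reducible:
  assumes m: "m2 \<le> m1" "m3 \<le> m2" "M \<le> m3" "1 \<le> M" and t: "m1 + m2 \<le> t"
    and ms: "\<And>m. m \<in> set ms \<Longrightarrow> 1 \<le> m \<and> m \<le> M"
    and total: "3 * int M ^ 2 + 4 + (\<Sum>m\<leftarrow>m1 # m2 # m3 # ms. int m * (int m + 1))
      \<le> (int t + 1) * (int t + 2) + 7 * int M"
  shows "reducible (\<lambda>j. t + 1 - j) (m1 # m2 # m3 # ms)"
proof -
  let ?b0 = "\<lambda>j. t + 1 - j" and ?b1 = "\<lambda>j. t + 1 - j - (m1 - j)"
  let ?b2 = "\<lambda>j. t + 1 - j - (m1 - j) - (m2 - j)"
  have v1: "valid ?b0 m1 (\<lambda>j. m1 - j)" by (rule valid_decreasing) (use t in auto)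
  have v2: "valid ?b1 m2 (\<lambda>j. m2 - j)" by (rule valid_decreasing) (use t m in auto)
  have inc: "?b2 j < ?b2 (j + 1)" if "j < m2" for j using that m t by auto
  have "\<exists>v q. valid ?b2 m3 v \<and> 0 \<le> q \<and> (\<forall>i<q. v i = ?b2 i) \<and> (\<forall>i\<ge>0 + m3. v i = 0) \<and>
    (\<forall>i\<ge>q. i < 0 + m3 \<longrightarrow> v (i + 1) < v i \<and> v i + (i - q) \<le> m3)"
    by (rule valid_step[of m3 ?b2 0]) (use inc m t in auto)
  then obtain v q where v3: "valid ?b2 m3 v" and q: "0 \<le> q" "\<forall>i<q. v i = ?b2 i"
    "\<forall>i\<ge>0 + m3. v i = 0" "\<forall>i\<ge>q. i < 0 + m3 \<longrightarrow> v (i + 1) < v i \<and> v i + (i - q) \<le> m3"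
    by blast
  have "slices t M 0 ?b2"
    unfolding slices_def
  proof (intro conjI allI impI)
    fix i
    consider "i < m2" | "m2 \<le> i" "i < m1" | "m1 \<le> i" by linarith
    then show "?b2 i < ?b2 (i + 1) \<or> (?b2 i \<le> ?b2 (i + 1) \<and> (M \<le> ?b2 i \<or> t + 1 - 0 \<le> ?b2 i + M)) \<or>
       (\<forall>i'\<ge>i. ?b2 i' = t + 1 - i')"
    proof cases
      case 1
      then show ?thesis using inc by blast
    next
      \<comment> \<open>These slices are touched by the first point alone and form a plateau. The
        alternative \<open>M \<le> b i\<close> in \<open>slices\<close> is there for them.\<close>
      case 2
      then have "?b2 i = t + 1 - m1" "?b2 (i + 1) = t + 1 - m1" using t m by simp_all
      moreover have "M \<le> t + 1 - m1" using t m by simp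
      ultimately show ?thesis by simp
    next
      case 3
      then have "?b2 i' = t + 1 - i'" if "i \<le> i'" for i' using that m by simp
      then show ?thesis by blast
    qed
  qed simp_all
  then have s: "slices t M q (\<lambda>i. ?b2 i - v i)"
  proof (rule slices_step[OF _ v3 q])
    show "m3 \<le> M \<or> ?b2 i \<le> ?b2 (i + 1)" if "i < 0 + m3" for i
      using inc[of i] that m by (intro disjI2 less_imp_le) simp
  qed
  have "2 * int (\<Sum>j\<le>t. ?b0 j) = (int t + 1) * (int t + 2)"
  proof -
    have "(\<Sum>j\<le>t. ?b0 j) = \<Sum>{1..t + 1}"
      by (rule sum.reindex_bij_witness[of _ "\<lambda>i. t + 1 - i" "\<lambda>i. t + 1 - i"]) auto
    then have "2 * (\<Sum>j\<le>t. ?b0 j) = (t + 1) * (t + 2)"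
      using gauss_sum_from_Suc_0[of "t + 1", where 'a=nat] by simp
    then have "int (2 * (\<Sum>j\<le>t. ?b0 j)) = int ((t + 1) * (t + 2))" by (rule arg_cong)
    then show ?thesis unfolding of_nat_add of_nat_mult by simp
  qed
  moreover note valid_sum_diff[OF v1, of t] valid_sum_diff[OF v2, of t] valid_sum_diff[OF v3, of t]
  ultimately have "3 * int M ^ 2 + 4 + (\<Sum>m\<leftarrow>ms. int m * (int m + 1))
      \<le> 2 * int (\<Sum>i\<le>t. ?b2 i - v i) + 7 * int M" using total by simp
  then have "reducible (\<lambda>i. ?b2 i - v i) ms"
    by (intro slices_reducible[OF s _ m(4)]) (use ms in auto)
  then show ?thesis by (intro reducible_Cons[OF v1] reducible_Cons[OF v2] reducible_Cons[OF v3])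
qed

section \<open>Degenerating one point\<close>

lemma higher_pderiv_power_mult:
  fixes g :: "complex poly"
  shows "i < l \<Longrightarrow> poly ((pderiv ^^ i) ([:-a, 1:] ^ l * g)) a = 0"
    and "poly ((pderiv ^^ l) ([:-a, 1:] ^ l * g)) a = fact l * poly g a"
proof (induction l arbitrary: g i)
  case (Suc l)
  have "pderiv ([:-a, 1:] ^ Suc l * g) = [:-a, 1:] ^ l * (smult (of_nat (Suc l)) g + [:-a, 1:] * pderiv g)"
    for g :: "complex poly"
    by (simp add: pderiv_mult pderiv_power_Suc pderiv_pCons algebra_simps del: power_Suc)
      (simp add: algebra_simps)
  then have d: "(pderiv ^^ Suc k) ([:-a, 1:] ^ Suc l * g) =
      (pderiv ^^ k) ([:-a, 1:] ^ l * (smult (of_nat (Suc l)) g + [:-a, 1:] * pderiv g))" for k and g :: "complex poly"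
    by (simp only: funpow_Suc_right o_apply)
  {
    case 1
    show ?case
    proof (cases "i = 0")
      case False
      then obtain k where k: "i = Suc k" "k < l" using 1 by (cases i) auto
      show ?thesis unfolding k(1) d by (rule Suc.IH(1)[OF k(2)])
    qed simp
  next
    case 2
    show ?case unfolding d Suc.IH(2) by (simp add: algebra_simps)
  }
qed auto

text \<open>Once \<open>(x - a)^v\<close> is split off, the derivative of order \<open>v\<close> at
  \<open>a\<close> is \<open>v!\<close> times the value of the cofactor times
  \<open>poly g a\<close>, so the cofactor vanishes at \<open>a\<close> too.\<close>

lemma power_dvd_if_higher_pderivs_zero:
  fixes g h :: "complex poly"
  assumes "poly g a \<noteq> 0" "\<And>i. i < v \<Longrightarrow> poly ((pderiv ^^ i) (g * h)) a = 0"
  shows "[:-a, 1:] ^ v dvd h"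
  using assms(2)
proof (induction v)
  case (Suc v)
  then obtain q where q: "h = [:-a, 1:] ^ v * q" by (auto elim: dvdE)
  have "poly ((pderiv ^^ v) ([:-a, 1:] ^ v * (g * q))) a = 0"
    using Suc.prems[of v] by (simp add: q mult_ac)
  then have "poly q a = 0"
    using assms(1) by (simp add: higher_pderiv_power_mult(2))
  then have "[:-a, 1:] dvd q" by (simp add: poly_eq_0_iff_dvd)
  then show ?case unfolding q power_Suc2 by (rule mult_dvd_mono[OF dvd_refl])
qed simp

lemma triangular_solve:
  fixes M :: "nat \<Rightarrow> nat \<Rightarrow> 'a::field"
  assumes "\<And>l. l < w \<Longrightarrow> M l l \<noteq> 0" "\<And>i l. i < l \<Longrightarrow> M i l = 0"
  shows "\<exists>d. \<forall>l<w. y l = (\<Sum>i<w. d i * M i l)"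
  using assms(1)
proof (induction w arbitrary: y)
  case (Suc w)
  define e where "e = y w / M w w"
  obtain d where d: "\<And>l. l < w \<Longrightarrow> y l - e * M w l = (\<Sum>i<w. d i * M i l)"
    using Suc.IH[of "\<lambda>l. y l - e * M w l"] Suc.prems by auto
  have "y l = (\<Sum>i<Suc w. (d(w := e)) i * M i l)" if "l < Suc w" for l
  proof (cases "l = w")
    case True
    then show ?thesis using Suc.prems[of w] assms(2) by (simp add: e_def)
  next
    case False
    then show ?thesis using d[of l] that by (simp add: algebra_simps)
  qed
  then show ?case by blast
qed simp

section \<open>Linear functionals on univariate polynomials\<close>

definition linear_functional :: "(complex poly \<Rightarrow> complex) \<Rightarrow> bool" where
  "linear_functional f \<longleftrightarrow> (\<forall>p q. f (p + q) = f p + f q) \<and> (\<forall>c p. f (smult c p) = c * f p)"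

lemma linear_functional_0: "linear_functional f \<Longrightarrow> f 0 = 0"
  unfolding linear_functional_def by (metis mult_zero_left smult_0_left)

lemma linear_functional_sum:
  assumes "linear_functional f"
  shows "f (\<Sum>i\<in>A. p i) = (\<Sum>i\<in>A. f (p i))"
  using assms linear_functional_0[OF assms]
  by (induction A rule: infinite_finite_induct) (auto simp: linear_functional_def)

lemma linear_functional_higher_pderiv:
  "linear_functional (\<lambda>f. poly ((pderiv ^^ i) f) a)"
proof -
  have "(pderiv ^^ i) (p + q) = (pderiv ^^ i) p + (pderiv ^^ i) q" for p q :: "complex poly"
    by (induction i) (simp_all add: pderiv_add)
  moreover have "(pderiv ^^ i) (smult c p) = smult c ((pderiv ^^ i) p)" for c and p :: "complex poly"
    by (induction i) (simp_all add: pderiv_smult)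
  ultimately show ?thesis by (simp add: linear_functional_def)
qed

text \<open>Degree less than \<open>c\<close>, stated by coefficients so that an empty slice,
  \<open>c = 0\<close>, forces the zero polynomial.\<close>

definition pdeg :: "nat \<Rightarrow> complex poly \<Rightarrow> bool" where
  "pdeg c h \<longleftrightarrow> (\<forall>i\<ge>c. coeff h i = 0)"

lemma pdeg_0: "pdeg 0 h \<longleftrightarrow> h = 0"
  by (auto simp: pdeg_def poly_eq_iff)

lemma pdeg_sum: "pdeg c h \<Longrightarrow> h = (\<Sum>l<c. monom (coeff h l) l)"
  by (auto simp: pdeg_def poly_eq_iff coeff_sum not_less coeff_monom if_distrib cong: if_cong)

lemma pdeg_cofactor:
  assumes "pdeg c ([:-a, 1:] ^ v * h)"
  shows "pdeg (c - v) h"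
proof (cases "h = 0")
  case False
  let ?p = "[:-a, 1:] ^ v * h"
  have "?p \<noteq> 0" using False by simp
  then have "coeff ?p (degree ?p) \<noteq> 0" by simp
  then have "degree ?p < c" using assms by (metis linorder_not_le pdeg_def)
  moreover have "degree ?p = v + degree h"
    using False by (simp add: degree_mult_eq degree_power_eq)
  ultimately show ?thesis by (auto simp: pdeg_def intro: coeff_eq_0)
qed (simp add: pdeg_def)

text \<open>The powers of \<open>x - a\<close> below \<open>w\<close> span the polynomials of degree
  less than \<open>w\<close>; the induction peels off one factor by division with remainder.\<close>

lemma linear_functional_vanishes:
  assumes "linear_functional f" "\<And>l. l < w \<Longrightarrow> f ([:-a, 1:] ^ l) = 0" "pdeg w h"
  shows "f h = 0"
  using assms
proof (induction w arbitrary: f h)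
  case 0
  then show ?case by (simp add: pdeg_0 linear_functional_0)
next
  case (Suc w)
  have "poly (h - [:poly h a:]) a = 0" by simp
  then have "[:-a, 1:] dvd h - [:poly h a:]" by (simp only: poly_eq_0_iff_dvd)
  then obtain q where "h - [:poly h a:] = [:-a, 1:] * q" by (rule dvdE)
  then have q: "h = [:-a, 1:] * q + [:poly h a:]" by (simp only: diff_eq_eq)
  have "pdeg (Suc w) ([:-a, 1:] ^ 1 * q)"
  proof -
    have "[:-a, 1:] ^ 1 * q = h - [:poly h a:]"
      using q by (simp only: power_one_right eq_diff_eq)
    then show ?thesis using Suc.prems(3) by (auto simp: pdeg_def coeff_pCons split: nat.splits)
  qed
  then have "pdeg w q" using pdeg_cofactor[of "Suc w" a 1 q] by simp
  moreover have "linear_functional (\<lambda>p. f ([:-a, 1:] * p))"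
    using Suc.prems(1) by (simp only: linear_functional_def distrib_left mult_smult_right) simp
  moreover have "f ([:-a, 1:] * [:-a, 1:] ^ l) = 0" if "l < w" for l
    using Suc.prems(2)[of "Suc l"] that by simp
  ultimately have "f ([:-a, 1:] * q) = 0" by (rule Suc.IH[rotated 2])
  moreover have "f [:poly h a:] = 0"
  proof -
    have "[:poly h a:] = smult (poly h a) ([:-a, 1:] ^ 0)" by simp
    then show ?thesis using Suc.prems(1) Suc.prems(2)[of 0]
      by (metis linear_functional_def mult_zero_right zero_less_Suc)
  qed
  ultimately show ?case using Suc.prems(1) q by (metis add_0 linear_functional_def)
qed

text \<open>The conditions on \<open>F = \<Sum>j. y\<^sup>j F\<^sub>j(x)\<close> imposed by an \<open>m\<close>-fold point at \<open>(a, b)\<close>, expressed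
  by the operators \<open>\<partial>\<^sub>x\<close> and \<open>y \<partial>\<^sub>y - r\<close>.\<close>

definition fat_point_conditions ::
    "nat \<Rightarrow> nat \<Rightarrow> complex \<Rightarrow> complex \<Rightarrow> (nat \<Rightarrow> complex poly) \<Rightarrow> bool" where
  "fat_point_conditions t m a b F \<longleftrightarrow> (\<forall>i R. finite R \<longrightarrow> i + card R < m \<longrightarrow>
     (\<Sum>j\<le>t. (\<Prod>r\<in>R. of_nat j - of_nat r) * b ^ j * poly ((pderiv ^^ i) (F j)) a) = 0)"

lemma valid_greater:
  assumes "valid c m v" "w \<le> m"
  shows "finite {r. w < v r}" "card {r. w < v r} = m - w"
proof -
  have "bij_betw v {r. w < v r} (v ` {r. w < v r})"
    using assms(1) by (auto simp: valid_def bij_betw_def intro: inj_on_subset)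
  moreover have "v ` {r. w < v r} = {w<..m}"
  proof
    show "v ` {r. w < v r} \<subseteq> {w<..m}"
      using assms(1) by (force simp: valid_def bij_betw_def)
    show "{w<..m} \<subseteq> v ` {r. w < v r}"
    proof
      fix x assume x: "x \<in> {w<..m}"
      then have "x \<in> v ` {j. 0 < v j}" using assms(1) by (auto simp: valid_def bij_betw_def)
      then show "x \<in> v ` {r. w < v r}" using x by auto
    qed
  qed
  ultimately have b: "bij_betw v {r. w < v r} {w<..m}" by simp
  show "finite {r. w < v r}" using bij_betw_finite[OF b] by simp
  show "card {r. w < v r} = m - w" using bij_betw_same_card[OF b] by simp
qed

text \<open>Descending through the values of \<open>v\<close>, the contribution of every slice before \<open>J\<close> is cancelled:
  a slice with a larger value by a factor of the multiplier that vanishes at its index, a slice with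
  a smaller value because it is used up completely.\<close>

lemma leading_functional:
  assumes v: "valid c m v" and i0: "i0 < v J" and g: "\<And>j. poly (g j) a \<noteq> 0"
  shows "\<exists>L. (\<forall>j. linear_functional (L j)) \<and>
    (\<forall>b F. fat_point_conditions t m a b F \<longrightarrow> (\<Sum>j\<le>t. b ^ j * L j (F j)) = 0) \<and>
    (\<forall>f. L J f = poly ((pderiv ^^ i0) f) a) \<and>
    (\<forall>j<J. \<forall>h. pdeg (c j) h \<longrightarrow> L j (g j * h) = 0)"
proof -
  have vb: "\<And>j. v j \<le> c j" and full: "\<And>j. j < J \<Longrightarrow> v j < v J \<Longrightarrow> v j = c j"
    and bij: "bij_betw v {j. 0 < v j} {1..m}"
    using v by (auto simp: valid_def)
  have vm: "v j \<le> m" for j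
  proof (cases "0 < v j")
    case True
    then show ?thesis using bij_betwE[OF bij] by auto
  qed simp
  have inj: "j = j'" if "v j = v j'" "0 < v j" for j j'
    using bij that by (auto simp: bij_betw_def inj_on_def)
  \<comment> \<open>This multiplier vanishes on the slices with value above \<open>w\<close> and is
    1 at \<open>j'\<close> if \<open>v j' \<le> w\<close>. It consumes \<open>m - w\<close> of the
    available orders, so derivatives of order less than \<open>w\<close> can still be taken.\<close>
  define q where "q w j' j = (\<Prod>r\<in>{r. w < v r}. of_nat j - of_nat r) /
    (\<Prod>r\<in>{r. w < v r}. of_nat j' - of_nat r :: complex)" for w j' j
  have q0: "q w j' j = 0" if "w < v j" "w \<le> m" for w j' j
    using valid_greater(1)[OF v that(2)] that by (auto simp: q_def)
  have q1: "q w j j = 1" if "v j \<le> w" "w \<le> m" for w j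
    using valid_greater(1)[OF v that(2)] that by (auto simp: q_def)
  have avail: "(\<Sum>j\<le>t. b ^ j * (q w j' j * poly ((pderiv ^^ i) (F j)) a)) = 0"
    if F: "fat_point_conditions t m a b F" and i: "i < w" "w \<le> m" for b F w j' i
  proof -
    have "(\<Sum>j\<le>t. (\<Prod>r\<in>{r. w < v r}. of_nat j - of_nat r) * b ^ j * poly ((pderiv ^^ i) (F j)) a) = 0"
      using F valid_greater[OF v i(2)] i by (auto simp: fat_point_conditions_def)
    moreover have "(\<Sum>j\<le>t. b ^ j * (q w j' j * poly ((pderiv ^^ i) (F j)) a)) =
      (\<Sum>j\<le>t. (\<Prod>r\<in>{r. w < v r}. of_nat j - of_nat r) * b ^ j * poly ((pderiv ^^ i) (F j)) a) /
      (\<Prod>r\<in>{r. w < v r}. of_nat j' - of_nat r :: complex)"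
      unfolding sum_divide_distrib by (rule sum.cong) (simp_all add: q_def)
    ultimately show ?thesis by simp
  qed
  let ?Q = "\<lambda>w L. (\<forall>j. linear_functional (L j)) \<and>
    (\<forall>b F. fat_point_conditions t m a b F \<longrightarrow> (\<Sum>j\<le>t. b ^ j * L j (F j)) = 0) \<and>
    (\<forall>f. L J f = poly ((pderiv ^^ i0) f) a) \<and>
    (\<forall>j<J. \<forall>h. w \<le> v j \<longrightarrow> pdeg (c j) h \<longrightarrow> L j (g j * h) = 0)"
  have "\<exists>L. ?Q w L" if "w \<le> v J" for w
    using that
  proof (induction w rule: inc_induct)
    case base
    define L where "L j f = q (v J) J j * poly ((pderiv ^^ i0) f) a" for j f
    have "linear_functional (L j)" for j
      using linear_functional_higher_pderiv[of i0 a]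
      by (simp add: linear_functional_def L_def algebra_simps)
    moreover have "(\<Sum>j\<le>t. b ^ j * L j (F j)) = 0" if "fat_point_conditions t m a b F" for b F
      unfolding L_def by (rule avail[OF that i0 vm])
    moreover have "L J f = poly ((pderiv ^^ i0) f) a" for f
      by (simp add: L_def q1 vm)
    moreover have "L j (g j * h) = 0" if "j < J" "v J \<le> v j" for j h
    proof -
      have "v j \<noteq> v J" using inj[of J j] i0 that(1) by auto
      then show ?thesis using q0[of "v J" j] vm that(2) by (simp add: L_def)
    qed
    ultimately show ?case by blast
  next
    case (step w)
    then obtain L where L: "\<And>j. linear_functional (L j)"
      "\<And>b F. fat_point_conditions t m a b F \<Longrightarrow> (\<Sum>j\<le>t. b ^ j * L j (F j)) = 0"
      "\<And>f. L J f = poly ((pderiv ^^ i0) f) a"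
      "\<And>j h. j < J \<Longrightarrow> Suc w \<le> v j \<Longrightarrow> pdeg (c j) h \<Longrightarrow> L j (g j * h) = 0" by blast
    have wm: "w \<le> m" using step(2) vm[of J] by linarith
    show ?case
    proof (cases "\<exists>j'<J. v j' = w \<and> 0 < w")
      case False
      have "L j (g j * h) = 0" if j: "j < J" "w \<le> v j" "pdeg (c j) h" for j h
      proof (cases "v j = w")
        case True
        then have "c j = 0" using False full[of j] j(1) step(2) by auto
        then show ?thesis using j(3) linear_functional_0[OF L(1)] by (simp add: pdeg_0)
      qed (use L(4) j in auto)
      then show ?thesis using L(1-3) by blast
    next
      case True
      then obtain j' where j': "j' < J" "v j' = w" "0 < w" by blast
      then have cw: "c j' = w" using full[of j'] step(2) by simp
      let ?M = "\<lambda>i l. poly ((pderiv ^^ i) ([:-a, 1:] ^ l * g j')) a"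
      obtain d where d: "\<And>l. l < w \<Longrightarrow> L j' (g j' * [:-a, 1:] ^ l) = (\<Sum>i<w. d i * ?M i l)"
        using triangular_solve[of w ?M "\<lambda>l. L j' (g j' * [:-a, 1:] ^ l)"] g
        by (auto simp: higher_pderiv_power_mult)
      \<comment> \<open>Slice \<open>j'\<close> is used up and has just \<open>w\<close>
        coefficients, so the \<open>w\<close> derivatives of order below \<open>w\<close> suffice to
        cancel its contribution. The factor \<open>q w j'\<close> keeps the slices with larger
        values, \<open>J\<close> among them, as they were.\<close>
      define L' where "L' j f = L j f - q w j' j * (\<Sum>i<w. d i * poly ((pderiv ^^ i) f) a)" for j f
      have lin: "linear_functional (L' j)" for j
        using L(1)[of j] linear_functional_higher_pderiv[of _ a]
        by (simp add: linear_functional_def L'_def algebra_simps sum.distrib sum_distrib_left)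
      moreover have "(\<Sum>j\<le>t. b ^ j * L' j (F j)) = 0" if F: "fat_point_conditions t m a b F" for b F
      proof -
        have "(\<Sum>j\<le>t. b ^ j * L' j (F j)) = (\<Sum>j\<le>t. b ^ j * L j (F j)) -
          (\<Sum>j\<le>t. \<Sum>i<w. d i * (b ^ j * (q w j' j * poly ((pderiv ^^ i) (F j)) a)))"
          unfolding sum_subtractf[symmetric]
          by (rule sum.cong) (auto simp: L'_def algebra_simps sum_distrib_left)
        also have "(\<Sum>j\<le>t. \<Sum>i<w. d i * (b ^ j * (q w j' j * poly ((pderiv ^^ i) (F j)) a))) =
          (\<Sum>i<w. d i * (\<Sum>j\<le>t. b ^ j * (q w j' j * poly ((pderiv ^^ i) (F j)) a)))"
          by (subst sum.swap) (simp add: sum_distrib_left)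
        also have "\<dots> = 0" using avail[OF F _ wm] by simp
        finally show ?thesis using L(2)[OF F] by simp
      qed
      moreover have "L' J f = poly ((pderiv ^^ i0) f) a" for f
        using q0[of w J] step(2) wm by (simp add: L'_def L(3))
      moreover have "L' j (g j * h) = 0" if j: "j < J" "w \<le> v j" "pdeg (c j) h" for j h
      proof (cases "v j = w")
        case False
        then show ?thesis using q0[of w j] wm j L(4) by (simp add: L'_def)
      next
        case True
        then have [simp]: "j = j'" using inj[of j j'] j' by simp
        show ?thesis
        proof (rule linear_functional_vanishes[of "\<lambda>h. L' j (g j * h)" w a])
          show "linear_functional (\<lambda>h. L' j (g j * h))"
            using lin by (simp add: linear_functional_def distrib_left)
          show "L' j (g j * [:- a, 1:] ^ l) = 0" if "l < w" for l
            using d[OF that] q1[of j' w] j' wm by (simp add: L'_def mult.commute)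
          show "pdeg w h" using j cw by simp
        qed
      qed
      ultimately show ?thesis by blast
    qed
  qed
  from this[of 0] show ?thesis by simp
qed

section \<open>Passage to the limit \<open>b = 0\<close>\<close>

lemma convergent_subsequence_finite:
  fixes f :: "nat \<Rightarrow> 'i \<Rightarrow> complex"
  assumes "finite I" "\<And>k i. i \<in> I \<Longrightarrow> cmod (f k i) \<le> B"
  shows "\<exists>r \<kappa>. strict_mono r \<and> (\<forall>i\<in>I. (\<lambda>k. f (r k) i) \<longlonglongrightarrow> \<kappa> i)"
  using assms
proof (induction I rule: finite_induct)
  case empty
  then show ?case by (intro exI[of _ id]) (simp add: strict_mono_def)
next
  case (insert x I)
  have "\<exists>r \<kappa>. strict_mono r \<and> (\<forall>i\<in>I. (\<lambda>k. f (r k) i) \<longlonglongrightarrow> \<kappa> i)"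
    by (rule insert.IH) (use insert.prems in auto)
  then obtain r \<kappa> where r: "strict_mono r" "\<And>i. i \<in> I \<Longrightarrow> (\<lambda>k. f (r k) i) \<longlonglongrightarrow> \<kappa> i" by blast
  have "bounded (range (\<lambda>k. f (r k) x))"
    using insert.prems by (intro boundedI[of _ B]) auto
  then obtain l r' where r': "strict_mono r'" "((\<lambda>k. f (r k) x) \<circ> r') \<longlonglongrightarrow> l"
    using bounded_imp_convergent_subsequence by blast
  have "(\<lambda>k. f ((r \<circ> r') k) i) \<longlonglongrightarrow> (\<kappa>(x := l)) i" if "i \<in> insert x I" for i
  proof (cases "i = x")
    case True
    then show ?thesis using r'(2) by (simp add: comp_def)
  next
    case False
    then show ?thesis using LIMSEQ_subseq_LIMSEQ[OF r(2)[of i] r'(1)] that by (simp add: comp_def)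
  qed
  then show ?case using strict_mono_o[OF r(1) r'(1)] by blast
qed

text \<open>If nonzero solutions existed for all \<open>b = 1 / (k + 1)\<close>, they could be
  scaled to norm 1 and a subsequence would converge to a nonzero \<open>h\<close>. The leading
  functionals show that \<open>h j\<close> is divisible by \<open>(x - a)^(v j)\<close>, and by
  \<open>rest\<close> the quotients are zero. The polynomials \<open>g j\<close> carry the factors
  from points degenerated earlier.\<close>

lemma degenerate_point:
  assumes v: "valid c m v" and c: "\<And>j. t < j \<Longrightarrow> c j = 0" and g: "\<And>j. poly (g j) a \<noteq> 0"
    and rest: "\<And>h. (\<And>j. pdeg (c j - v j) (h j)) \<Longrightarrow>
      (\<And>p. p < n \<Longrightarrow> fat_point_conditions t (ms p) (as p) (bs p) (\<lambda>j. g j * [:-a, 1:] ^ v j * h j)) \<Longrightarrow>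
      (\<And>j. h j = 0)"
  shows "\<exists>b. \<forall>h. (\<forall>j. pdeg (c j) (h j)) \<longrightarrow> fat_point_conditions t m a b (\<lambda>j. g j * h j) \<longrightarrow>
    (\<forall>p<n. fat_point_conditions t (ms p) (as p) (bs p) (\<lambda>j. g j * h j)) \<longrightarrow> (\<forall>j. h j = 0)"
proof (rule ccontr)
  assume neg: "\<not> ?thesis"
  define \<beta> where "\<beta> k = (1 / of_nat (Suc k) :: complex)" for k
  have "\<forall>k. \<exists>h. (\<forall>j. pdeg (c j) (h j)) \<and> fat_point_conditions t m a (\<beta> k) (\<lambda>j. g j * h j) \<and>
    (\<forall>p<n. fat_point_conditions t (ms p) (as p) (bs p) (\<lambda>j. g j * h j)) \<and> (\<exists>j. h j \<noteq> 0)"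
    using neg by blast
  then obtain H where H: "\<And>k j. pdeg (c j) (H k j)"
    "\<And>k. fat_point_conditions t m a (\<beta> k) (\<lambda>j. g j * H k j)"
    "\<And>k p. p < n \<Longrightarrow> fat_point_conditions t (ms p) (as p) (bs p) (\<lambda>j. g j * H k j)"
    "\<And>k. \<exists>j. H k j \<noteq> 0" by metis
  define I where "I = Sigma {..t} (\<lambda>j. {..<c j})"
  have fI: "finite I" by (simp add: I_def)
  define S where "S k = (\<Sum>(j, l)\<in>I. cmod (coeff (H k j) l))" for k
  have Spos: "0 < S k" for k
  proof -
    obtain j l where jl: "coeff (H k j) l \<noteq> 0" using H(4)[of k] by (metis leading_coeff_0_iff)
    then have "l < c j" using H(1)[of j k] by (metis not_less pdeg_def)
    moreover from this have "j \<le> t" using c[of j] by (cases "t < j") auto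
    ultimately have "(j, l) \<in> I" by (simp add: I_def)
    then show ?thesis unfolding S_def using jl fI
      by (intro sum_pos2[of I "(j, l)"]) auto
  qed
  define H' where "H' k j = smult (of_real (1 / S k)) (H k j)" for k j
  have cond_smult: "fat_point_conditions t m a b (\<lambda>j. g j * smult s (h j))"
    if "fat_point_conditions t m a b (\<lambda>j. g j * h j)" for m a b s h
  proof -
    have e: "(pderiv ^^ i) (smult s p) = smult s ((pderiv ^^ i) p)" for i and p :: "complex poly"
      by (induction i) (simp_all add: pderiv_smult)
    have "(\<Sum>j\<le>t. (\<Prod>r\<in>R. of_nat j - of_nat r) * b ^ j * poly ((pderiv ^^ i) (g j * smult s (h j))) a) =
      s * (\<Sum>j\<le>t. (\<Prod>r\<in>R. of_nat j - of_nat r) * b ^ j * poly ((pderiv ^^ i) (g j * h j)) a)" for i and R :: "nat set"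
      unfolding sum_distrib_left by (rule sum.cong) (simp_all add: e algebra_simps)
    then show ?thesis using that by (simp add: fat_point_conditions_def)
  qed
  have H'1: "pdeg (c j) (H' k j)" for k j using H(1) by (simp add: H'_def pdeg_def)
  have H'2: "fat_point_conditions t m a (\<beta> k) (\<lambda>j. g j * H' k j)" for k
    unfolding H'_def by (rule cond_smult) (rule H(2))
  have H'3: "fat_point_conditions t (ms p) (as p) (bs p) (\<lambda>j. g j * H' k j)" if "p < n" for k p
    unfolding H'_def by (rule cond_smult) (rule H(3)[OF that])
  have norm1: "(\<Sum>(j, l)\<in>I. cmod (coeff (H' k j) l)) = 1" for k
  proof -
    have "(\<Sum>(j, l)\<in>I. cmod (coeff (H' k j) l)) = (\<Sum>(j, l)\<in>I. cmod (coeff (H k j) l)) / S k"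
      unfolding sum_divide_distrib using Spos[of k]
      by (intro sum.cong) (auto simp: H'_def norm_mult norm_divide)
    then show ?thesis using Spos[of k] by (simp add: S_def)
  qed
  have "cmod (coeff (H' k (fst i)) (snd i)) \<le> 1" if "i \<in> I" for k i
    unfolding norm1[of k, symmetric] case_prod_beta
    by (rule member_le_sum[OF that _ fI, of "\<lambda>i. cmod (coeff (H' k (fst i)) (snd i))"]) simp
  then obtain r \<kappa> where r: "strict_mono r"
    "\<And>i. i \<in> I \<Longrightarrow> (\<lambda>k. coeff (H' (r k) (fst i)) (snd i)) \<longlonglongrightarrow> \<kappa> i"
    using convergent_subsequence_finite[OF fI, of "\<lambda>k i. coeff (H' k (fst i)) (snd i)" 1] by blast
  define h where "h j = (\<Sum>l<c j. monom (\<kappa> (j, l)) l)" for j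
  have h1: "pdeg (c j) (h j)" for j
    by (auto simp: pdeg_def h_def coeff_sum coeff_monom intro!: sum.neutral)
  have lim: "(\<lambda>k. f (g j * H' (r k) j)) \<longlonglongrightarrow> f (g j * h j)" if f: "linear_functional f" for f j
  proof (cases "j \<le> t")
    case False
    then show ?thesis using c[of j] H'1[of j] h1[of j] by (simp add: pdeg_0)
  next
    case True
    have fm: "f (g j * (\<Sum>l<c j. monom (x l) l)) = (\<Sum>l<c j. x l * f (g j * monom 1 l))" for x
    proof -
      have "f (g j * (\<Sum>l<c j. monom (x l) l)) = f (\<Sum>l<c j. smult (x l) (g j * monom 1 l))"
        by (simp add: sum_distrib_left mult_smult_right[symmetric] smult_monom del: mult_smult_right)
      also have "\<dots> = (\<Sum>l<c j. x l * f (g j * monom 1 l))"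
        using f by (simp add: linear_functional_sum linear_functional_def)
      finally show ?thesis .
    qed
    have "(\<lambda>k. \<Sum>l<c j. coeff (H' (r k) j) l * f (g j * monom 1 l)) \<longlonglongrightarrow>
      (\<Sum>l<c j. \<kappa> (j, l) * f (g j * monom 1 l))"
      using True r(2)[of "(j, _)"] by (intro tendsto_intros) (auto simp: I_def)
    then show ?thesis
      unfolding fm[symmetric] pdeg_sum[OF H'1, symmetric] by (simp add: h_def)
  qed
  have h3: "fat_point_conditions t (ms p) (as p) (bs p) (\<lambda>j. g j * h j)" if p: "p < n" for p
    unfolding fat_point_conditions_def
  proof (intro allI impI)
    fix i and R :: "nat set" assume iR: "finite R" "i + card R < ms p"
    let ?s = "\<lambda>F. \<Sum>j\<le>t. (\<Prod>r\<in>R. of_nat j - of_nat r) * bs p ^ j * poly ((pderiv ^^ i) (F j)) (as p)"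
    have z: "?s (\<lambda>j. g j * H' (r k) j) = 0" for k
      using H'3[OF p, of "r k"] iR by (simp add: fat_point_conditions_def)
    have "(\<lambda>k. ?s (\<lambda>j. g j * H' (r k) j)) \<longlonglongrightarrow> ?s (\<lambda>j. g j * h j)"
      by (intro tendsto_intros lim linear_functional_higher_pderiv)
    then show "?s (\<lambda>j. g j * h j) = 0"
      unfolding z by (simp only: LIMSEQ_const_iff)
  qed
  have h2: "poly ((pderiv ^^ i) (g J * h J)) a = 0" if i: "i < v J" for i J
  proof -
    have Jt: "J \<le> t"
    proof (rule ccontr)
      assume "\<not> J \<le> t"
      then have "v J = 0" using v c[of J] by (metis le_zero_eq not_le valid_def)
      then show False using i by simp
    qed
    obtain L where L: "\<And>j. linear_functional (L j)"
      "\<And>b F. fat_point_conditions t m a b F \<Longrightarrow> (\<Sum>j\<le>t. b ^ j * L j (F j)) = 0"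
      "\<And>f. L J f = poly ((pderiv ^^ i) f) a"
      "\<And>j h. j < J \<Longrightarrow> pdeg (c j) h \<Longrightarrow> L j (g j * h) = 0"
      using leading_functional[OF v i, of g a t] g by blast
    \<comment> \<open>The slices before \<open>J\<close> drop out by the choice of \<open>L\<close>.
      Division by the power of \<open>b\<close> belonging to slice \<open>J\<close> then leaves only
      this slice in the limit.\<close>
    let ?X = "\<lambda>k. \<Sum>j\<in>{J..t}. \<beta> (r k) ^ (j - J) * L j (g j * H' (r k) j)"
    have "?X k = 0" for k
    proof -
      have "0 = (\<Sum>j\<le>t. \<beta> (r k) ^ j * L j (g j * H' (r k) j))"
        by (rule L(2)[OF H'2, symmetric])
      also have "\<dots> = (\<Sum>j\<in>{J..t}. \<beta> (r k) ^ j * L j (g j * H' (r k) j))"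
        by (rule sum.mono_neutral_right) (use L(4) H'1 in auto)
      also have "\<dots> = \<beta> (r k) ^ J * ?X k"
        unfolding sum_distrib_left
        by (rule sum.cong) (simp_all add: mult.assoc[symmetric] power_add[symmetric])
      finally have "\<beta> (r k) ^ J * ?X k = 0" by (rule sym)
      moreover have "\<beta> (r k) \<noteq> 0" by (simp add: \<beta>_def del: of_nat_Suc)
      ultimately show ?thesis by (metis mult_eq_0_iff power_not_zero)
    qed
    moreover have "?X \<longlonglongrightarrow> (\<Sum>j\<in>{J..t}. 0 ^ (j - J) * L j (g j * h j))"
    proof -
      have "\<beta> \<longlonglongrightarrow> 0" unfolding \<beta>_def by (rule lim_1_over_n[THEN LIMSEQ_Suc])
      from LIMSEQ_subseq_LIMSEQ[OF this r(1)] have "(\<lambda>k. \<beta> (r k)) \<longlonglongrightarrow> 0" by (simp add: comp_def)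
      then show ?thesis by (intro tendsto_intros lim L(1))
    qed
    moreover have "(\<Sum>j\<in>{J..t}. 0 ^ (j - J) * L j (g j * h j)) = L J (g J * h J)"
    proof -
      have "(\<Sum>j\<in>{J..t}. 0 ^ (j - J) * L j (g j * h j)) = (\<Sum>j\<in>{J}. 0 ^ (j - J) * L j (g j * h j))"
        by (rule sum.mono_neutral_right) (use Jt in auto)
      then show ?thesis by simp
    qed
    ultimately have "L J (g J * h J) = 0" by (simp add: LIMSEQ_const_iff)
    then show ?thesis using L(3) by simp
  qed
  have "\<exists>q. h j = [:-a, 1:] ^ v j * q" for j
    using power_dvd_if_higher_pderivs_zero[of "g j" a "v j" "h j"] g h2 by (auto simp: dvd_def)
  then obtain q where q: "\<And>j. h j = [:-a, 1:] ^ v j * q j" by metis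
  have "q j = 0" for j
  proof (rule rest)
    show "pdeg (c j - v j) (q j)" for j
      using h1[of j] unfolding q by (rule pdeg_cofactor)
    show "fat_point_conditions t (ms p) (as p) (bs p) (\<lambda>j. g j * [:- a, 1:] ^ v j * q j)" if "p < n" for p
      using h3[OF that] unfolding q by (simp add: mult.assoc)
  qed
  then have h0: "h j = 0" for j using q by simp
  have "\<kappa> i = 0" if "i \<in> I" for i
  proof -
    obtain j l where i: "i = (j, l)" "l < c j" using \<open>i \<in> I\<close> by (auto simp: I_def)
    have "coeff (h j) l = \<kappa> (j, l)"
      using i(2) by (simp add: h_def coeff_sum coeff_monom)
    then show ?thesis using h0 i by simp
  qed
  moreover have "(\<lambda>k. \<Sum>i\<in>I. cmod (coeff (H' (r k) (fst i)) (snd i))) \<longlonglongrightarrow> (\<Sum>i\<in>I. cmod (\<kappa> i))"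
    by (intro tendsto_intros r(2))
  ultimately have "(\<lambda>k. 1 :: real) \<longlonglongrightarrow> 0"
    using norm1 by (simp add: case_prod_beta)
  then show False by (simp add: LIMSEQ_const_iff)
qed

text \<open>The heights of the later points are chosen first, with the factor
  \<open>(x - a)^(v j)\<close> of the first point built into \<open>g\<close>; the height of the
  first point is then found with these fixed. Distinct abscissas keep the enlarged \<open>g\<close>
  nonzero at the later points.\<close>

lemma exact_points:
  assumes "exact c ms" "length as = length ms" "distinct as"
    "\<And>a j. a \<in> set as \<Longrightarrow> poly (g j) a \<noteq> 0" "\<And>j. t < j \<Longrightarrow> c j = 0"
  shows "\<exists>bs. \<forall>h. (\<forall>j. pdeg (c j) (h j)) \<longrightarrow>
    (\<forall>p<length ms. fat_point_conditions t (ms ! p) (as ! p) (bs p) (\<lambda>j. g j * h j)) \<longrightarrow> (\<forall>j. h j = 0)"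
  using assms
proof (induction arbitrary: as g rule: exact.induct)
  case exact_Nil
  then show ?case by (simp add: pdeg_0)
next
  case (exact_Cons c m v ms)
  obtain a as' where as: "as = a # as'" using exact_Cons.prems(1) by (cases as) auto
  have "\<exists>bs. \<forall>h. (\<forall>j. pdeg (c j - v j) (h j)) \<longrightarrow> (\<forall>p<length ms. fat_point_conditions t (ms ! p) (as' ! p)
     (bs p) (\<lambda>j. g j * [:-a, 1:] ^ v j * h j)) \<longrightarrow> (\<forall>j. h j = 0)"
  proof (rule exact_Cons.IH)
    show "poly (g j * [:- a, 1:] ^ v j) a' \<noteq> 0" if "a' \<in> set as'" for a' j
      using exact_Cons.prems(2,3) that as by auto
  qed (use exact_Cons.prems as in auto)
  then obtain bs where bs: "\<And>h j. (\<And>j. pdeg (c j - v j) (h j)) \<Longrightarrow> (\<And>p. p < length ms \<Longrightarrow>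
    fat_point_conditions t (ms ! p) (as' ! p) (bs p) (\<lambda>j. g j * [:-a, 1:] ^ v j * h j)) \<Longrightarrow> h j = 0"
    by blast
  obtain b where b: "\<And>h. \<forall>j. pdeg (c j) (h j) \<Longrightarrow> fat_point_conditions t m a b (\<lambda>j. g j * h j) \<Longrightarrow>
    \<forall>p<length ms. fat_point_conditions t (ms ! p) (as' ! p) (bs p) (\<lambda>j. g j * h j) \<Longrightarrow> \<forall>j. h j = 0"
    using degenerate_point[of c m v t g a "length ms" "(!) ms" "(!) as'" bs] exact_Cons bs as by auto
  show ?case
  proof (intro exI[of _ "case_nat b bs"] allI impI, rule b[THEN spec])
    fix h assume h: "\<forall>j. pdeg (c j) (h j)" and
      C: "\<forall>p<length (m # ms). fat_point_conditions t ((m # ms) ! p) (as ! p) (case_nat b bs p) (\<lambda>j. g j * h j)"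
    show "\<forall>j. pdeg (c j) (h j)" by fact
    show "fat_point_conditions t m a b (\<lambda>j. g j * h j)" using C as by force
    show "\<forall>p<length ms. fat_point_conditions t (ms ! p) (as' ! p) (bs p) (\<lambda>j. g j * h j)"
      using C as by force
  qed
qed

section \<open>Laurent polynomials and their partial derivatives\<close>

abbreviation lcoeff :: "('a \<Rightarrow>\<^sub>0 complex) \<Rightarrow> 'a \<Rightarrow> complex" where
  "lcoeff \<equiv> Poly_Mapping.lookup"

abbreviation lmonom :: "'a \<Rightarrow> complex \<Rightarrow> 'a \<Rightarrow>\<^sub>0 complex" where
  "lmonom \<equiv> Poly_Mapping.single"

abbreviation supp :: "('a \<Rightarrow>\<^sub>0 complex) \<Rightarrow> 'a set" where
  "supp \<equiv> Poly_Mapping.keys"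

lemma supp_iff: "e \<in> supp f \<longleftrightarrow> lcoeff f e \<noteq> 0"
  by (simp add: in_keys_iff)

lemma supp_diff: "supp (f - g) \<subseteq> supp f \<union> supp g"
  by (auto simp: supp_iff lookup_minus)

lemma sum_lmonom: "f = (\<Sum>e\<in>supp f. lmonom e (lcoeff f e))"
  by (rule poly_mapping_eqI) (auto simp: lookup_sum lookup_single when_def supp_iff)

lemma lmonom_induct:
  assumes "P 0" "\<And>e c. P (lmonom e c)" "\<And>f g. P f \<Longrightarrow> P g \<Longrightarrow> P (f + g)"
  shows "P f"
proof -
  have "P (\<Sum>e\<in>A. lmonom e (lcoeff f e))" for A
    by (induction A rule: infinite_finite_induct) (auto intro: assms)
  then show ?thesis by (subst sum_lmonom)
qed

text \<open>Common form of \<open>leval\<close> and \<open>mpoly_eval\<close>, with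
  \<open>\<phi>\<close> giving the values of the monomials.\<close>

definition peval :: "('a \<Rightarrow> complex) \<Rightarrow> ('a \<Rightarrow>\<^sub>0 complex) \<Rightarrow> complex" where
  "peval \<phi> f = (\<Sum>e\<in>supp f. lcoeff f e * \<phi> e)"

lemma peval_superset: "finite A \<Longrightarrow> supp f \<subseteq> A \<Longrightarrow> peval \<phi> f = (\<Sum>e\<in>A. lcoeff f e * \<phi> e)"
  unfolding peval_def by (rule sum.mono_neutral_left) (auto simp: supp_iff)

lemma peval_0 [simp]: "peval \<phi> 0 = 0"
  by (simp add: peval_def)

lemma peval_single [simp]: "peval \<phi> (lmonom e c) = c * \<phi> e"
  by (simp add: peval_def)

lemma peval_add: "peval \<phi> (f + g) = peval \<phi> f + peval \<phi> g"
proof -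
  have "supp (f + g) \<subseteq> supp f \<union> supp g" by (rule keys_add)
  then show ?thesis
    using peval_superset[of "supp f \<union> supp g" _ \<phi>]
    by (simp add: lookup_add distrib_right sum.distrib)
qed

lemma peval_uminus: "peval \<phi> (- f) = - peval \<phi> f"
  using peval_add[of \<phi> f "- f"] by (simp add: eq_neg_iff_add_eq_0 add.commute)

lemma peval_diff: "peval \<phi> (f - g) = peval \<phi> f - peval \<phi> g"
  using peval_add[of \<phi> f "- g"] by (simp add: peval_uminus)

lemma peval_sum: "peval \<phi> (\<Sum>i\<in>A. f i) = (\<Sum>i\<in>A. peval \<phi> (f i))"
  by (induction A rule: infinite_finite_induct) (simp_all add: peval_add)

text \<open>Multiplicativity is asked on the supports only, because \<open>powi\<close> is not
  additive in the exponent at 0: \<open>0 powi 1 * 0 powi (-1)\<close> differs from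
  \<open>0 powi 0\<close>.\<close>

lemma peval_mult:
  assumes "\<And>a b. a \<in> supp f \<Longrightarrow> b \<in> supp g \<Longrightarrow> \<phi> (a + b) = \<phi> a * \<phi> b"
  shows "peval \<phi> (f * g) = peval \<phi> f * peval \<phi> g"
proof -
  have "f * g = (\<Sum>a\<in>supp f. \<Sum>b\<in>supp g. lmonom (a + b) (lcoeff f a * lcoeff g b))"
    by (subst sum_lmonom[of f], subst sum_lmonom[of g]) (simp add: sum_product mult_single)
  also have "peval \<phi> \<dots> = (\<Sum>a\<in>supp f. \<Sum>b\<in>supp g. (lcoeff f a * \<phi> a) * (lcoeff g b * \<phi> b))"
    unfolding peval_sum by (intro sum.cong refl) (simp add: assms)
  also have "\<dots> = peval \<phi> f * peval \<phi> g"
    by (simp add: peval_def sum_product)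
  finally show ?thesis .
qed

lemma leval_eq_peval: "leval f v = peval (\<lambda>e. \<Prod>k\<in>UNIV. (v $ k) powi (e $ k)) f"
  by (simp add: leval_def peval_def)

lemma leval_0 [simp]: "leval 0 v = 0"
  and leval_add: "leval (f + g) v = leval f v + leval g v"
  and leval_diff: "leval (f - g) v = leval f v - leval g v"
  and leval_sum: "leval (\<Sum>i\<in>A. F i) v = (\<Sum>i\<in>A. leval (F i) v)"
  and leval_single: "leval (lmonom e c) v = c * (\<Prod>k\<in>UNIV. (v $ k) powi (e $ k))"
  by (simp_all add: leval_eq_peval peval_add peval_diff peval_sum)

lemma leval_mult:
  assumes "f \<in> coord_ring S" "g \<in> coord_ring S" "\<And>k. k \<in> S \<Longrightarrow> v $ k \<noteq> 0"
  shows "leval (f * g) v = leval f v * leval g v"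
  unfolding leval_eq_peval
proof (rule peval_mult)
  fix a b assume ab: "a \<in> supp f" "b \<in> supp g"
  have "(v $ k) powi ((a + b) $ k) = (v $ k) powi (a $ k) * (v $ k) powi (b $ k)" for k
  proof (cases "k \<in> S")
    case True
    then show ?thesis using assms(3) by (simp add: power_int_add)
  next
    case False
    then have "0 \<le> a $ k" "0 \<le> b $ k" using assms(1,2) ab by (auto simp: coord_ring_def)
    then show ?thesis
      by (cases "a $ k = 0 \<and> b $ k = 0") (auto simp: power_int_add)
  qed
  then show "(\<Prod>k\<in>UNIV. (v $ k) powi ((a + b) $ k)) =
    (\<Prod>k\<in>UNIV. (v $ k) powi (a $ k)) * (\<Prod>k\<in>UNIV. (v $ k) powi (b $ k))"
    by (simp add: prod.distrib)
qed

lemma leval_lscale: "leval (lscale c f) v = c * leval f v"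
  by (induction f rule: lmonom_induct)
    (simp_all add: lscale_def leval_single mult_single distrib_left leval_add)

lemma lcoeff_lscale [simp]: "lcoeff (lscale c f) e = c * lcoeff f e"
  by (induction f rule: lmonom_induct)
    (simp_all add: lscale_def mult_single distrib_left lookup_add lookup_single when_def)

lemma lcoeff_partial: "lcoeff (partial k f) e = of_int (e $ k + 1) * lcoeff f (e + axis k 1)"
proof -
  have "lcoeff (partial k f) e =
    (\<Sum>a\<in>supp f. if a = e + axis k 1 then of_int (a $ k) * lcoeff f a else 0)"
    unfolding partial_def lookup_sum
    by (rule sum.cong) (auto simp: lookup_single when_def)
  also have "\<dots> = of_int (e $ k + 1) * lcoeff f (e + axis k 1)"
    by (auto simp: supp_iff)
  finally show ?thesis .
qed

lemma partial_single: "partial k (lmonom e c) = lmonom (e - axis k 1) (of_int (e $ k) * c)"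
  by (simp add: partial_def)

lemma partial_0 [simp]: "partial k 0 = 0"
  and partial_add: "partial k (f + g) = partial k f + partial k g"
  and partial_diff: "partial k (f - g) = partial k f - partial k g"
  and partial_lscale: "partial k (lscale c f) = lscale c (partial k f)"
  by (rule poly_mapping_eqI, simp add: lcoeff_partial lookup_add lookup_minus algebra_simps)+

lemma partial_sum: "partial k (\<Sum>i\<in>A. F i) = (\<Sum>i\<in>A. partial k (F i))"
  by (induction A rule: infinite_finite_induct) (simp_all add: partial_add)

lemma partial_commute: "partial k (partial l f) = partial l (partial k f)"
  by (rule poly_mapping_eqI) (auto simp: lcoeff_partial axis_def add.commute add.left_commute)

lemma partial_mult: "partial k (f * g) = partial k f * g + f * partial k g"
proof (induction f rule: lmonom_induct)
  case (2 a c)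
  show ?case
  proof (induction g rule: lmonom_induct)
    case (2 b d)
    show ?case
      by (simp add: mult_single partial_single add_diff_eq diff_add_eq add.commute[of b a]
        single_add[symmetric] distrib_right distrib_left mult_ac)
  qed (simp_all add: partial_add distrib_left)
qed (simp_all add: partial_add distrib_right)

section \<open>Localized polynomial rings and homogeneous elements\<close>

lemma coord_ring_mono: "S \<subseteq> T \<Longrightarrow> coord_ring S \<subseteq> coord_ring T"
  by (auto simp: coord_ring_def)

lemma coord_ring_iff: "f \<in> coord_ring S \<longleftrightarrow> (\<forall>e k. lcoeff f e \<noteq> 0 \<longrightarrow> k \<notin> S \<longrightarrow> 0 \<le> e $ k)"
  by (auto simp: coord_ring_def supp_iff)

lemma coord_ring_0 [simp]: "0 \<in> coord_ring S"
  and coord_ring_1 [simp]: "1 \<in> coord_ring S"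
  and coord_ring_add: "f \<in> coord_ring S \<Longrightarrow> g \<in> coord_ring S \<Longrightarrow> f + g \<in> coord_ring S"
  and coord_ring_uminus: "f \<in> coord_ring S \<Longrightarrow> - f \<in> coord_ring S"
  and coord_ring_diff: "f \<in> coord_ring S \<Longrightarrow> g \<in> coord_ring S \<Longrightarrow> f - g \<in> coord_ring S"
  and coord_ring_lscale: "f \<in> coord_ring S \<Longrightarrow> lscale c f \<in> coord_ring S"
  using keys_add[of f g] supp_diff[of f g]
  by (auto simp: coord_ring_def supp_iff)

lemma coord_ring_mult: "f \<in> coord_ring S \<Longrightarrow> g \<in> coord_ring S \<Longrightarrow> f * g \<in> coord_ring S"
  using keys_mult[of f g] by (fastforce simp: coord_ring_def)

lemma coord_ring_sum: "(\<And>i. i \<in> A \<Longrightarrow> F i \<in> coord_ring S) \<Longrightarrow> (\<Sum>i\<in>A. F i) \<in> coord_ring S"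
  by (induction A rule: infinite_finite_induct) (auto intro: coord_ring_add)

lemma coord_ring_prod: "(\<And>i. i \<in> A \<Longrightarrow> F i \<in> coord_ring S) \<Longrightarrow> (\<Prod>i\<in>A. F i) \<in> coord_ring S"
  by (induction A rule: infinite_finite_induct) (auto intro: coord_ring_mult)

lemma coord_ring_single: "(\<And>k. k \<notin> S \<Longrightarrow> 0 \<le> e $ k) \<Longrightarrow> lmonom e c \<in> coord_ring S"
  by (auto simp: coord_ring_iff lookup_single when_def)

text \<open>Lowering an exponent 0 would leave the ring, but differentiation multiplies that term by
  0.\<close>

lemma coord_ring_partial:
  assumes "f \<in> coord_ring S"
  shows "partial k f \<in> coord_ring S"
  unfolding coord_ring_iff
proof (intro allI impI)
  fix e l assume e: "lcoeff (partial k f) e \<noteq> 0" and l: "l \<notin> S"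
  then have "0 \<le> (e + axis k 1) $ l" "e $ k \<noteq> -1"
    using assms by (auto simp: coord_ring_iff lcoeff_partial)
  then show "0 \<le> e $ l" by (cases "l = k") (auto simp: axis_def)
qed

lemma homogeneous_iff: "homogeneous d f \<longleftrightarrow> (\<forall>e. lcoeff f e \<noteq> 0 \<longrightarrow> (\<Sum>k\<in>UNIV. e $ k) = d)"
  by (auto simp: homogeneous_def supp_iff)

lemma homogeneous_0 [simp]: "homogeneous d 0"
  and homogeneous_add: "homogeneous d f \<Longrightarrow> homogeneous d g \<Longrightarrow> homogeneous d (f + g)"
  and homogeneous_diff: "homogeneous d f \<Longrightarrow> homogeneous d g \<Longrightarrow> homogeneous d (f - g)"
  and homogeneous_lscale: "homogeneous d f \<Longrightarrow> homogeneous d (lscale c f)"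
  using keys_add[of f g] supp_diff[of f g] by (auto simp: homogeneous_def supp_iff)

lemma homogeneous_sum: "(\<And>i. i \<in> A \<Longrightarrow> homogeneous d (F i)) \<Longrightarrow> homogeneous d (\<Sum>i\<in>A. F i)"
  by (induction A rule: infinite_finite_induct) (auto intro: homogeneous_add)

lemma homogeneous_single: "(\<Sum>k\<in>UNIV. e $ k) = d \<Longrightarrow> homogeneous d (lmonom e c)"
  by (auto simp: homogeneous_iff lookup_single when_def)

lemma sum_axis: "(\<Sum>i\<in>UNIV. axis k 1 $ i) = (1 :: int)"
  by (simp add: axis_def)

lemma homogeneous_partial: "homogeneous d f \<Longrightarrow> homogeneous (d - 1) (partial k f)"
  unfolding homogeneous_iff
proof (intro allI impI)
  fix e assume "\<forall>e. lcoeff f e \<noteq> 0 \<longrightarrow> (\<Sum>k\<in>UNIV. e $ k) = d" "lcoeff (partial k f) e \<noteq> 0"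
  then have "(\<Sum>l\<in>UNIV. (e + axis k 1) $ l) = d"
    by (simp add: lcoeff_partial del: vector_add_component)
  then show "(\<Sum>l\<in>UNIV. e $ l) = d - 1" by (simp add: sum.distrib sum_axis)
qed

lemma leval_homogeneous_scale:
  assumes "homogeneous d f" "c \<noteq> 0"
  shows "leval f (c *s v) = c powi d * leval f v"
proof -
  have "(\<Prod>k\<in>UNIV. ((c *s v) $ k) powi (e $ k)) = c powi d * (\<Prod>k\<in>UNIV. (v $ k) powi (e $ k))"
    if "e \<in> supp f" for e
  proof -
    have "(\<Sum>k\<in>UNIV. e $ k) = d" using assms(1) that by (simp add: homogeneous_def)
    moreover have "(\<Prod>k\<in>A. c powi (e $ k)) = c powi (\<Sum>k\<in>A. e $ k)" for A
      using assms(2) by (induction A rule: infinite_finite_induct) (simp_all add: power_int_add)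
    ultimately show ?thesis by (simp add: power_int_mult_distrib prod.distrib)
  qed
  then show ?thesis unfolding leval_def sum_distrib_left
    by (intro sum.cong) (simp_all only: mult.left_commute)
qed

lemma euler_identity:
  assumes "homogeneous d f"
  shows "(\<Sum>k\<in>UNIV. lmonom (axis k 1) 1 * partial k f) = lscale (of_int d) f"
proof -
  have "lmonom (axis k 1) 1 * partial k f = (\<Sum>e\<in>supp f. lmonom e (of_int (e $ k) * lcoeff f e))" for k
    by (simp add: partial_def sum_distrib_left mult_single)
  then have "(\<Sum>k\<in>UNIV. lmonom (axis k 1) 1 * partial k f) =
    (\<Sum>e\<in>supp f. \<Sum>k\<in>UNIV. lmonom e (of_int (e $ k) * lcoeff f e))"
    by (simp add: sum.swap[of _ UNIV])
  also have "\<dots> = (\<Sum>e\<in>supp f. lscale (of_int d) (lmonom e (lcoeff f e)))"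
  proof (rule sum.cong)
    fix e assume "e \<in> supp f"
    then have "(\<Sum>k\<in>UNIV. e $ k) = d" using assms by (simp add: homogeneous_def)
    then have "(\<Sum>k\<in>UNIV. of_int (e $ k)) = (of_int d :: complex)" by (metis of_int_sum)
    moreover have "(\<Sum>k\<in>UNIV. lmonom e (of_int (e $ k) * lcoeff f e)) =
       lmonom e (\<Sum>k\<in>UNIV. of_int (e $ k) * lcoeff f e)"
      by (simp add: sum_3 single_add)
    ultimately show "(\<Sum>k\<in>UNIV. lmonom e (of_int (e $ k) * lcoeff f e)) = lscale (of_int d) (lmonom e (lcoeff f e))"
      by (simp add: lscale_def mult_single sum_distrib_right[symmetric] del: single_of_int)
  qed simp
  also have "\<dots> = lscale (of_int d) f"
    by (subst (3) sum_lmonom) (simp add: lscale_def sum_distrib_left)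
  finally show ?thesis .
qed

text \<open>The condition of \<open>vanishes_to_order\<close> at a single representative. For
  homogeneous elements the representative does not matter, and \<open>vanishes_at_Suc\<close> makes
  induction on the order possible.\<close>

definition vanishes_at :: "nat \<Rightarrow> complex ^ 3 \<Rightarrow> laurent \<Rightarrow> bool" where
  "vanishes_at n v f \<longleftrightarrow> (\<forall>ks. length ks < n \<longrightarrow> leval (fold partial ks f) v = 0)"

lemma vanishes_at_0 [simp]: "vanishes_at 0 v f"
  by (simp add: vanishes_at_def)

lemma vanishes_at_Suc:
  "vanishes_at (Suc n) v f \<longleftrightarrow> leval f v = 0 \<and> (\<forall>k. vanishes_at n v (partial k f))"
proof
  assume a: "vanishes_at (Suc n) v f"
  have "leval f v = 0" using a[unfolded vanishes_at_def, rule_format, of "[]"] by simp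
  moreover have "leval (fold partial ks (partial k f)) v = 0" if "length ks < n" for ks k
    using a[unfolded vanishes_at_def, rule_format, of "k # ks"] that by simp
  ultimately show "leval f v = 0 \<and> (\<forall>k. vanishes_at n v (partial k f))" by (simp add: vanishes_at_def)
next
  assume a: "leval f v = 0 \<and> (\<forall>k. vanishes_at n v (partial k f))"
  show "vanishes_at (Suc n) v f"
    unfolding vanishes_at_def
  proof (intro allI impI)
    fix ks :: "3 list" assume "length ks < Suc n"
    then show "leval (fold partial ks f) v = 0" using a by (cases ks) (auto simp: vanishes_at_def)
  qed
qed

lemma vanishes_at_mono: "vanishes_at n v f \<Longrightarrow> n' \<le> n \<Longrightarrow> vanishes_at n' v f"
  by (simp add: vanishes_at_def)

lemma vanishes_at_zero [simp]: "vanishes_at n v 0"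
  by (induction n) (simp_all add: vanishes_at_Suc)

lemma vanishes_at_add: "vanishes_at n v f \<Longrightarrow> vanishes_at n v g \<Longrightarrow> vanishes_at n v (f + g)"
  by (induction n arbitrary: f g) (simp_all add: vanishes_at_Suc leval_add partial_add)

lemma vanishes_at_diff: "vanishes_at n v f \<Longrightarrow> vanishes_at n v g \<Longrightarrow> vanishes_at n v (f - g)"
  by (induction n arbitrary: f g) (simp_all add: vanishes_at_Suc leval_diff partial_diff)

lemma vanishes_at_lscale: "vanishes_at n v f \<Longrightarrow> vanishes_at n v (lscale c f)"
  by (induction n arbitrary: f) (simp_all add: vanishes_at_Suc leval_lscale partial_lscale)

text \<open>By the Leibniz rule a derivative lowers just one of the two orders, and by at most one.
  Inverted variables must be nonzero at \<open>v\<close> for evaluation to be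
  multiplicative.\<close>

lemma vanishes_at_mult:
  assumes "f \<in> coord_ring S" "g \<in> coord_ring S" "\<And>k. k \<in> S \<Longrightarrow> v $ k \<noteq> 0"
    "vanishes_at a v f" "vanishes_at b v g" "n \<le> a + b"
  shows "vanishes_at n v (f * g)"
  using assms
proof (induction n arbitrary: f g a b)
  case (Suc n)
  have "leval f v = 0 \<or> leval g v = 0"
    using Suc.prems by (cases a; cases b) (auto simp: vanishes_at_Suc)
  moreover have "vanishes_at n v (partial k f * g)" for k
  proof (cases a)
    case 0
    then show ?thesis using Suc.prems
      by (intro Suc.IH[of _ _ 0 b]) (auto intro: coord_ring_partial)
  next
    case (Suc a')
    then show ?thesis using Suc.prems
      by (intro Suc.IH[of _ _ a' b]) (auto intro: coord_ring_partial simp: vanishes_at_Suc)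
  qed
  moreover have "vanishes_at n v (f * partial k g)" for k
  proof (cases b)
    case 0
    then show ?thesis using Suc.prems
      by (intro Suc.IH[of _ _ a 0]) (auto intro: coord_ring_partial)
  next
    case (Suc b')
    then show ?thesis using Suc.prems
      by (intro Suc.IH[of _ _ a b']) (auto intro: coord_ring_partial simp: vanishes_at_Suc)
  qed
  ultimately show ?case using leval_mult[OF Suc.prems(1-3)]
    by (auto simp: vanishes_at_Suc partial_mult intro: vanishes_at_add)
qed simp

lemma vanishes_at_scale:
  assumes "homogeneous d f" "c \<noteq> 0" "vanishes_at n v f"
  shows "vanishes_at n (c *s v) f"
  using assms
proof (induction n arbitrary: f d)
  case (Suc n)
  then show ?case using homogeneous_partial[of d f]
    by (auto simp: vanishes_at_Suc leval_homogeneous_scale)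
qed simp

lemma leval_X: "leval (lmonom (axis k 1) 1) v = v $ k"
proof -
  have "(v $ j) powi ((axis k 1 :: int ^ 3) $ j) = (if j = k then v $ k else 1)" for j
    by (simp add: axis_def)
  then show ?thesis by (simp add: leval_single prod.delta)
qed

lemma coord_ring_X [simp]: "lmonom (axis k 1) 1 \<in> coord_ring S"
  by (rule coord_ring_single) (simp add: axis_def)

text \<open>By Euler's identity it suffices to check the derivatives of the highest order.\<close>

lemma vanishes_at_if_top:
  assumes "homogeneous d f" "f \<in> coord_ring S" "\<And>k. k \<in> S \<Longrightarrow> v $ k \<noteq> 0" "int n \<le> d"
    "\<And>ks. length ks = n \<Longrightarrow> leval (fold partial ks f) v = 0"
  shows "vanishes_at (Suc n) v f"
  using assms
proof (induction n arbitrary: f d)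
  case 0
  then show ?case by (simp add: vanishes_at_Suc)
next
  case (Suc n)
  have v: "vanishes_at (Suc n) v (partial k f)" for k
  proof (rule Suc.IH[of "d - 1"])
    show "leval (fold partial ks (partial k f)) v = 0" if "length ks = n" for ks
      using Suc.prems(5)[of "k # ks"] that by simp
  qed (use Suc.prems in \<open>auto intro: homogeneous_partial coord_ring_partial\<close>)
  have "leval (lscale (of_int d) f) v = (\<Sum>k\<in>UNIV. v $ k * leval (partial k f) v)"
    unfolding euler_identity[OF Suc.prems(1), symmetric] leval_sum
    by (intro sum.cong refl)
      (simp add: leval_mult[of _ S] Suc.prems coord_ring_partial leval_X)
  also have "\<dots> = 0" using v by (simp add: vanishes_at_Suc)
  \<comment> \<open>The degree drops together with the order, so \<open>int n \<le> d\<close> keeps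
    the factor \<open>d\<close> of Euler's identity nonzero throughout.\<close>
  finally have "leval f v = 0" using Suc.prems(4) by (simp add: leval_lscale)
  then show ?case using v vanishes_at_Suc[of "Suc n"] by simp
qed

section \<open>Representatives of points\<close>

lemma hcoords_eq:
  assumes "v \<in> hcoords P"
  shows "v \<noteq> 0" "hcoords P = {c *s v | c. c \<noteq> 0}"
proof -
  obtain w where w: "w \<noteq> 0" "line_of P = range (\<lambda>c. c *s w)"
    using line_of[of P] by blast
  obtain c where c: "v = c *s w" using assms w by (auto simp: hcoords_def)
  show v: "v \<noteq> 0" using assms by (simp add: hcoords_def)
  then have "c \<noteq> 0" using c by auto
  then have "x *s w = (x / c) *s v" for x by (simp add: c)
  moreover have "x *s v = (x * c) *s w" for x by (simp add: c)
  ultimately have "range (\<lambda>x. x *s w) = range (\<lambda>x. x *s v)"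
    by (intro subset_antisym image_subsetI) (metis rangeI)+
  then show "hcoords P = {c *s v | c. c \<noteq> 0}"
    using w v by (auto simp: hcoords_def)
qed

lemma ex_hcoords: "\<exists>v. v \<in> hcoords P"
proof -
  obtain w where w: "w \<noteq> 0" "line_of P = range (\<lambda>c. c *s w)"
    using line_of[of P] by blast
  then have "1 *s w \<in> line_of P" by blast
  then show ?thesis using w(1) by (auto simp: hcoords_def)
qed

lemma ex_point: "v \<noteq> 0 \<Longrightarrow> \<exists>P. v \<in> hcoords P"
proof -
  assume v: "v \<noteq> 0"
  then have "line_of (Abs_proj2 (range (\<lambda>c. c *s v))) = range (\<lambda>c. c *s v)"
    by (intro Abs_proj2_inverse) auto
  moreover have "1 *s v \<in> range (\<lambda>c. c *s v)" by blast
  ultimately show ?thesis using v by (intro exI[of _ "Abs_proj2 (range (\<lambda>c. c *s v))"]) (simp add: hcoords_def)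
qed

lemma hcoords_inject:
  assumes "v \<in> hcoords P" "c *s v \<in> hcoords Q"
  shows "P = Q"
proof -
  have c: "c \<noteq> 0" using hcoords_eq(1)[OF assms(2)] by auto
  have "hcoords Q = {d *s v | d. d \<noteq> 0}"
    unfolding hcoords_eq(2)[OF assms(2)] using c
    by (auto simp: vector_smult_assoc) (metis divide_eq_0_iff nonzero_divide_eq_eq)
  then have "hcoords P = hcoords Q" using hcoords_eq(2)[OF assms(1)] by simp
  moreover have "0 \<in> line_of R" for R
    using line_of[of R] by (auto simp: image_iff)
  ultimately have "line_of P = line_of Q" by (auto simp: hcoords_def)
  then show ?thesis by (simp add: line_of_inject)
qed

lemma vanishes_to_order_iff:
  assumes "v \<in> hcoords P" "homogeneous d f"
  shows "vanishes_to_order n P f \<longleftrightarrow> vanishes_at n v f"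
proof -
  have "vanishes_to_order n P f \<longleftrightarrow> (\<forall>w\<in>hcoords P. vanishes_at n w f)"
    by (auto simp: vanishes_to_order_def vanishes_at_def)
  then show ?thesis using assms(1) vanishes_at_scale[OF assms(2)]
    by (auto simp: hcoords_eq(2)[OF assms(1)])
qed

section \<open>Ideals of fat points\<close>

lemma generated_ideal_0 [simp]: "0 \<in> generated_ideal R B"
  unfolding generated_ideal_def by (rule CollectI, intro exI[of _ "{}"]) simp

lemma generated_ideal_step:
  assumes "r \<in> coord_ring S" "b \<in> B" "f \<in> generated_ideal (coord_ring S) B"
  shows "r * b + f \<in> generated_ideal (coord_ring S) B"
proof -
  obtain A q where A: "f = (\<Sum>b\<in>A. q b * b)" "finite A" "A \<subseteq> B" "\<And>b. b \<in> A \<Longrightarrow> q b \<in> coord_ring S"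
    using assms(3) unfolding generated_ideal_def by blast
  \<comment> \<open>Coefficients are attached to a set of generators, so a generator that already
    occurs gets the sum of both coefficients.\<close>
  define q' where "q' = (\<lambda>x. if x = b then r + (if b \<in> A then q b else 0) else q x)"
  have "r * b + f = (\<Sum>x\<in>insert b A. q' x * x)"
  proof (cases "b \<in> A")
    case True
    then have "(\<Sum>x\<in>insert b A. q' x * x) = q' b * b + (\<Sum>x\<in>A - {b}. q' x * x)"
      using A(2) by (simp add: insert_absorb sum.remove[of A b])
    also have "(\<Sum>x\<in>A - {b}. q' x * x) = (\<Sum>x\<in>A - {b}. q x * x)"
      by (rule sum.cong) (auto simp: q'_def)
    finally show ?thesis using True A(2)
      by (simp add: A(1) q'_def sum.remove[of A b] distrib_right add.assoc)
  next
    case False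
    then have "(\<Sum>x\<in>A. q' x * x) = (\<Sum>x\<in>A. q x * x)"
      by (intro sum.cong) (auto simp: q'_def)
    then show ?thesis using False A(2) by (simp add: A(1) q'_def)
  qed
  moreover have "q' x \<in> coord_ring S" if "x \<in> insert b A" for x
    using that A(4) assms(1) by (auto simp: q'_def intro: coord_ring_add)
  ultimately show ?thesis
    unfolding generated_ideal_def using A(2,3) assms(2)
    by (intro CollectI exI[of _ "insert b A"] exI[of _ q']) auto
qed

lemma generated_ideal_induct [consumes 1, case_names zero step]:
  assumes "f \<in> generated_ideal R B" "Q 0"
    "\<And>r b f. r \<in> R \<Longrightarrow> b \<in> B \<Longrightarrow> f \<in> generated_ideal R B \<Longrightarrow> Q f \<Longrightarrow> Q (r * b + f)"
  shows "Q f"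
proof -
  obtain A q where A: "f = (\<Sum>b\<in>A. q b * b)" "finite A" "A \<subseteq> B" "\<forall>b\<in>A. q b \<in> R"
    using assms(1) unfolding generated_ideal_def by blast
  have "(\<Sum>b\<in>A. q b * b) \<in> generated_ideal R B \<and> Q (\<Sum>b\<in>A. q b * b)"
    using A(2-4)
  proof (induction A rule: finite_induct)
    case empty
    then show ?case using assms(2) by simp
  next
    case (insert x A)
    then have "(\<Sum>b\<in>insert x A. q b * b) \<in> generated_ideal R B"
      unfolding generated_ideal_def by (intro CollectI exI[of _ "insert x A"] exI[of _ q]) auto
    then show ?case using insert assms(3)[of "q x" x] by simp
  qed
  then show ?thesis using A(1) by simp
qed

lemma generated_ideal_base: "b \<in> B \<Longrightarrow> b \<in> generated_ideal (coord_ring S) B"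
  using generated_ideal_step[of 1 S b B 0] by simp

lemma generated_ideal_add:
  assumes "f \<in> generated_ideal (coord_ring S) B" "g \<in> generated_ideal (coord_ring S) B"
  shows "f + g \<in> generated_ideal (coord_ring S) B"
  using assms(1)
  by (induction rule: generated_ideal_induct)
    (use assms(2) in \<open>auto simp: add.assoc intro: generated_ideal_step\<close>)

lemma generated_ideal_mult:
  assumes "f \<in> generated_ideal (coord_ring S) B" "r \<in> coord_ring S"
  shows "r * f \<in> generated_ideal (coord_ring S) B"
  using assms(1)
proof (induction rule: generated_ideal_induct)
  case (step q b f)
  have "(r * q) * b + r * f \<in> generated_ideal (coord_ring S) B"
    using step assms(2) by (intro generated_ideal_step coord_ring_mult)
  then show ?case by (simp add: distrib_left mult.assoc)
qed simp

lemma generated_ideal_uminus: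
  "f \<in> generated_ideal (coord_ring S) B \<Longrightarrow> - f \<in> generated_ideal (coord_ring S) B"
  using generated_ideal_mult[of f S B "- 1"] by (simp add: coord_ring_uminus)

lemma generated_ideal_diff:
  assumes "f \<in> generated_ideal (coord_ring S) B" "g \<in> generated_ideal (coord_ring S) B"
  shows "f - g \<in> generated_ideal (coord_ring S) B"
  using generated_ideal_add[OF assms(1) generated_ideal_uminus[OF assms(2)]] by simp

lemma generated_ideal_lscale:
  assumes "f \<in> generated_ideal (coord_ring S) B"
  shows "lscale c f \<in> generated_ideal (coord_ring S) B"
  unfolding lscale_def by (rule generated_ideal_mult[OF assms]) (rule coord_ring_single, simp)

lemma generated_ideal_product:
  assumes "f \<in> generated_ideal (coord_ring S) B" "g \<in> generated_ideal (coord_ring S) C"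
    "\<And>b c. b \<in> B \<Longrightarrow> c \<in> C \<Longrightarrow> b * c \<in> D"
  shows "f * g \<in> generated_ideal (coord_ring S) D"
proof -
  have *: "b * g \<in> generated_ideal (coord_ring S) D" if b: "b \<in> B" for b
    using assms(2)
  proof (induction rule: generated_ideal_induct)
    case (step r c f)
    then show ?case
      using generated_ideal_step[of r S "b * c" D "b * f"] assms(3)[OF b]
      by (simp add: distrib_left mult.left_commute)
  qed simp
  show ?thesis using assms(1)
  proof (induction rule: generated_ideal_induct)
    case (step r b f)
    then show ?case
      using generated_ideal_add[OF generated_ideal_mult[OF *[of b], of r], of "f * g"]
      by (simp add: distrib_right mult.assoc)
  qed simp
qed

lemma generated_ideal_mono:
  assumes "S \<subseteq> T" shows "generated_ideal (coord_ring S) B \<subseteq> generated_ideal (coord_ring T) B"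
proof
  fix f assume "f \<in> generated_ideal (coord_ring S) B"
  then show "f \<in> generated_ideal (coord_ring T) B"
    by (induction rule: generated_ideal_induct)
      (use coord_ring_mono[OF assms] in \<open>auto intro: generated_ideal_step\<close>)
qed

lemma generated_ideal_subset:
  assumes "B \<subseteq> coord_ring S" shows "generated_ideal (coord_ring S) B \<subseteq> coord_ring S"
proof
  fix f assume "f \<in> generated_ideal (coord_ring S) B"
  then show "f \<in> coord_ring S"
    by (induction rule: generated_ideal_induct)
      (use assms in \<open>auto intro!: coord_ring_add coord_ring_mult\<close>)
qed

text \<open>The element is a multiple of \<open>x\<close>, as the geometric sum shows.\<close>

lemma one_minus_power_in_ideal:
  assumes "x \<in> generated_ideal (coord_ring S) B" "x \<in> coord_ring S"
  shows "1 - (1 - x) ^ k \<in> generated_ideal (coord_ring S) B"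
proof (induction k)
  case (Suc k)
  have "(1 - x) ^ k \<in> coord_ring S"
    by (induction k) (use assms(2) in \<open>auto intro!: coord_ring_mult coord_ring_diff\<close>)
  then have "(1 - (1 - x) ^ k) + (1 - x) ^ k * x \<in> generated_ideal (coord_ring S) B"
    by (intro generated_ideal_add Suc generated_ideal_mult assms)
  then show ?case by (simp add: algebra_simps)
qed simp

text \<open>Generators of the \<open>k\<close>-th power of the homogeneous ideal of one point; this
  is the factor that each new point adds to \<open>fat_ideal_generators\<close>.\<close>

definition point_generators :: "nat \<Rightarrow> proj2 \<Rightarrow> laurent set" where
  "point_generators k Q = {\<Prod>j<k. l j | l. \<forall>j<k. l j \<in> forms_vanishing_at Q}"

lemma point_generators_0: "1 \<in> point_generators 0 Q"
  by (simp add: point_generators_def)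

lemma point_generators_Suc:
  assumes "b \<in> point_generators k Q" "c \<in> forms_vanishing_at Q"
  shows "b * c \<in> point_generators (Suc k) Q"
proof -
  obtain l where l: "b = (\<Prod>j<k. l j)" "\<forall>j<k. l j \<in> forms_vanishing_at Q"
    using assms(1) by (auto simp: point_generators_def)
  have "b * c = (\<Prod>j<Suc k. (l(k := c)) j)" by (simp add: l(1))
  moreover have "\<forall>j<Suc k. (l(k := c)) j \<in> forms_vanishing_at Q"
    using l(2) assms(2) by simp
  ultimately show ?thesis unfolding point_generators_def by blast
qed

lemma fat_ideal_generators_Suc:
  assumes "b \<in> fat_ideal_generators n m P" "c \<in> point_generators (m (Suc n)) (P (Suc n))"
  shows "b * c \<in> fat_ideal_generators (Suc n) m P"
proof -
  obtain l where l: "b = (\<Prod>i=1..n. \<Prod>j<m i. l i j)"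
    "\<forall>i\<in>{1..n}. \<forall>j<m i. l i j \<in> forms_vanishing_at (P i)"
    using assms(1) by (auto simp: fat_ideal_generators_def)
  obtain l' where l': "c = (\<Prod>j<m (Suc n). l' j)" "\<forall>j<m (Suc n). l' j \<in> forms_vanishing_at (P (Suc n))"
    using assms(2) by (auto simp: point_generators_def)
  have "b * c = (\<Prod>i=1..Suc n. \<Prod>j<m i. (l(Suc n := l')) i j)" by (simp add: l(1) l'(1))
  moreover have "\<forall>i\<in>{1..Suc n}. \<forall>j<m i. (l(Suc n := l')) i j \<in> forms_vanishing_at (P i)"
    using l(2) l'(2) by (auto simp: le_Suc_eq)
  ultimately show ?thesis unfolding fat_ideal_generators_def by blast
qed

lemma fat_ideal_generators_0: "1 \<in> fat_ideal_generators 0 m P"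
  by (simp add: fat_ideal_generators_def)

lemma forms_vanishing_at_subset: "forms_vanishing_at Q \<subseteq> coord_ring S"
  using coord_ring_mono[of "{}" S] by (auto simp: forms_vanishing_at_def forms_def)

lemma point_generators_subset: "point_generators k Q \<subseteq> coord_ring S"
  using forms_vanishing_at_subset[of Q S]
  by (auto simp: point_generators_def intro!: coord_ring_prod)

lemma fat_ideal_generators_subset: "fat_ideal_generators n m P \<subseteq> coord_ring S"
  using forms_vanishing_at_subset[of _ S]
  by (fastforce simp: fat_ideal_generators_def intro!: coord_ring_prod)

lemma generated_ideal_point_power:
  assumes "x \<in> generated_ideal (coord_ring S) (forms_vanishing_at Q)"
  shows "x ^ k \<in> generated_ideal (coord_ring S) (point_generators k Q)"
proof (induction k)
  case 0
  show ?case using generated_ideal_base[OF point_generators_0] by simp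
next
  case (Suc k)
  then show ?case
    using generated_ideal_product[OF Suc assms point_generators_Suc] by (simp add: mult.commute)
qed

section \<open>Comaximality of the ideals of distinct points\<close>

lemma forms_vanishing_at_linear:
  assumes "v \<in> hcoords Q" "a * v $ k + b * v $ l = 0"
  shows "lscale a (lmonom (axis k 1) 1) + lscale b (lmonom (axis l 1) 1) \<in> forms_vanishing_at Q"
proof -
  let ?f = "lscale a (lmonom (axis k 1) 1) + lscale b (lmonom (axis l 1) 1)"
  have "?f \<in> forms 1"
    unfolding forms_def
    by (auto intro!: coord_ring_add coord_ring_lscale homogeneous_add homogeneous_lscale
      homogeneous_single sum_axis)
  moreover have "leval ?f w = 0" if w: "w \<in> hcoords Q" for w
  proof -
    obtain c where "w = c *s v" using w hcoords_eq(2)[OF assms(1)] by auto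
    then have "leval ?f w = c * (a * v $ k + b * v $ l)"
      by (simp add: leval_add leval_lscale leval_X algebra_simps)
    then show ?thesis using assms(2) by simp
  qed
  ultimately show ?thesis by (auto simp: forms_vanishing_at_def)
qed

lemma axis_nth_if: "axis k x $ l = (if l = k then x else 0)"
  by (simp add: axis_def)

lemma axis_uminus: "axis k (- x) = - axis k (x :: int)"
  by (simp add: Finite_Cartesian_Product.vec_eq_iff axis_def)

text \<open>On the open set \<open>x\<^sub>i \<noteq> 0\<close> two distinct points are separated by linear forms through them a
  combination of which is the unit \<open>x\<^sub>i\<close>.\<close>

lemma points_comaximal:
  assumes Q: "v \<in> hcoords Q" "w \<in> hcoords Q'" "Q \<noteq> Q'" "v $ i \<noteq> 0"
  shows "\<exists>b. b \<in> generated_ideal (coord_ring {i}) (forms_vanishing_at Q) \<and>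
    1 - b \<in> generated_ideal (coord_ring {i}) (forms_vanishing_at Q')"
proof -
  have "\<exists>k. v $ i * w $ k \<noteq> w $ i * v $ k"
  proof (rule ccontr)
    assume "\<not> ?thesis"
    then have "w = (w $ i / v $ i) *s v"
      using Q(4) by (simp add: Finite_Cartesian_Product.vec_eq_iff field_simps)
    then show False using hcoords_inject[OF Q(1)] Q(2,3) by metis
  qed
  then obtain k where k: "v $ i * w $ k \<noteq> w $ i * v $ k" by blast
  define D where "D = v $ i * w $ k - w $ i * v $ k"
  define Y :: laurent where "Y = lmonom (axis i (- 1)) 1"
  have Y: "Y * lmonom (axis i 1) 1 = 1" by (simp add: Y_def mult_single axis_uminus)
  have YR: "Y \<in> coord_ring {i}" unfolding Y_def by (rule coord_ring_single) (simp add: axis_def)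
  let ?l = "\<lambda>v. lscale (v $ i) (lmonom (axis k 1) 1) + lscale (- v $ k) (lmonom (axis i 1) 1)"
  define b where "b = Y * lscale (w $ i / D) (?l v)"
  have "1 - b = Y * lscale (- v $ i / D) (?l w)"
  proof -
    have D: "D \<noteq> 0" using k by (simp add: D_def)
    have "lscale (w $ i / D) (?l v) + lscale (- v $ i / D) (?l w) = lmonom (axis i 1) 1"
    proof -
      have "w $ i / D * (v $ i * A + - v $ k * B) + - v $ i / D * (w $ i * A + - w $ k * B) = B" for A B
      proof -
        have "w $ i / D * (v $ i * A + - v $ k * B) + - v $ i / D * (w $ i * A + - w $ k * B) =
          (v $ i * w $ k - w $ i * v $ k) * B / D"
          using D by (simp add: field_simps)
        then show ?thesis using D by (simp add: D_def)
      qed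
      then show ?thesis by (intro poly_mapping_eqI) (simp only: lookup_add lcoeff_lscale)
    qed
    then have "Y * (lscale (w $ i / D) (?l v) + lscale (- v $ i / D) (?l w)) = 1" using Y by simp
    then show ?thesis by (simp add: b_def algebra_simps)
  qed
  moreover have "Y * lscale c (?l u) \<in> generated_ideal (coord_ring {i}) (forms_vanishing_at R)"
    if "u \<in> hcoords R" for c u R
    by (intro generated_ideal_mult[OF generated_ideal_lscale[OF generated_ideal_base[OF
      forms_vanishing_at_linear[OF that]]] YR]) simp
  ultimately show ?thesis using Q(1,2) by (metis b_def)
qed

text \<open>Take \<open>b\<close> in the ideal of \<open>Q\<close> with \<open>1 - b\<close> in that
  of \<open>Q'\<close>. Then \<open>1 - b^k\<close> is a multiple of \<open>1 - b\<close>, so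
  \<open>u = (1 - b^k)^k'\<close> lies in the power of the second ideal, while \<open>1 - u\<close>
  is a multiple of \<open>b^k\<close>.\<close>

lemma point_powers_comaximal:
  assumes Q: "v \<in> hcoords Q" "Q \<noteq> Q'" "v $ i \<noteq> 0"
  shows "\<exists>u. u \<in> generated_ideal (coord_ring {i}) (point_generators k' Q') \<and>
    1 - u \<in> generated_ideal (coord_ring {i}) (point_generators k Q)"
proof -
  obtain w where "w \<in> hcoords Q'" using ex_hcoords by blast
  then obtain b where b: "b \<in> generated_ideal (coord_ring {i}) (forms_vanishing_at Q)"
    "1 - b \<in> generated_ideal (coord_ring {i}) (forms_vanishing_at Q')"
    using points_comaximal[OF Q(1) _ Q(2,3)] by blast
  have bR: "1 - b \<in> coord_ring {i}"
    using b(2) generated_ideal_subset[OF forms_vanishing_at_subset] by blast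
  have 1: "b ^ k \<in> generated_ideal (coord_ring {i}) (point_generators k Q)"
    by (rule generated_ideal_point_power[OF b(1)])
  have "1 - (1 - (1 - b)) ^ k \<in> generated_ideal (coord_ring {i}) (forms_vanishing_at Q')"
    by (rule one_minus_power_in_ideal[OF b(2) bR])
  then have "(1 - b ^ k) ^ k' \<in> generated_ideal (coord_ring {i}) (point_generators k' Q')"
    by (intro generated_ideal_point_power) simp
  moreover have "b ^ k \<in> coord_ring {i}"
    using 1 generated_ideal_subset[OF point_generators_subset] by blast
  then have "1 - (1 - b ^ k) ^ k' \<in> generated_ideal (coord_ring {i}) (point_generators k Q)"
    by (rule one_minus_power_in_ideal[OF 1])
  ultimately show ?thesis by blast
qed

text \<open>Elements congruent to 1 modulo the power at \<open>Q\<close> can be multiplied: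
  \<open>1 - u * w = (1 - u) + u * (1 - w)\<close>.\<close>

lemma fat_points_comaximal:
  assumes Q: "v \<in> hcoords Q" "v $ i \<noteq> 0" "\<And>p. 1 \<le> p \<Longrightarrow> p \<le> n \<Longrightarrow> P p \<noteq> Q"
  shows "\<exists>u. u \<in> generated_ideal (coord_ring {i}) (fat_ideal_generators n m P) \<and>
    1 - u \<in> generated_ideal (coord_ring {i}) (point_generators k Q)"
  using Q(3)
proof (induction n)
  case 0
  have "1 \<in> generated_ideal (coord_ring {i}) (fat_ideal_generators 0 m P)"
    by (rule generated_ideal_base[OF fat_ideal_generators_0])
  then show ?case by (intro exI[of _ 1]) simp
next
  case (Suc n)
  then obtain u where u: "u \<in> generated_ideal (coord_ring {i}) (fat_ideal_generators n m P)"
    "1 - u \<in> generated_ideal (coord_ring {i}) (point_generators k Q)" by auto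
  have "Q \<noteq> P (Suc n)" using Suc.prems[of "Suc n"] by auto
  then obtain w where w: "w \<in> generated_ideal (coord_ring {i}) (point_generators (m (Suc n)) (P (Suc n)))"
    "1 - w \<in> generated_ideal (coord_ring {i}) (point_generators k Q)"
    using point_powers_comaximal[OF Q(1) _ Q(2)] by blast
  have "u \<in> coord_ring {i}"
    using u(1) generated_ideal_subset[OF fat_ideal_generators_subset] by blast
  then have "(1 - u) + u * (1 - w) \<in> generated_ideal (coord_ring {i}) (point_generators k Q)"
    by (intro generated_ideal_add u generated_ideal_mult w)
  moreover have "(1 - u) + u * (1 - w) = 1 - u * w" by (simp add: algebra_simps)
  moreover have "u * w \<in> generated_ideal (coord_ring {i}) (fat_ideal_generators (Suc n) m P)"
    by (rule generated_ideal_product[OF u(1) w(1) fat_ideal_generators_Suc])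
  ultimately show ?case by auto
qed

section \<open>Taylor expansion at a point\<close>

lemma leval_1 [simp]: "leval 1 v = 1"
  by (simp flip: single_one add: leval_single)

lemma leval_power:
  assumes "f \<in> coord_ring S" "\<And>k. k \<in> S \<Longrightarrow> v $ k \<noteq> 0"
  shows "leval (f ^ n) v = leval f v ^ n"
proof (induction n)
  case (Suc n)
  have "f ^ n \<in> coord_ring S" by (induction n) (auto intro: coord_ring_mult assms)
  then show ?case using Suc leval_mult[OF assms(1) _ assms(2), of "f ^ n"] by simp
qed simp

lemma partial_power: "partial k (f ^ n) = of_nat n * f ^ (n - 1) * partial k f"
proof (induction n)
  case 0
  show ?case by (simp flip: single_one add: partial_single)
next
  case (Suc n)
  then show ?case
    by (cases n) (simp_all add: partial_mult algebra_simps)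
qed

lemma lscale_of_nat: "lscale (of_nat n) f = of_nat n * f"
  by (simp add: lscale_def)

text \<open>Coordinates at a point \<open>v\<close> that is normalized to \<open>v\<^sub>i = 1\<close>.\<close>

definition local_coord :: "complex ^ 3 \<Rightarrow> 3 \<Rightarrow> 3 \<Rightarrow> laurent" where
  "local_coord v i a = lmonom (axis a 1) 1 - lscale (v $ a) (lmonom (axis i 1) 1)"

text \<open>A monomial in the local coordinates, homogenized by a power of the unit
  \<open>x_i\<close>; the exponent of this power may be negative.\<close>

definition taylor_monomial :: "complex ^ 3 \<Rightarrow> 3 \<Rightarrow> 3 \<Rightarrow> 3 \<Rightarrow> nat \<Rightarrow> nat \<Rightarrow> int \<Rightarrow> laurent" where
  "taylor_monomial v i a b p q n = local_coord v i a ^ p * local_coord v i b ^ q * lmonom (axis i n) 1"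

lemma partial_local_coord: "a \<noteq> i \<Longrightarrow> partial k (local_coord v i a) =
   (if k = a then 1 else if k = i then - lmonom 0 (v $ a) else 0)"
  by (auto simp: local_coord_def partial_diff partial_lscale partial_single lscale_def mult_single
    axis_nth_if simp flip: single_one)

text \<open>Differentiation in the directions \<open>a\<close> and \<open>b\<close> treats
  \<open>x_i\<close> as a constant, so the local coordinates behave like independent
  variables.\<close>

lemma partial_taylor_monomial:
  assumes "a \<noteq> i" "b \<noteq> i" "a \<noteq> b"
  shows "partial a (taylor_monomial v i a b p q n) = lscale (of_nat p) (taylor_monomial v i a b (p - 1) q n)"
    and "partial b (taylor_monomial v i a b p q n) = lscale (of_nat q) (taylor_monomial v i a b p (q - 1) n)"
proof -
  have "partial k (lmonom (axis i n) 1) = 0" if "k \<noteq> i" for k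
    using that by (simp add: partial_single axis_def)
  then show "partial a (taylor_monomial v i a b p q n) = lscale (of_nat p) (taylor_monomial v i a b (p - 1) q n)"
    and "partial b (taylor_monomial v i a b p q n) = lscale (of_nat q) (taylor_monomial v i a b p (q - 1) n)"
    using assms by (simp_all add: taylor_monomial_def partial_mult partial_power partial_local_coord
      lscale_of_nat mult_ac)
qed

lemma funpow_partial_lscale: "(partial k ^^ n) (lscale c f) = lscale c ((partial k ^^ n) f)"
  by (induction n) (simp_all add: partial_lscale)

lemma funpow_partial_add: "(partial k ^^ n) (f + g) = (partial k ^^ n) f + (partial k ^^ n) g"
  by (induction n) (simp_all add: partial_add)

lemma funpow_partial_0 [simp]: "(partial k ^^ n) 0 = 0"
  by (induction n) simp_all

lemma higher_partial_taylor_monomial: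
  assumes "a \<noteq> i" "b \<noteq> i" "a \<noteq> b"
  shows "(partial a ^^ p') (taylor_monomial v i a b p q n) =
      lscale (\<Prod>r<p'. of_nat p - of_nat r) (taylor_monomial v i a b (p - p') q n)"
    and "(partial b ^^ q') (taylor_monomial v i a b p q n) =
      lscale (\<Prod>r<q'. of_nat q - of_nat r) (taylor_monomial v i a b p (q - q') n)"
proof -
  \<comment> \<open>For \<open>r' > p\<close> the truncated difference is 0, and the product on the
    left already contains the factor 0.\<close>
  have *: "(\<Prod>r<r'. of_nat p - of_nat r) * of_nat (p - r') = (\<Prod>r<Suc r'. of_nat p - of_nat r :: complex)" for r' p
  proof (cases "r' \<le> p")
    case False
    then have "(\<Prod>r<r'. of_nat p - of_nat r) = (0 :: complex)" by (intro prod_zero) auto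
    then show ?thesis by simp
  qed (simp add: of_nat_diff)
  show "(partial a ^^ p') (taylor_monomial v i a b p q n) =
      lscale (\<Prod>r<p'. of_nat p - of_nat r) (taylor_monomial v i a b (p - p') q n)"
    by (induction p') (simp_all add: partial_lscale partial_taylor_monomial[OF assms] * diff_diff_eq del: prod.lessThan_Suc)
  show "(partial b ^^ q') (taylor_monomial v i a b p q n) =
      lscale (\<Prod>r<q'. of_nat q - of_nat r) (taylor_monomial v i a b p (q - q') n)"
    by (induction q') (simp_all add: partial_lscale partial_taylor_monomial[OF assms] * diff_diff_eq del: prod.lessThan_Suc)
qed

definition taylor_coeff :: "complex ^ 3 \<Rightarrow> 3 \<Rightarrow> 3 \<Rightarrow> nat \<Rightarrow> nat \<Rightarrow> laurent \<Rightarrow> complex" where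
  "taylor_coeff v a b p q f = leval ((partial a ^^ p) ((partial b ^^ q) f)) v / (fact p * fact q)"

lemma local_coord_coord_ring: "local_coord v i a \<in> coord_ring S"
  by (simp add: local_coord_def coord_ring_diff coord_ring_lscale)

lemma coord_ring_power: "f \<in> coord_ring S \<Longrightarrow> f ^ n \<in> coord_ring S"
  by (induction n) (auto intro: coord_ring_mult)

lemma leval_taylor_monomial:
  assumes "v $ i = 1" "a \<noteq> i" "b \<noteq> i"
  shows "leval (taylor_monomial v i a b p q n) v = (if p = 0 \<and> q = 0 then 1 else 0)"
proof -
  have l: "leval (local_coord v i a) v = 0" for a
    using assms(1) by (simp add: local_coord_def leval_diff leval_lscale leval_X)
  have n: "lmonom (axis i n) 1 \<in> coord_ring {i}"
    by (rule coord_ring_single) (simp add: axis_def)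
  have "leval (lmonom (axis i n) 1) v = 1"
    unfolding leval_single mult_1 using assms(1) by (intro prod.neutral) (auto simp: axis_def)
  moreover have g: "v $ k \<noteq> 0" if "k \<in> {i}" for k using that assms(1) by simp
  moreover have "leval (taylor_monomial v i a b p q n) v = leval (local_coord v i a ^ p * local_coord v i b ^ q) v *
      leval (lmonom (axis i n) 1) v"
    unfolding taylor_monomial_def
    by (rule leval_mult[of _ "{i}"]) (use g n in \<open>auto intro!: coord_ring_mult coord_ring_power local_coord_coord_ring\<close>)
  moreover have "leval (local_coord v i a ^ p * local_coord v i b ^ q) v =
      leval (local_coord v i a ^ p) v * leval (local_coord v i b ^ q) v"
    by (rule leval_mult[of _ "{i}"]) (use g in \<open>auto intro!: coord_ring_power local_coord_coord_ring\<close>)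
  moreover have "leval (local_coord v i c ^ r) v = (if r = 0 then 1 else 0)" for c r
    by (subst leval_power[of _ "{i}"]) (use g l in \<open>auto simp: local_coord_coord_ring power_0_left\<close>)
  ultimately show ?thesis by auto
qed

lemma taylor_coeff_monomial:
  assumes "v $ i = 1" "a \<noteq> i" "b \<noteq> i" "a \<noteq> b"
  shows "taylor_coeff v a b p' q' (taylor_monomial v i a b p q n) = (if p = p' \<and> q = q' then 1 else 0)"
proof -
  have f: "(\<Prod>r<p'. of_nat p' - of_nat r) = (fact p' :: complex)" for p'
    by (simp add: fact_prod_rev of_nat_diff atLeast0LessThan)
  have z: "(\<Prod>r<p'. of_nat p - of_nat r) = (0 :: complex)" if "p < p'" for p p' :: nat
    using that by (intro prod_zero) auto
  have "p = p' \<or> p < p' \<or> p - p' \<noteq> 0" "q = q' \<or> q < q' \<or> q - q' \<noteq> 0" by auto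
  then show ?thesis
    by (auto simp: taylor_coeff_def higher_partial_taylor_monomial[OF assms(2-4)] funpow_partial_lscale
      leval_lscale leval_taylor_monomial[OF assms(1-3)] f z)
qed

text \<open>Multiplication by \<open>x\<^sub>a\<close> and \<open>x\<^sub>b\<close> preserves the span of the Taylor monomials, which contains all
  Laurent monomials for this reason.\<close>

definition taylor_span :: "complex ^ 3 \<Rightarrow> 3 \<Rightarrow> 3 \<Rightarrow> 3 \<Rightarrow> int \<Rightarrow> laurent set" where
  "taylor_span v i a b d =
     laurent.span (range (\<lambda>(p, q). taylor_monomial v i a b p q (d - int p - int q)))"

lemma taylor_span_mult:
  assumes "f \<in> taylor_span v i a b d"
  shows "lmonom (axis a 1) 1 * f \<in> taylor_span v i a b (d + 1)"
    and "lmonom (axis b 1) 1 * f \<in> taylor_span v i a b (d + 1)"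
proof -
  have X: "lmonom (axis c 1) 1 = local_coord v i c + lscale (v $ c) (lmonom (axis i 1) 1)" for c
    by (rule poly_mapping_eqI) (simp add: local_coord_def lookup_add lookup_minus)
  have m: "lmonom (axis i 1) 1 * lmonom (axis i n) 1 = lmonom (axis i (n + 1)) (1 :: complex)" for n :: int
  proof -
    have "axis i 1 + axis i n = axis i (n + 1)"
      by (simp add: Finite_Cartesian_Product.vec_eq_iff axis_nth_if)
    then show ?thesis by (simp add: mult_single)
  qed
  have T: "taylor_monomial v i a b p q (d - int p - int q) \<in> taylor_span v i a b d" for p q d
    unfolding taylor_span_def by (rule laurent.span_base) auto
  have 0: "lmonom (axis i 1) 1 * taylor_monomial v i a b p q (d - int p - int q) =
    taylor_monomial v i a b p q (d + 1 - int p - int q)" for p q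
  proof -
    have "d - int p - int q + 1 = d + 1 - int p - int q" by simp
    then have "lmonom (axis i (d + 1 - int p - int q)) 1 =
        lmonom (axis i 1) 1 * lmonom (axis i (d - int p - int q)) (1 :: complex)"
      unfolding m by (simp only:)
    then show ?thesis unfolding taylor_monomial_def by (simp only: mult_ac)
  qed
  have 1: "local_coord v i a * taylor_monomial v i a b p q (d - int p - int q) =
    taylor_monomial v i a b (Suc p) q (d + 1 - int (Suc p) - int q)" for p q
    by (simp add: taylor_monomial_def mult_ac)
  have 2: "local_coord v i b * taylor_monomial v i a b p q (d - int p - int q) =
    taylor_monomial v i a b p (Suc q) (d + 1 - int p - int (Suc q))" for p q
  proof -
    have "d + 1 - int p - int (Suc q) = d - int p - int q" by simp
    then show ?thesis unfolding taylor_monomial_def by (simp only: power_Suc mult_ac)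
  qed
  have gen: "lmonom (axis c 1) 1 * f \<in> taylor_span v i a b (d + 1)"
    if c: "\<And>p q. local_coord v i c * taylor_monomial v i a b p q (d - int p - int q) \<in> taylor_span v i a b (d + 1)" for c
    using assms unfolding taylor_span_def[of v i a b d]
  proof (induction rule: laurent.span_induct_alt)
    case base
    show ?case by (simp add: taylor_span_def laurent.span_zero)
  next
    case (step s x y)
    then obtain p q where x: "x = taylor_monomial v i a b p q (d - int p - int q)" by auto
    have "lmonom (axis c 1) 1 * (lscale s x + y) =
      lscale s (local_coord v i c * x + lscale (v $ c) (taylor_monomial v i a b p q (d + 1 - int p - int q)))
      + lmonom (axis c 1) 1 * y"
    proof -
      have "(l + lscale r z) * (lscale s x + y) = lscale s (l * x + lscale r (z * x)) + (l + lscale r z) * y" for l z r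
        by (simp add: lscale_def algebra_simps)
      then show ?thesis unfolding 0[symmetric] x[symmetric] X[of c] .
    qed
    also have "\<dots> \<in> taylor_span v i a b (d + 1)"
      using step(2) c[of p q] T[of p q "d + 1"] unfolding x[symmetric] taylor_span_def
      by (intro laurent.span_add laurent.span_scale)
    finally show ?case .
  qed
  show "lmonom (axis a 1) 1 * f \<in> taylor_span v i a b (d + 1)"
    by (rule gen) (simp only: 1 T)
  show "lmonom (axis b 1) 1 * f \<in> taylor_span v i a b (d + 1)"
    by (rule gen) (simp only: 2 T)
qed

lemma homogeneous_in_taylor_span:
  assumes "a \<noteq> i" "b \<noteq> i" "a \<noteq> b" "f \<in> coord_ring {i}" "homogeneous d f"
  shows "f \<in> taylor_span v i a b d"
proof -
  have U: "(UNIV :: 3 set) = {i, a, b}"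
    using assms(1-3) by (intro card_subset_eq[symmetric]) auto
  have *: "lmonom (axis a (int p) + axis b (int q) + axis i n) 1 \<in> taylor_span v i a b (int p + int q + n)" for p q n
  proof (induction p)
    case 0
    show ?case
    proof (induction q)
      case 0
      have "lmonom (axis i n) 1 = taylor_monomial v i a b 0 0 (n - int 0 - int 0)"
        by (simp add: taylor_monomial_def)
      moreover have "axis a 0 + axis b 0 + axis i n = axis i n"
        by (simp add: Finite_Cartesian_Product.vec_eq_iff axis_def)
      ultimately show ?case unfolding taylor_span_def
        by (intro laurent.span_base) (simp add: image_iff split_beta, metis diff_zero fst_conv of_nat_0 snd_conv)
    next
      case (Suc q)
      have "axis b (1::int) + (axis a (int 0) + axis b (int q) + axis i n) = axis a (int 0) + axis b (int (Suc q)) + axis i n"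
        by (simp add: Finite_Cartesian_Product.vec_eq_iff axis_nth_if)
      moreover have "int 0 + int q + n + 1 = int 0 + int (Suc q) + n" by simp
      ultimately show ?case using taylor_span_mult(2)[OF Suc] by (simp only: mult_single mult_1)
    qed
  next
    case (Suc p)
    have "axis a (1::int) + (axis a (int p) + axis b (int q) + axis i n) = axis a (int (Suc p)) + axis b (int q) + axis i n"
      by (simp add: Finite_Cartesian_Product.vec_eq_iff axis_nth_if)
    moreover have "int p + int q + n + 1 = int (Suc p) + int q + n" by simp
    ultimately show ?case using taylor_span_mult(1)[OF Suc] by (simp only: mult_single mult_1)
  qed
  have "lscale (lcoeff f e) (lmonom e 1) \<in> taylor_span v i a b d" if e: "e \<in> supp f" for e
  proof -
    have "0 \<le> e $ a" "0 \<le> e $ b" using assms(1,2,4) e by (auto simp: coord_ring_def)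
    then obtain p q where pq: "e $ a = int p" "e $ b = int q" by (metis nonneg_int_cases)
    have "(\<Sum>k\<in>UNIV. e $ k) = d" using assms(5) e by (simp add: homogeneous_def)
    then have "int p + int q + e $ i = d" unfolding U using assms(1-3) pq by simp
    moreover have "e = axis a (int p) + axis b (int q) + axis i (e $ i)"
      unfolding Finite_Cartesian_Product.vec_eq_iff
    proof
      fix k
      have "k \<in> {i, a, b}" using U by blast
      then show "e $ k = (axis a (int p) + axis b (int q) + axis i (e $ i)) $ k"
        using assms(1-3) pq by (auto simp: axis_def)
    qed
    ultimately have "lmonom e 1 \<in> taylor_span v i a b d" using *[of p q "e $ i"] by simp
    then show ?thesis unfolding taylor_span_def by (rule laurent.span_scale)
  qed
  then have "(\<Sum>e\<in>supp f. lscale (lcoeff f e) (lmonom e 1)) \<in> taylor_span v i a b d"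
    unfolding taylor_span_def by (rule laurent.span_sum)
  then show ?thesis by (subst sum_lmonom) (simp add: lscale_def mult_single)
qed

text \<open>The remainder is linear in \<open>f\<close>, so Taylor monomials suffice. Since
  \<open>taylor_coeff\<close> is dual to them, one with \<open>p + q < k\<close> equals its
  expansion; any other has expansion 0 and already contains \<open>k\<close> linear forms through
  the point.\<close>

lemma taylor_expansion:
  assumes "v $ i = 1" "a \<noteq> i" "b \<noteq> i" "a \<noteq> b" "v \<in> hcoords Q" "f \<in> taylor_span v i a b d"
  shows "f - (\<Sum>(p, q)\<in>{(p, q). p + q < k}. lscale (taylor_coeff v a b p q f)
      (taylor_monomial v i a b p q (d - int p - int q)))
    \<in> generated_ideal (coord_ring {i}) (point_generators k Q)"
proof -
  define A where "A = {(p, q). p + q < k}"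
  have "A \<subseteq> {..<k} \<times> {..<k}" by (auto simp: A_def)
  then have fA: "finite A" by (rule finite_subset) simp
  define R where "R f = f - (\<Sum>(p, q)\<in>A. lscale (taylor_coeff v a b p q f)
      (taylor_monomial v i a b p q (d - int p - int q)))" for f
  have lin: "R (lscale s x + y) = lscale s (R x) + R y" for s x y
  proof -
    have "taylor_coeff v a b p q (lscale s x + y) = s * taylor_coeff v a b p q x + taylor_coeff v a b p q y" for p q
      by (simp add: taylor_coeff_def funpow_partial_add funpow_partial_lscale leval_add leval_lscale add_divide_distrib)
    then have "(\<Sum>(p, q)\<in>A. lscale (taylor_coeff v a b p q (lscale s x + y)) (taylor_monomial v i a b p q (d - int p - int q))) =
      (\<Sum>(p, q)\<in>A. lscale s (lscale (taylor_coeff v a b p q x) (taylor_monomial v i a b p q (d - int p - int q))) +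
        lscale (taylor_coeff v a b p q y) (taylor_monomial v i a b p q (d - int p - int q)))"
      by (intro sum.cong) (auto simp: laurent.scale_left_distrib)
    also have "\<dots> = lscale s (\<Sum>(p, q)\<in>A. lscale (taylor_coeff v a b p q x) (taylor_monomial v i a b p q (d - int p - int q))) +
        (\<Sum>(p, q)\<in>A. lscale (taylor_coeff v a b p q y) (taylor_monomial v i a b p q (d - int p - int q)))"
      unfolding laurent.scale_sum_right by (simp add: sum.distrib case_prod_beta)
    finally show ?thesis by (simp add: R_def laurent.scale_right_diff_distrib)
  qed
  have mon: "taylor_monomial v i a b p q n \<in> generated_ideal (coord_ring {i}) (point_generators k Q)"
    if "k \<le> p + q" for p q n
  proof -
    have L: "local_coord v i c \<in> forms_vanishing_at Q" for c
      using forms_vanishing_at_linear[OF assms(5), of 1 c "- v $ c" i] assms(1)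
      by (simp add: local_coord_def)
    define l where "l j = local_coord v i (if j < p then a else b)" for j :: nat
    have "(\<Prod>j<p + q. l j) = (\<Prod>j<p. l j) * (\<Prod>j\<in>{p..<p + q}. l j)"
      by (subst prod.union_disjoint[symmetric]) (auto intro!: prod.cong)
    also have "\<dots> = local_coord v i a ^ p * local_coord v i b ^ q"
      by (simp add: l_def)
    finally have "taylor_monomial v i a b p q n = lmonom (axis i n) 1 * (\<Prod>j<p + q. l j)"
      by (simp add: taylor_monomial_def mult.commute)
    also have "(\<Prod>j<p + q. l j) = (\<Prod>j<k. l j) * (\<Prod>j\<in>{k..<p + q}. l j)"
      by (subst prod.union_disjoint[symmetric]) (use that in \<open>auto intro!: prod.cong\<close>)
    finally have "taylor_monomial v i a b p q n = (lmonom (axis i n) 1 * (\<Prod>j\<in>{k..<p + q}. l j)) * (\<Prod>j<k. l j)"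
      by (simp add: mult_ac)
    moreover have "(\<Prod>j<k. l j) \<in> point_generators k Q"
      unfolding point_generators_def l_def using L by blast
    moreover have "lmonom (axis i n) 1 * (\<Prod>j\<in>{k..<p + q}. l j) \<in> coord_ring {i}"
      unfolding l_def
      by (intro coord_ring_mult coord_ring_prod local_coord_coord_ring coord_ring_single) (simp add: axis_def)
    ultimately show ?thesis by (metis generated_ideal_base generated_ideal_mult)
  qed
  have "R f \<in> generated_ideal (coord_ring {i}) (point_generators k Q)"
    using assms(6) unfolding taylor_span_def
  proof (induction rule: laurent.span_induct_alt)
    case base
    have "R 0 = 0" using lin[of 0 0 0] by (simp add: R_def taylor_coeff_def)
    then show ?case by simp
  next
    case (step s x y)
    then obtain p q where x: "x = taylor_monomial v i a b p q (d - int p - int q)" by auto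
    have "(\<Sum>(p', q')\<in>A. lscale (taylor_coeff v a b p' q' x) (taylor_monomial v i a b p' q' (d - int p' - int q')))
      = (\<Sum>z\<in>A. if z = (p, q) then x else 0)"
      by (intro sum.cong) (auto simp: x taylor_coeff_monomial[OF assms(1-4)] split: if_splits)
    then have "R x = (if (p, q) \<in> A then 0 else x)" using fA by (simp add: R_def)
    then have "R x \<in> generated_ideal (coord_ring {i}) (point_generators k Q)"
      using mon[of p q] by (auto simp: A_def x)
    then show ?case unfolding lin using step(2) by (intro generated_ideal_add generated_ideal_lscale)
  qed
  then show ?thesis by (simp add: R_def A_def)
qed

lemma fold_partial_replicate: "fold partial (replicate n k) f = (partial k ^^ n) f"
  by (induction n arbitrary: f) (simp_all add: funpow_swap1)

lemma ex_other_coords: "\<exists>a b. a \<noteq> i \<and> b \<noteq> i \<and> a \<noteq> (b :: 3)"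
proof -
  have "card (UNIV - {i}) = 2" by simp
  then obtain a b where "UNIV - {i} = {a, b}" "a \<noteq> b" unfolding card_2_iff by blast
  moreover from this have "a \<in> UNIV - {i}" "b \<in> UNIV - {i}" by simp_all
  ultimately show ?thesis by blast
qed

lemma vanishes_at_imp_point_power:
  assumes "f \<in> coord_ring {i}" "homogeneous d f" "v \<in> hcoords Q" "v $ i \<noteq> 0" "vanishes_at k v f"
  shows "f \<in> generated_ideal (coord_ring {i}) (point_generators k Q)"
proof -
  obtain a b where ab: "a \<noteq> i" "b \<noteq> i" "a \<noteq> b" using ex_other_coords by blast
  define w where "w = (1 / v $ i) *s v"
  have w: "w $ i = 1" "w \<in> hcoords Q"
    using assms(4) by (auto simp: w_def hcoords_eq(2)[OF assms(3)] intro!: exI[of _ "1 / v $ i"])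
  have "vanishes_at k w f"
    unfolding w_def by (rule vanishes_at_scale[OF assms(2) _ assms(5)]) (use assms(4) in simp)
  then have "taylor_coeff w a b p q f = 0" if "p + q < k" for p q
    using that unfolding vanishes_at_def
    by (force simp: taylor_coeff_def fold_partial_replicate dest!: spec[of _ "replicate q b @ replicate p a"])
  then have "(\<Sum>(p, q)\<in>{(p, q). p + q < k}. lscale (taylor_coeff w a b p q f)
      (taylor_monomial w i a b p q (d - int p - int q))) = 0"
    by (intro sum.neutral) (auto simp: lscale_def)
  then show ?thesis
    using taylor_expansion[OF w(1) ab w(2) homogeneous_in_taylor_span[OF ab assms(1,2)], of k] by simp
qed

text \<open>Points are added one at a time. If \<open>x_i\<close> vanishes at the new point, it
  belongs to the ideal of that point and is a unit on the chart, so the new factor is the unit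
  ideal. Otherwise \<open>f\<close> lies in two comaximal ideals, and
  \<open>f = u * f + f * (1 - u)\<close> puts it into their product.\<close>

lemma fat_ideal_membership:
  assumes "f \<in> coord_ring {i}" "homogeneous d f"
    "\<And>p. 1 \<le> p \<Longrightarrow> p \<le> n \<Longrightarrow> v p \<in> hcoords (P p)"
    "\<And>p q. 1 \<le> p \<Longrightarrow> p < q \<Longrightarrow> q \<le> n \<Longrightarrow> P p \<noteq> P q"
    "\<And>p. 1 \<le> p \<Longrightarrow> p \<le> n \<Longrightarrow> v p $ i \<noteq> 0 \<Longrightarrow> vanishes_at (m p) (v p) f"
  shows "f \<in> generated_ideal (coord_ring {i}) (fat_ideal_generators n m P)"
  using assms(3-5)
proof (induction n)
  case 0
  show ?case using generated_ideal_mult[OF generated_ideal_base[OF fat_ideal_generators_0] assms(1)] by simp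
next
  case (Suc n)
  let ?m = "m (Suc n)" and ?Q = "P (Suc n)"
  have IH: "f \<in> generated_ideal (coord_ring {i}) (fat_ideal_generators n m P)"
    by (rule Suc.IH) (use Suc.prems in auto)
  have v: "v (Suc n) \<in> hcoords ?Q" using Suc.prems(1) by simp
  show ?case
  proof (cases "v (Suc n) $ i = 0")
    case True
    then have "lscale 1 (lmonom (axis i 1) 1) + lscale 0 (lmonom (axis i 1) 1) \<in> forms_vanishing_at ?Q"
      by (intro forms_vanishing_at_linear[OF v]) simp
    then have "lmonom (axis i 1) 1 \<in> forms_vanishing_at ?Q" by (simp add: lscale_def)
    then have 1: "lmonom (axis i 1) 1 ^ ?m \<in> generated_ideal (coord_ring {i}) (point_generators ?m ?Q)"
      by (intro generated_ideal_point_power generated_ideal_base)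
    have Y: "(lmonom (axis i (- 1)) 1 :: laurent) ^ ?m \<in> coord_ring {i}"
      by (intro coord_ring_power coord_ring_single) (simp add: axis_def)
    have "(lmonom (axis i (- 1)) 1 ^ ?m * f) * lmonom (axis i 1) 1 ^ ?m =
        (lmonom (axis i (- 1)) 1 * lmonom (axis i 1) 1) ^ ?m * f"
      by (simp only: power_mult_distrib mult_ac)
    also have "lmonom (axis i (- 1)) 1 * lmonom (axis i 1) 1 = (1 :: laurent)"
      by (simp add: mult_single axis_uminus)
    finally have "(lmonom (axis i (- 1)) 1 ^ ?m * f) * lmonom (axis i 1) 1 ^ ?m = f" by simp
    then show ?thesis
      using generated_ideal_product[OF generated_ideal_mult[OF IH Y] 1 fat_ideal_generators_Suc] by simp
  next
    case False
    have 1: "f \<in> generated_ideal (coord_ring {i}) (point_generators ?m ?Q)"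
      by (rule vanishes_at_imp_point_power[OF assms(1,2) v False]) (use Suc.prems False in auto)
    have "\<exists>u. u \<in> generated_ideal (coord_ring {i}) (fat_ideal_generators n m P) \<and>
      1 - u \<in> generated_ideal (coord_ring {i}) (point_generators ?m ?Q)"
      by (rule fat_points_comaximal[OF v False]) (use Suc.prems(2)[of _ "Suc n"] in auto)
    then obtain u where u: "u \<in> generated_ideal (coord_ring {i}) (fat_ideal_generators n m P)"
      "1 - u \<in> generated_ideal (coord_ring {i}) (point_generators ?m ?Q)" by blast
    have "u * f + f * (1 - u) \<in> generated_ideal (coord_ring {i}) (fat_ideal_generators (Suc n) m P)"
      by (intro generated_ideal_add generated_ideal_product[OF u(1) 1] generated_ideal_product[OF IH u(2)]
        fat_ideal_generators_Suc)
    then show ?thesis by (simp add: algebra_simps)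
  qed
qed

section \<open>Elements of the product ideal vanish to the prescribed orders\<close>

lemma forms_vanishing_at_vanishes:
  "f \<in> forms_vanishing_at Q \<Longrightarrow> v \<in> hcoords Q \<Longrightarrow> vanishes_at 1 v f"
  unfolding One_nat_def vanishes_at_Suc by (simp add: forms_vanishing_at_def)

lemma fat_ideal_generators_vanish:
  assumes "b \<in> fat_ideal_generators n m P" "1 \<le> p" "p \<le> n" "v \<in> hcoords (P p)"
  shows "vanishes_at (m p) v b"
proof -
  obtain l where l: "b = (\<Prod>i=1..n. \<Prod>j<m i. l i j)"
    "\<And>i j. i \<in> {1..n} \<Longrightarrow> j < m i \<Longrightarrow> l i j \<in> forms_vanishing_at (P i)"
    using assms(1) by (auto simp: fat_ideal_generators_def)
  have c: "l i j \<in> coord_ring {}" if "i \<in> {1..n}" "j < m i" for i j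
    using l(2)[OF that] forms_vanishing_at_subset by blast
  have "vanishes_at k v (\<Prod>j<k. l p j)" if "k \<le> m p" for k
    using that
  proof (induction k)
    case (Suc k)
    have "vanishes_at (Suc k) v ((\<Prod>j<k. l p j) * l p k)"
      by (rule vanishes_at_mult[of _ "{}" _ _ k 1])
        (use Suc assms l(2)[of p k] c[of p] in \<open>auto intro!: coord_ring_prod forms_vanishing_at_vanishes[unfolded One_nat_def]\<close>)
    then show ?case by simp
  qed simp
  then have 1: "vanishes_at (m p) v (\<Prod>j<m p. l p j)" by simp
  have "b = (\<Prod>j<m p. l p j) * (\<Prod>i\<in>{1..n} - {p}. \<Prod>j<m i. l i j)"
    unfolding l(1) by (rule prod.remove) (use assms in auto)
  also have "vanishes_at (m p) v \<dots>"
    by (rule vanishes_at_mult[of _ "{}" _ _ "m p" 0])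
      (use 1 assms c in \<open>auto intro!: coord_ring_prod\<close>)
  finally show ?thesis .
qed

lemma fat_sections_vanish:
  assumes "f \<in> fat_sections t n m P S" "1 \<le> p" "p \<le> n" "v \<in> hcoords (P p)" "\<And>k. k \<in> S \<Longrightarrow> v $ k \<noteq> 0"
  shows "vanishes_at (m p) v f"
proof -
  have "f \<in> generated_ideal (coord_ring S) (fat_ideal_generators n m P)"
    using assms(1) by (simp add: fat_sections_def)
  then show ?thesis
  proof (induction rule: generated_ideal_induct)
    case (step r b f)
    have "vanishes_at (m p) v (r * b)"
      by (rule vanishes_at_mult[of _ S _ _ 0 "m p"])
        (use step assms fat_ideal_generators_subset[of n m P S] fat_ideal_generators_vanish in auto)
    then show ?case by (intro vanishes_at_add step)
  qed simp
qed

section \<open>Vanishing of the first cohomology\<close>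

text \<open>The coefficient of \<open>x\<^sup>e\<close> in the cochain is taken from \<open>c k j\<close>, where \<open>x\<^sub>k\<close> has a nonnegative
  exponent in \<open>x\<^sup>e\<close>.\<close>

lemma twisting_sheaf_cocycle:
  assumes c: "\<And>i j. c i j \<in> coord_ring {i, j}" "\<And>i j. homogeneous t (c i j)"
    "\<And>i j k. c j k - c i k + c i j = (0 :: laurent)"
  shows "\<exists>g. (\<forall>i. g i \<in> coord_ring {i} \<and> homogeneous t (g i)) \<and> (\<forall>i j. c i j = g j - g i)"
proof -
  define \<kappa> where "\<kappa> e = (SOME k :: 3. 0 \<le> (e :: int ^ 3) $ k)" for e
  define E where "E = (\<Union>i. \<Union>j. supp (c i j))"
  have fE: "finite E" by (simp add: E_def)
  define g where "g j = (\<Sum>e\<in>E. lmonom e (lcoeff (c (\<kappa> e) j) e))" for j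
  have g: "lcoeff (g j) e = lcoeff (c (\<kappa> e) j) e" for j e
  proof -
    have "lcoeff (g j) e = (\<Sum>e'\<in>E. if e' = e then lcoeff (c (\<kappa> e) j) e else 0)"
      unfolding g_def lookup_sum by (rule sum.cong) (auto simp: lookup_single when_def)
    also have "\<dots> = (if e \<in> E then lcoeff (c (\<kappa> e) j) e else 0)" using fE by simp
    also have "\<dots> = lcoeff (c (\<kappa> e) j) e" by (auto simp: E_def supp_iff)
    finally show ?thesis .
  qed
  have "g j \<in> coord_ring {j}" for j
    unfolding coord_ring_iff
  proof (intro allI impI)
    fix e l assume e: "lcoeff (g j) e \<noteq> 0" and l: "l \<notin> {j}"
    have nn: "0 \<le> e $ l'" if "l' \<notin> {\<kappa> e, j}" for l'
      using c(1)[of "\<kappa> e" j] e that unfolding coord_ring_iff g by blast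
    \<comment> \<open>With three variables some index lies outside this set, so \<open>e\<close> has
      a nonnegative exponent and the choice of \<open>\<kappa> e\<close> is a genuine one.\<close>
    have "{\<kappa> e, j} \<noteq> UNIV"
    proof
      assume "{\<kappa> e, j} = UNIV"
      moreover have "card {\<kappa> e, j} \<le> 2" by (simp add: card_insert_if)
      ultimately show False by simp
    qed
    then have "\<exists>k. 0 \<le> e $ k" using nn by blast
    then have "0 \<le> e $ \<kappa> e" unfolding \<kappa>_def by (rule someI_ex)
    then show "0 \<le> e $ l" using nn[of l] l by (cases "l = \<kappa> e") auto
  qed
  moreover have "homogeneous t (g j)" for j
    using c(2) by (auto simp: homogeneous_iff g)
  moreover have "c i j = g j - g i" for i j
  proof (rule poly_mapping_eqI)
    fix e
    have "lcoeff (c i j - c (\<kappa> e) j + c (\<kappa> e) i) e = 0" by (simp add: c(3))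
    then show "lcoeff (c i j) e = lcoeff (g j - g i) e"
      by (simp add: lookup_add lookup_minus g algebra_simps)
  qed
  ultimately show ?thesis by blast
qed

lemma fat_sections_subset:
  assumes "f \<in> fat_sections t s m P S"
  shows "f \<in> coord_ring S" "homogeneous t f"
  using assms generated_ideal_subset[OF fat_ideal_generators_subset[of s m P S]]
  by (auto simp: fat_sections_def)

lemma fat_sections_mono: "S \<subseteq> T \<Longrightarrow> fat_sections t s m P S \<subseteq> fat_sections t s m P T"
  using generated_ideal_mono[of S T "fat_ideal_generators s m P"] by (auto simp: fat_sections_def)

text \<open>Surjectivity of the map from forms of degree \<open>t\<close> to jets at the points. A
  jet is represented by a section \<open>G p\<close> on a chart around the point, as this is how the
  cochain of a cocycle supplies it.\<close>

definition jets_interpolated :: "int \<Rightarrow> nat \<Rightarrow> (nat \<Rightarrow> nat) \<Rightarrow> (nat \<Rightarrow> complex ^ 3) \<Rightarrow> bool" where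
  "jets_interpolated t s m v \<longleftrightarrow> (\<forall>G \<iota>. (\<forall>p\<in>{1..s}. G p \<in> coord_ring {\<iota> p} \<and> homogeneous t (G p) \<and> v p $ \<iota> p \<noteq> 0) \<longrightarrow>
     (\<exists>h\<in>forms t. \<forall>p\<in>{1..s}. vanishes_at (m p) (v p) (h - G p)))"

text \<open>The value of a section that is nonzero at \<open>P p\<close> can be prescribed there
  together with 0 at \<open>P q\<close>. A common point would make this contradictory, so
  distinctness is automatic on the open set.\<close>

lemma jets_interpolated_distinct:
  assumes I: "jets_interpolated t s m v" and t: "0 \<le> t" and m: "\<And>p. p \<in> {1..s} \<Longrightarrow> 1 \<le> m p"
    and v: "\<And>p. p \<in> {1..s} \<Longrightarrow> v p \<in> hcoords (P p)" and pq: "p \<in> {1..s}" "q \<in> {1..s}" "p \<noteq> q"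
  shows "P p \<noteq> P q"
proof
  assume eq: "P p = P q"
  have "\<exists>k. v r $ k \<noteq> 0" if "r \<in> {1..s}" for r
    using hcoords_eq(1)[OF v[OF that]] by (auto simp: Finite_Cartesian_Product.vec_eq_iff)
  then obtain \<iota> where \<iota>: "\<And>r. r \<in> {1..s} \<Longrightarrow> v r $ \<iota> r \<noteq> 0" by metis
  define G where "G r = (if r = p then lmonom (axis (\<iota> p) t) 1 else (0 :: laurent))" for r
  have "lmonom (axis k t) 1 \<in> coord_ring {l}" "homogeneous t (lmonom (axis k t) 1)" for k l :: 3
    using t by (auto intro!: coord_ring_single homogeneous_single simp: axis_nth_if sum.delta split: if_splits)
  then have "\<exists>h\<in>forms t. \<forall>r\<in>{1..s}. vanishes_at (m r) (v r) (h - G r)"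
    using \<iota> by (intro I[unfolded jets_interpolated_def, rule_format]) (auto simp: G_def)
  then obtain h where h: "h \<in> forms t" "\<And>r. r \<in> {1..s} \<Longrightarrow> vanishes_at (m r) (v r) (h - G r)" by blast
  have 0: "leval (h - G r) (v r) = 0" if "r \<in> {1..s}" for r
    using vanishes_at_mono[OF h(2)[OF that] m[OF that]] unfolding One_nat_def vanishes_at_Suc by blast
  have "leval (G p) (v p) = (v p $ \<iota> p) powi t"
  proof -
    have "(v p $ k) powi (axis (\<iota> p) t $ k) = (if k = \<iota> p then (v p $ \<iota> p) powi t else 1)" for k
      by (simp add: axis_nth_if)
    then show ?thesis by (simp add: G_def leval_single prod.delta)
  qed
  then have "leval h (v p) \<noteq> 0" using 0[OF pq(1)] \<iota>[OF pq(1)] by (simp add: leval_diff)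
  moreover have "leval h (v q) = 0" using 0[OF pq(2)] pq(3) by (simp add: leval_diff G_def)
  moreover obtain c where "c \<noteq> 0" "v p = c *s v q"
    using v[OF pq(1)] hcoords_eq(2)[OF v[OF pq(2)]] unfolding eq by auto
  ultimately show False using leval_homogeneous_scale[of t h c "v q"] h(1) by (simp add: forms_def)
qed

lemma h1_vanishes_if_interpolated:
  assumes I: "jets_interpolated t s m v" and v: "\<And>p. p \<in> {1..s} \<Longrightarrow> v p \<in> hcoords (P p)"
    and dist: "\<And>p q. p \<in> {1..s} \<Longrightarrow> q \<in> {1..s} \<Longrightarrow> p \<noteq> q \<Longrightarrow> P p \<noteq> P q"
  shows "h1_vanishes t s m P"
  unfolding h1_vanishes_def
proof (intro subset_antisym subsetI)
  fix c assume "c \<in> cech_coboundaries1 (fat_sections t s m P)"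
  then obtain g where g: "c = (\<lambda>i j. g j - g i)" "\<And>i. g i \<in> fat_sections t s m P {i}"
    by (auto simp: cech_coboundaries1_def)
  have "g j - g i \<in> fat_sections t s m P {i, j}" for i j
  proof -
    have "g i \<in> fat_sections t s m P {i, j}" "g j \<in> fat_sections t s m P {i, j}"
      using g(2) fat_sections_mono[of "{i}" "{i, j}"] fat_sections_mono[of "{j}" "{i, j}"] by blast+
    then show ?thesis by (auto simp: fat_sections_def intro: generated_ideal_diff homogeneous_diff)
  qed
  then show "c \<in> cech_cocycles1 (fat_sections t s m P)" by (simp add: cech_cocycles1_def g(1))
next
  fix c assume "c \<in> cech_cocycles1 (fat_sections t s m P)"
  then have c: "\<And>i j. c i j \<in> fat_sections t s m P {i, j}" "\<And>i j k. c j k - c i k + c i j = 0"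
    by (auto simp: cech_cocycles1_def)
  obtain g where g: "\<And>i. g i \<in> coord_ring {i}" "\<And>i. homogeneous t (g i)" "\<And>i j. c i j = g j - g i"
    using twisting_sheaf_cocycle[of c t] fat_sections_subset[OF c(1)] c(2) by blast
  have "\<exists>k. v r $ k \<noteq> 0" if "r \<in> {1..s}" for r
    using hcoords_eq(1)[OF v[OF that]] by (auto simp: Finite_Cartesian_Product.vec_eq_iff)
  then obtain \<iota> where \<iota>: "\<And>r. r \<in> {1..s} \<Longrightarrow> v r $ \<iota> r \<noteq> 0" by metis
  have "\<exists>h\<in>forms t. \<forall>p\<in>{1..s}. vanishes_at (m p) (v p) (h - g (\<iota> p))"
    using g(1,2) \<iota> by (intro I[unfolded jets_interpolated_def, rule_format, of "\<lambda>p. g (\<iota> p)" \<iota>]) auto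
  then obtain h where h: "h \<in> forms t" "\<And>p. p \<in> {1..s} \<Longrightarrow> vanishes_at (m p) (v p) (h - g (\<iota> p))" by blast
  have "g i - h \<in> fat_sections t s m P {i}" for i
    unfolding fat_sections_def mem_Collect_eq
  proof
    show "homogeneous t (g i - h)" using g(2) h(1) by (auto simp: forms_def intro: homogeneous_diff)
    show "g i - h \<in> generated_ideal (coord_ring {i}) (fat_ideal_generators s m P)"
    proof (rule fat_ideal_membership)
      show "g i - h \<in> coord_ring {i}"
        using g(1) h(1) coord_ring_mono[of "{}" "{i}"] by (auto simp: forms_def intro: coord_ring_diff)
      show "homogeneous t (g i - h)" by fact
      show "v p \<in> hcoords (P p)" if "1 \<le> p" "p \<le> s" for p using v that by simp
      show "P p \<noteq> P q" if "1 \<le> p" "p < q" "q \<le> s" for p q using dist that by simp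
      show "vanishes_at (m p) (v p) (g i - h)" if p: "1 \<le> p" "p \<le> s" "v p $ i \<noteq> 0" for p
      proof -
        \<comment> \<open>This section over the intersection of two charts is
          \<open>g i - g (\<iota> p)\<close>. Its vanishing lets \<open>h\<close>, fitted to the jet
          on the chart \<open>\<iota> p\<close>, fit on every chart \<open>i\<close> containing the
          point.\<close>
        have "vanishes_at (m p) (v p) (c (\<iota> p) i)"
          by (rule fat_sections_vanish[OF c(1)]) (use p v \<iota>[of p] in auto)
        then have "vanishes_at (m p) (v p) (c (\<iota> p) i - (h - g (\<iota> p)))"
          by (rule vanishes_at_diff) (use h(2)[of p] p in auto)
        then show ?thesis by (simp add: g(3))
      qed
    qed
  qed
  moreover have "c = (\<lambda>i j. (g j - h) - (g i - h))"
    by (intro ext) (simp add: g(3))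
  ultimately show "c \<in> cech_coboundaries1 (fat_sections t s m P)"
    unfolding cech_coboundaries1_def by (intro CollectI exI[of _ "\<lambda>i. g i - h"] conjI allI)
qed

section \<open>Determinants of multihomogeneous polynomials\<close>

lemma det_solvable:
  fixes M :: "nat \<Rightarrow> nat \<Rightarrow> complex"
  assumes "Determinant.det (mat N N (\<lambda>(i, j). M i j)) \<noteq> 0"
  shows "\<exists>u. \<forall>i<N. (\<Sum>j<N. M i j * u j) = y i"
    and "(\<And>i. i < N \<Longrightarrow> (\<Sum>j<N. M i j * u j) = 0) \<Longrightarrow> j < N \<Longrightarrow> u j = 0"
proof -
  define A where "A = mat N N (\<lambda>(i, j). M i j)"
  define D where "D = Determinant.det A"
  have A: "A \<in> carrier_mat N N" and D: "D \<noteq> 0"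
    using assms by (simp_all add: A_def D_def)
  define B where "B = adj_mat A"
  have B: "B \<in> carrier_mat N N" "A * B = D \<cdot>\<^sub>m 1\<^sub>m N" "B * A = D \<cdot>\<^sub>m 1\<^sub>m N"
    using adj_mat[OF A] by (simp_all add: B_def D_def)
  have AB: "(\<Sum>k<N. M i k * B $$ (k, j)) = (if i = j then D else 0)" if "i < N" "j < N" for i j
  proof -
    have "(A * B) $$ (i, j) = (\<Sum>k<N. M i k * B $$ (k, j))"
      using that B(1) by (auto simp: A_def scalar_prod_def atLeast0LessThan intro!: sum.cong)
    then show ?thesis unfolding B(2) using that by (cases "i = j") simp_all
  qed
  have BA: "(\<Sum>k<N. B $$ (i, k) * M k j) = (if i = j then D else 0)" if "i < N" "j < N" for i j
  proof -
    have "(B * A) $$ (i, j) = (\<Sum>k<N. B $$ (i, k) * M k j)"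
      using that B(1) by (auto simp: A_def scalar_prod_def atLeast0LessThan intro!: sum.cong)
    then show ?thesis unfolding B(3) using that by (cases "i = j") simp_all
  qed
  have "(\<Sum>j<N. M i j * (\<Sum>k<N. B $$ (j, k) * y k / D)) = y i" if i: "i < N" for i
  proof -
    have "(\<Sum>j<N. M i j * (\<Sum>k<N. B $$ (j, k) * y k / D)) =
      (\<Sum>k<N. (\<Sum>j<N. M i j * B $$ (j, k)) * (y k / D))"
      unfolding sum_distrib_left sum_distrib_right by (subst sum.swap) (simp add: mult_ac)
    also have "\<dots> = (\<Sum>k<N. if k = i then y i else 0)"
      by (rule sum.cong) (use AB[OF i] D in auto)
    finally show ?thesis using i by simp
  qed
  then show "\<exists>u. \<forall>i<N. (\<Sum>j<N. M i j * u j) = y i"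
    by (intro exI[of _ "\<lambda>j. \<Sum>k<N. B $$ (j, k) * y k / D"]) simp
  show "u j = 0" if u: "\<And>i. i < N \<Longrightarrow> (\<Sum>j<N. M i j * u j) = 0" and j: "j < N"
  proof -
    have "0 = (\<Sum>k<N. B $$ (j, k) * (\<Sum>l<N. M k l * u l))" using u by simp
    also have "\<dots> = (\<Sum>l<N. (\<Sum>k<N. B $$ (j, k) * M k l) * u l)"
      unfolding sum_distrib_left sum_distrib_right by (subst sum.swap) (simp add: mult_ac)
    also have "\<dots> = (\<Sum>l<N. if l = j then D * u j else 0)"
      by (rule sum.cong) (use BA[OF j] in auto)
    finally show ?thesis using j D by simp
  qed
qed

lemma det_nonzero:
  fixes M :: "nat \<Rightarrow> nat \<Rightarrow> complex"
  assumes "\<And>u. (\<And>i. i < N \<Longrightarrow> (\<Sum>j<N. M i j * u j) = 0) \<Longrightarrow> (\<And>j. j < N \<Longrightarrow> u j = 0)"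
  shows "Determinant.det (mat N N (\<lambda>(i, j). M i j)) \<noteq> 0"
proof
  define A where "A = mat N N (\<lambda>(i, j). M i j)"
  assume "Determinant.det (mat N N (\<lambda>(i, j). M i j)) = 0"
  then obtain v where v: "v \<in> carrier_vec N" "v \<noteq> 0\<^sub>v N" "A *\<^sub>v v = 0\<^sub>v N"
    using det_0_iff_vec_prod_zero_field[of A N] by (auto simp: A_def)
  have "(\<Sum>j<N. M i j * vec_index v j) = 0" if "i < N" for i
  proof -
    have "vec_index (A *\<^sub>v v) i = (\<Sum>j<N. M i j * vec_index v j)"
      using that v(1) by (auto simp: A_def scalar_prod_def atLeast0LessThan intro!: sum.cong)
    then show ?thesis using v(3) that by simp
  qed
  then have "vec_index v j = 0" if "j < N" for j using assms that by blast
  then have "v = 0\<^sub>v N" using v(1) by (intro eq_vecI) auto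
  then show False using v(2) by simp
qed

section \<open>Polynomials in the coordinates of all points\<close>

definition mpoly_monomial :: "(nat \<Rightarrow> complex ^ 3) \<Rightarrow> ((nat \<times> 3) \<Rightarrow>\<^sub>0 nat) \<Rightarrow> complex" where
  "mpoly_monomial x e = (\<Prod>z\<in>Poly_Mapping.keys e. (x (fst z) $ snd z) ^ Poly_Mapping.lookup e z)"

lemma mpoly_monomial_superset:
  assumes "finite A" "Poly_Mapping.keys e \<subseteq> A"
  shows "mpoly_monomial x e = (\<Prod>z\<in>A. (x (fst z) $ snd z) ^ Poly_Mapping.lookup e z)"
  unfolding mpoly_monomial_def
  by (rule prod.mono_neutral_left) (use assms in \<open>auto simp: in_keys_iff\<close>)

lemma mpoly_monomial_add: "mpoly_monomial x (a + b) = mpoly_monomial x a * mpoly_monomial x b"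
proof -
  let ?A = "Poly_Mapping.keys a \<union> Poly_Mapping.keys b"
  have "Poly_Mapping.keys (a + b) \<subseteq> ?A" by (rule keys_add)
  then show ?thesis
    using mpoly_monomial_superset[of ?A _ x]
    by (simp add: lookup_add power_add prod.distrib)
qed

lemma mpoly_eval_eq_peval: "mpoly_eval F x = peval (mpoly_monomial x) F"
  by (simp add: mpoly_eval_def peval_def mpoly_monomial_def case_prod_beta)

lemma comm_ring_hom_mpoly_eval: "comm_ring_hom (\<lambda>F. mpoly_eval F x)"
proof
  show "mpoly_eval 1 x = 1"
    using peval_single[of "mpoly_monomial x" 0 1]
    by (simp add: mpoly_eval_eq_peval mpoly_monomial_def)
qed (simp_all add: mpoly_eval_eq_peval peval_add peval_mult mpoly_monomial_add)

lemma multihomogeneous_add: "multihomogeneous s d F \<Longrightarrow> multihomogeneous s d G \<Longrightarrow> multihomogeneous s d (F + G)"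
  using keys_add[of F G] by (auto simp: multihomogeneous_def)

lemma multihomogeneous_sum:
  "(\<And>i. i \<in> A \<Longrightarrow> multihomogeneous s d (F i)) \<Longrightarrow> multihomogeneous s d (\<Sum>i\<in>A. F i)"
  by (induction A rule: infinite_finite_induct)
    (auto intro: multihomogeneous_add simp: multihomogeneous_def[of _ _ 0])

lemma multihomogeneous_mult:
  assumes "multihomogeneous s d F" "multihomogeneous s d' G"
  shows "multihomogeneous s (\<lambda>i. d i + d' i) (F * G)"
  unfolding multihomogeneous_def
proof
  fix e assume "e \<in> Poly_Mapping.keys (F * G)"
  then obtain a b where e: "e = a + b" "a \<in> Poly_Mapping.keys F" "b \<in> Poly_Mapping.keys G"
    using keys_mult[of F G] by blast
  moreover from this have "Poly_Mapping.keys a \<subseteq> {1..s} \<times> UNIV" "Poly_Mapping.keys b \<subseteq> {1..s} \<times> UNIV"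
    using assms unfolding multihomogeneous_def by blast+
  then have "Poly_Mapping.keys e \<subseteq> {1..s} \<times> UNIV" using keys_add[of a b] e(1) by blast
  ultimately show "Poly_Mapping.keys e \<subseteq> {1..s} \<times> UNIV \<and>
      (\<forall>i\<in>{1..s}. (\<Sum>k\<in>UNIV. Poly_Mapping.lookup e (i, k)) = d i + d' i)"
    using assms by (simp add: multihomogeneous_def lookup_add sum.distrib)
qed

lemma multihomogeneous_1: "multihomogeneous s (\<lambda>i. 0) 1"
  by (simp add: multihomogeneous_def)

lemma multihomogeneous_uminus: "multihomogeneous s d F \<Longrightarrow> multihomogeneous s d (- F)"
  by (auto simp: multihomogeneous_def in_keys_iff)

lemma multihomogeneous_prod:
  "(\<And>i. i \<in> A \<Longrightarrow> multihomogeneous s (d i) (F i)) \<Longrightarrow>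
    multihomogeneous s (\<lambda>p. \<Sum>i\<in>A. d i p) (\<Prod>i\<in>A. F i)"
  by (induction A rule: infinite_finite_induct)
    (auto intro: multihomogeneous_mult multihomogeneous_1)

text \<open>The multidegree of an entry depends on its row only, so all terms of the Leibniz
  expansion have the same multidegree.\<close>

lemma multihomogeneous_det:
  assumes "\<And>i j. i < N \<Longrightarrow> j < N \<Longrightarrow> multihomogeneous s (d i) (E i j)"
  shows "multihomogeneous s (\<lambda>p. \<Sum>i\<in>{0..<N}. d i p) (Determinant.det (mat N N (\<lambda>(i, j). E i j)))"
proof -
  have "multihomogeneous s (\<lambda>p. \<Sum>i\<in>{0..<N}. d i p) (signof \<pi> * (\<Prod>i = 0..<N. mat N N (\<lambda>(i, j). E i j) $$ (i, \<pi> i)))"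
    if \<pi>: "\<pi> permutes {0..<N}" for \<pi>
  proof -
    have "multihomogeneous s (d i) (mat N N (\<lambda>(i, j). E i j) $$ (i, \<pi> i))" if "i \<in> {0..<N}" for i
      using that permutes_in_image[OF \<pi>, of i] assms[of i "\<pi> i"] by simp
    then have "multihomogeneous s (\<lambda>p. \<Sum>i\<in>{0..<N}. d i p) (\<Prod>i = 0..<N. mat N N (\<lambda>(i, j). E i j) $$ (i, \<pi> i))"
      by (rule multihomogeneous_prod)
    then show ?thesis by (cases "evenperm \<pi>") (auto simp: sign_def intro: multihomogeneous_uminus)
  qed
  then show ?thesis
    by (subst det_def'[of _ N]) (auto intro!: multihomogeneous_sum)
qed

section \<open>Interpolation of jets on an open set of point configurations\<close>

definition jet :: "nat \<Rightarrow> nat \<Rightarrow> nat \<Rightarrow> laurent \<Rightarrow> laurent" where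
  "jet k a b f = (partial 1 ^^ k) ((partial 2 ^^ a) ((partial 3 ^^ b) f))"

text \<open>Triples \<open>(p, a, b)\<close> with \<open>a + b < m p\<close>; the order
  \<open>m p - 1 - a - b\<close> of the derivative in the first variable is then determined.\<close>

definition jet_index :: "nat \<Rightarrow> (nat \<Rightarrow> nat) \<Rightarrow> (nat \<times> nat \<times> nat) set" where
  "jet_index s m = Sigma {1..s} (\<lambda>p. Sigma {..<m p} (\<lambda>a. {..<m p - a}))"

text \<open>Only the derivatives of order exactly \<open>m p - 1\<close> are used: by Euler's identity they control the
  lower ones, there are as many of them as conditions, and they are homogeneous in the point.\<close>

definition jet_value :: "(nat \<Rightarrow> nat) \<Rightarrow> (nat \<Rightarrow> complex ^ 3) \<Rightarrow> nat \<times> nat \<times> nat \<Rightarrow> laurent \<Rightarrow> complex" where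
  "jet_value m x r f = (case r of (p, a, b) \<Rightarrow> leval (jet (m p - 1 - a - b) a b f) (x p))"

text \<open>The pair \<open>(j, l)\<close> stands for \<open>x\<^sub>1\<^sup>t\<^sup>-\<^sup>j\<^sup>-\<^sup>l x\<^sub>2\<^sup>l x\<^sub>3\<^sup>j\<close>, that is, for \<open>x\<^sup>l\<close> in slice \<open>j\<close>.\<close>

definition plane_exponent :: "nat \<Rightarrow> nat \<times> nat \<Rightarrow> int ^ 3" where
  "plane_exponent t z = axis 1 (int t - int (fst z) - int (snd z)) + axis 2 (int (snd z)) + axis 3 (int (fst z))"

definition plane_monomial :: "nat \<Rightarrow> nat \<times> nat \<Rightarrow> laurent" where
  "plane_monomial t z = lmonom (plane_exponent t z) 1"

lemma plane_exponent_nth [simp]: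
  "plane_exponent t z $ 1 = int t - int (fst z) - int (snd z)"
  "plane_exponent t z $ 2 = int (snd z)" "plane_exponent t z $ 3 = int (fst z)"
  by (simp_all add: plane_exponent_def axis_nth_if)

lemma funpow_partial_diff: "(partial k ^^ n) (f - g) = (partial k ^^ n) f - (partial k ^^ n) g"
  by (induction n) (simp_all add: partial_diff)

lemma jet_value_add: "jet_value m x r (f + g) = jet_value m x r f + jet_value m x r g"
  and jet_value_lscale: "jet_value m x r (lscale c f) = c * jet_value m x r f"
  and jet_value_diff: "jet_value m x r (f - g) = jet_value m x r f - jet_value m x r g"
  and jet_value_0 [simp]: "jet_value m x r 0 = 0"
  by (simp_all add: jet_value_def jet_def funpow_partial_add funpow_partial_lscale funpow_partial_diff
    leval_add leval_lscale leval_diff split: prod.splits)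

lemma jet_value_sum: "jet_value m x r (\<Sum>i\<in>A. F i) = (\<Sum>i\<in>A. jet_value m x r (F i))"
  by (induction A rule: infinite_finite_induct) (simp_all add: jet_value_add)

lemma funpow_partial_lmonom:
  "(partial k ^^ n) (lmonom e c) = lmonom (e - axis k (int n)) ((\<Prod>i<n. of_int (e $ k - int i)) * c)"
proof (induction n)
  case 0
  have z: "axis k 0 = (0 :: int ^ 3)" by (simp add: axis_eq_0_iff)
  show ?case by (simp add: z)
next
  case (Suc n)
  have z: "e - axis k (int n) - axis k 1 = e - axis k (1 + int n)"
    by (simp add: Finite_Cartesian_Product.vec_eq_iff axis_nth_if)
  show ?case by (simp add: Suc partial_single axis_nth_if mult_ac z)
qed

definition falling :: "int ^ 3 \<Rightarrow> nat \<Rightarrow> nat \<Rightarrow> nat \<Rightarrow> complex" where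
  "falling e k a b = (\<Prod>i<k. of_int (e $ 1 - int i)) * (\<Prod>i<a. of_int (e $ 2 - int i)) * (\<Prod>i<b. of_int (e $ 3 - int i))"

lemma jet_lmonom:
  "jet k a b (lmonom e 1) = lmonom (e - axis 1 (int k) - axis 2 (int a) - axis 3 (int b)) (falling e k a b)"
  unfolding jet_def funpow_partial_lmonom
  by (simp add: axis_nth_if falling_def algebra_simps)

lemma prod_falling_0: "0 \<le> j \<Longrightarrow> j < int k \<Longrightarrow> (\<Prod>i<k. of_int (j - int i)) = (0 :: complex)"
  by (rule prod_zero) (auto intro!: bexI[of _ "nat j"])

lemma falling_nonzero:
  assumes "falling e k a b \<noteq> 0" "\<And>l. 0 \<le> e $ l"
  shows "int k \<le> e $ 1" "int a \<le> e $ 2" "int b \<le> e $ 3"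
  using assms(1) assms(2)[of 1] assms(2)[of 2] assms(2)[of 3] prod_falling_0[of _ k] prod_falling_0[of _ a] prod_falling_0[of _ b]
  unfolding falling_def by (metis mult_eq_0_iff not_less)+

definition point_exponent :: "nat \<Rightarrow> nat \<Rightarrow> nat \<Rightarrow> nat \<Rightarrow> (nat \<times> 3) \<Rightarrow>\<^sub>0 nat" where
  "point_exponent p a b c = Poly_Mapping.single (p, 1) a + Poly_Mapping.single (p, 2) b + Poly_Mapping.single (p, 3) c"

lemma lookup_point_exponent:
  "Poly_Mapping.lookup (point_exponent p a b c) (i, k) =
    (if i = p then if k = 1 then a else if k = 2 then b else c else 0)"
  using exhaust_3[of k] by (auto simp: point_exponent_def lookup_add lookup_single when_def)

lemma keys_point_exponent: "Poly_Mapping.keys (point_exponent p a b c) \<subseteq> {p} \<times> UNIV"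
  by (auto simp: in_keys_iff lookup_point_exponent split: if_splits)

text \<open>The derivative of a monomial, read as a polynomial in the coordinates of the point. For
  nonnegative exponents the factor \<open>falling\<close> is 0 whenever one of the subtractions
  truncates.\<close>

definition jet_entry :: "(nat \<Rightarrow> nat) \<Rightarrow> nat \<times> nat \<times> nat \<Rightarrow> int ^ 3 \<Rightarrow> mpoly" where
  "jet_entry m r e = (case r of (p, a, b) \<Rightarrow>
     lmonom (point_exponent p (nat (e $ 1) - (m p - 1 - a - b)) (nat (e $ 2) - a) (nat (e $ 3) - b))
       (falling e (m p - 1 - a - b) a b))"

lemma mpoly_eval_jet_entry:
  assumes "\<And>l. 0 \<le> e $ l"
  shows "mpoly_eval (jet_entry m r e) x = jet_value m x r (lmonom e 1)"
proof -
  obtain p a b where r: "r = (p, a, b)" by (cases r)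
  define k where "k = m p - 1 - a - b"
  show ?thesis
  proof (cases "falling e k a b = 0")
    case True
    then show ?thesis
      by (simp only: r jet_entry_def jet_value_def prod.case k_def[symmetric] jet_lmonom)
        (simp add: mpoly_eval_eq_peval)
  next
    case False
    note le = falling_nonzero[OF False assms]
    have P: "(x p $ l) powi (e $ l - int n) = (x p $ l) ^ (nat (e $ l) - n)" if "int n \<le> e $ l" for l n
      using that by (simp add: power_int_def nat_diff_distrib')
    let ?e = "point_exponent p (nat (e $ 1) - k) (nat (e $ 2) - a) (nat (e $ 3) - b)"
    have "mpoly_monomial x ?e = (\<Prod>z\<in>{p} \<times> UNIV. (x (fst z) $ snd z) ^ Poly_Mapping.lookup ?e z)"
      by (rule mpoly_monomial_superset) (use keys_point_exponent in auto)
    also have "\<dots> = (\<Prod>l\<in>UNIV. (x p $ l) ^ Poly_Mapping.lookup ?e (p, l))"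
      by (rule prod.reindex_bij_witness[of _ "\<lambda>l. (p, l)" snd]) auto
    also have "\<dots> = (\<Prod>l\<in>UNIV. (x p $ l) powi ((e - axis 1 (int k) - axis 2 (int a) - axis 3 (int b)) $ l))"
    proof (rule prod.cong[OF refl])
      fix l
      show "(x p $ l) ^ Poly_Mapping.lookup ?e (p, l) =
          (x p $ l) powi ((e - axis 1 (int k) - axis 2 (int a) - axis 3 (int b)) $ l)"
        using exhaust_3[of l] P[OF le(1)] P[OF le(2)] P[OF le(3)]
        by (auto simp: lookup_point_exponent axis_nth_if)
    qed
    finally show ?thesis
      by (simp only: r jet_entry_def jet_value_def prod.case k_def[symmetric] jet_lmonom
        mpoly_eval_eq_peval leval_single peval_single)
  qed
qed

text \<open>The degree in the point is \<open>t - (m p - 1)\<close> for every monomial of degree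
  \<open>t\<close>, as \<open>multihomogeneous_det\<close> requires of a row.\<close>

lemma multihomogeneous_jet_entry:
  assumes "\<And>l. 0 \<le> e $ l" "(\<Sum>l\<in>UNIV. e $ l) = int t" "(p, a, b) \<in> jet_index s m"
  shows "multihomogeneous s (\<lambda>i. if i = p then t - (m p - 1) else 0) (jet_entry m (p, a, b) e)"
proof (cases "falling e (m p - 1 - a - b) a b = 0")
  case True
  then show ?thesis by (simp add: jet_entry_def multihomogeneous_def)
next
  case False
  note le = falling_nonzero[OF False assms(1)]
  have r: "1 \<le> p" "p \<le> s" "a + b < m p" using assms(3) by (auto simp: jet_index_def)
  define e' where "e' = point_exponent p (nat (e $ 1) - (m p - 1 - a - b)) (nat (e $ 2) - a) (nat (e $ 3) - b)"
  define k where "k = m p - 1 - a - b"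
  have k: "m p - 1 = k + a + b" using r k_def by simp
  obtain x y z where xyz: "e $ 1 = int k + int x" "e $ 2 = int a + int y" "e $ 3 = int b + int z"
    using le zle_iff_zadd unfolding k_def by metis
  have "e $ 1 + e $ 2 + e $ 3 = int t" using assms(2) by (simp add: sum_3)
  then have t: "t = k + x + (a + y) + (b + z)" using xyz by linarith
  have "nat (e $ 1) = k + x" "nat (e $ 2) = a + y" "nat (e $ 3) = b + z" using xyz by linarith+
  then have "nat (e $ 1) - (m p - 1 - a - b) + (nat (e $ 2) - a) + (nat (e $ 3) - b) = t - (m p - 1)"
    unfolding k_def[symmetric] k t by simp
  then have "(\<Sum>k\<in>UNIV. Poly_Mapping.lookup e' (i, k)) = (if i = p then t - (m p - 1) else 0)" for i
    unfolding sum_3 e'_def lookup_point_exponent by (cases "i = p") simp_all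
  moreover have "Poly_Mapping.keys e' \<subseteq> {1..s} \<times> UNIV"
    using keys_point_exponent r unfolding e'_def by fastforce
  moreover have "jet_entry m (p, a, b) e = lmonom e' (falling e (m p - 1 - a - b) a b)"
    by (simp only: jet_entry_def e'_def prod.case)
  ultimately show ?thesis using False by (simp add: multihomogeneous_def)
qed

text \<open>The set \<open>C\<close> of monomials stays fixed while the points vary, which turns
  bijectivity into the nonvanishing of a single determinant.\<close>

definition jets_bijective :: "nat \<Rightarrow> (nat \<Rightarrow> nat) \<Rightarrow> nat \<Rightarrow> (nat \<times> nat) set \<Rightarrow> (nat \<Rightarrow> complex ^ 3) \<Rightarrow> bool" where
  "jets_bijective s m t C x \<longleftrightarrow>
    (\<forall>y. \<exists>u. \<forall>r\<in>jet_index s m. jet_value m x r (\<Sum>z\<in>C. lscale (u z) (plane_monomial t z)) = y r) \<and>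
    (\<forall>u. (\<forall>r\<in>jet_index s m. jet_value m x r (\<Sum>z\<in>C. lscale (u z) (plane_monomial t z)) = 0) \<longrightarrow> (\<forall>z\<in>C. u z = 0))"

lemma finite_jet_index: "finite (jet_index s m)"
  by (simp add: jet_index_def)

lemma jets_bijective_open:
  assumes C: "finite C" "\<And>z. z \<in> C \<Longrightarrow> fst z + snd z \<le> t" "card C = card (jet_index s m)"
    and x0: "\<And>p. x0 p \<noteq> 0"
    and ker: "\<And>u. (\<And>r. r \<in> jet_index s m \<Longrightarrow> jet_value m x0 r (\<Sum>z\<in>C. lscale (u z) (plane_monomial t z)) = 0)
      \<Longrightarrow> (\<And>z. z \<in> C \<Longrightarrow> u z = 0)"
  shows "\<exists>U. zariski_open s U \<and> U \<noteq> {} \<and>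
    (\<forall>P\<in>U. \<exists>x. (\<forall>p\<in>{1..s}. x p \<in> hcoords (P p)) \<and> jets_bijective s m t C x)"
proof -
  define N where "N = card C"
  obtain \<gamma> where \<gamma>: "bij_betw \<gamma> {..<N} C"
    using ex_bij_betw_nat_finite[OF C(1)] by (auto simp: N_def atLeast0LessThan)
  obtain \<rho> where \<rho>: "bij_betw \<rho> {..<N} (jet_index s m)"
    using ex_bij_betw_nat_finite[OF finite_jet_index[of s m]] C(3) by (auto simp: N_def atLeast0LessThan)
  have nonneg: "0 \<le> plane_exponent t z $ l" if "z \<in> C" for z l
    using exhaust_3[of l] C(2)[OF that] by auto
  define F where "F = Determinant.det (mat N N (\<lambda>(i, j). jet_entry m (\<rho> i) (plane_exponent t (\<gamma> j))))"
  define M where "M x i j = jet_value m x (\<rho> i) (plane_monomial t (\<gamma> j))" for x i j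
  have F: "mpoly_eval F x = Determinant.det (mat N N (\<lambda>(i, j). M x i j))" for x
  proof -
    interpret comm_ring_hom "\<lambda>F. mpoly_eval F x" by (rule comm_ring_hom_mpoly_eval)
    have "mpoly_eval F x = Determinant.det (map_mat (\<lambda>F. mpoly_eval F x)
        (mat N N (\<lambda>(i, j). jet_entry m (\<rho> i) (plane_exponent t (\<gamma> j)))))"
      unfolding F_def by (rule hom_det[symmetric])
    also have "map_mat (\<lambda>F. mpoly_eval F x) (mat N N (\<lambda>(i, j). jet_entry m (\<rho> i) (plane_exponent t (\<gamma> j)))) =
        mat N N (\<lambda>(i, j). M x i j)"
    proof (rule eq_matI)
      fix i j assume "i < dim_row (mat N N (\<lambda>(i, j). M x i j))" "j < dim_col (mat N N (\<lambda>(i, j). M x i j))"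
      then have "i < N" "j < N" by simp_all
      moreover from this have "\<gamma> j \<in> C" using bij_betwE[OF \<gamma>] by simp
      ultimately show "map_mat (\<lambda>F. mpoly_eval F x) (mat N N (\<lambda>(i, j). jet_entry m (\<rho> i) (plane_exponent t (\<gamma> j)))) $$ (i, j) =
          mat N N (\<lambda>(i, j). M x i j) $$ (i, j)"
        by (simp add: M_def plane_monomial_def mpoly_eval_jet_entry[OF nonneg])
    qed auto
    finally show ?thesis .
  qed
  have comb: "jet_value m x (\<rho> i) (\<Sum>z\<in>C. lscale (u z) (plane_monomial t z)) = (\<Sum>j<N. M x i j * u (\<gamma> j))" for x u i
  proof -
    have "jet_value m x (\<rho> i) (\<Sum>z\<in>C. lscale (u z) (plane_monomial t z)) =
        (\<Sum>z\<in>C. jet_value m x (\<rho> i) (plane_monomial t z) * u z)"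
      by (simp add: jet_value_sum jet_value_lscale mult.commute)
    also have "\<dots> = (\<Sum>j<N. M x i j * u (\<gamma> j))"
      unfolding M_def by (rule sum.reindex_bij_betw[OF \<gamma>, symmetric])
    finally show ?thesis .
  qed
  have \<gamma>inv: "inv_into {..<N} \<gamma> (\<gamma> j) = j" if "j < N" for j
    using bij_betw_inv_into_left[OF \<gamma>] that by simp
  have \<rho>inv: "inv_into {..<N} \<rho> (\<rho> j) = j" if "j < N" for j
    using bij_betw_inv_into_left[OF \<rho>] that by simp
  have bijective: "jets_bijective s m t C x" if "mpoly_eval F x \<noteq> 0" for x
    unfolding jets_bijective_def
  proof (intro conjI allI impI)
    fix y :: "nat \<times> nat \<times> nat \<Rightarrow> complex"
    obtain w where w: "\<forall>i<N. (\<Sum>j<N. M x i j * w j) = y (\<rho> i)"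
      using det_solvable(1)[of N "M x" "\<lambda>i. y (\<rho> i)"] \<open>mpoly_eval F x \<noteq> 0\<close> F by auto
    show "\<exists>u. \<forall>r\<in>jet_index s m. jet_value m x r (\<Sum>z\<in>C. lscale (u z) (plane_monomial t z)) = y r"
    proof (intro exI ballI)
      fix r assume "r \<in> jet_index s m"
      then obtain i where i: "i < N" "r = \<rho> i" using \<rho> by (force simp: bij_betw_def)
      show "jet_value m x r (\<Sum>z\<in>C. lscale (w (inv_into {..<N} \<gamma> z)) (plane_monomial t z)) = y r"
        unfolding i(2) comb using w i(1) by (simp add: \<gamma>inv)
    qed
  next
    fix u :: "nat \<times> nat \<Rightarrow> complex"
    assume "\<forall>r\<in>jet_index s m. jet_value m x r (\<Sum>z\<in>C. lscale (u z) (plane_monomial t z)) = 0"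
    then have "(\<Sum>j<N. M x i j * u (\<gamma> j)) = 0" if "i < N" for i
      using bij_betwE[OF \<rho>] that by (simp add: comb[symmetric])
    then have "u (\<gamma> j) = 0" if "j < N" for j
      using det_solvable(2)[of N "M x" "\<lambda>j. u (\<gamma> j)"] \<open>mpoly_eval F x \<noteq> 0\<close> F that by auto
    then show "\<forall>z\<in>C. u z = 0" using \<gamma> by (force simp: bij_betw_def)
  qed
  have "mpoly_eval F x0 \<noteq> 0"
    unfolding F
  proof (rule det_nonzero)
    fix u j assume u: "\<And>i. i < N \<Longrightarrow> (\<Sum>j<N. M x0 i j * u j) = 0" and j: "j < N"
    have "u (inv_into {..<N} \<gamma> z) = 0" if "z \<in> C" for z
    proof (rule ker[OF _ that])
      fix r assume "r \<in> jet_index s m"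
      then obtain i where i: "i < N" "r = \<rho> i" using \<rho> by (force simp: bij_betw_def)
      show "jet_value m x0 r (\<Sum>z\<in>C. lscale (u (inv_into {..<N} \<gamma> z)) (plane_monomial t z)) = 0"
        unfolding i(2) comb using u[OF i(1)] by (simp add: \<gamma>inv)
    qed
    from this[of "\<gamma> j"] show "u j = 0" using bij_betwE[OF \<gamma>] j by (simp add: \<gamma>inv)
  qed
  have hom: "\<exists>d. multihomogeneous s d F"
  proof -
    have "\<exists>d. \<forall>j<N. multihomogeneous s d (jet_entry m (\<rho> i) (plane_exponent t (\<gamma> j)))" if "i < N" for i
    proof -
      obtain p a b where r: "\<rho> i = (p, a, b)" by (cases "\<rho> i")
      then have "(p, a, b) \<in> jet_index s m" using bij_betwE[OF \<rho>] that by force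
      moreover have "\<gamma> j \<in> C" if "j < N" for j using bij_betwE[OF \<gamma>] that by simp
      ultimately have "multihomogeneous s (\<lambda>i. if i = p then t - (m p - 1) else 0)
          (jet_entry m (p, a, b) (plane_exponent t (\<gamma> j)))" if "j < N" for j
        using that nonneg by (intro multihomogeneous_jet_entry) (auto simp: sum_3)
      then show ?thesis unfolding r by blast
    qed
    then obtain d where "\<And>i j. i < N \<Longrightarrow> j < N \<Longrightarrow> multihomogeneous s (d i) (jet_entry m (\<rho> i) (plane_exponent t (\<gamma> j)))"
      by metis
    then have "multihomogeneous s (\<lambda>p. \<Sum>i\<in>{0..<N}. d i p) F"
      unfolding F_def by (rule multihomogeneous_det)
    then show ?thesis by blast
  qed
  define U where "U = ({1..s} \<rightarrow>\<^sub>E UNIV) - common_zeros s {F}"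
  have "zariski_open s U"
    unfolding zariski_open_def U_def using hom by blast
  moreover obtain P0 where P0: "\<And>p. x0 p \<in> hcoords (P0 p)" using ex_point[OF x0] by metis
  have "restrict P0 {1..s} \<in> U"
    unfolding U_def common_zeros_def using \<open>mpoly_eval F x0 \<noteq> 0\<close> P0 by auto
  moreover have "\<exists>x. (\<forall>p\<in>{1..s}. x p \<in> hcoords (P p)) \<and> jets_bijective s m t C x" if "P \<in> U" for P
    using that bijective unfolding U_def common_zeros_def by blast
  ultimately show ?thesis by blast
qed

lemma partial_funpow_commute: "partial k ((partial l ^^ n) f) = (partial l ^^ n) (partial k f)"
  by (induction n) (simp_all add: partial_commute[of k])

lemma fold_partial_jet: "\<exists>k a b. k + a + b = length ks \<and> fold partial ks f = jet k a b f"
proof (induction ks arbitrary: f)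
  case Nil
  show ?case by (intro exI[of _ 0]) (simp add: jet_def)
next
  case (Cons l ks)
  obtain k a b where j: "k + a + b = length ks" "fold partial ks (partial l f) = jet k a b (partial l f)"
    using Cons.IH by blast
  have s: "(partial l' ^^ n) (partial l' f) = (partial l' ^^ Suc n) f" for l' n f
    by (simp add: funpow_swap1)
  consider "l = 1" | "l = 2" | "l = 3" using exhaust_3 by blast
  then have "\<exists>k' a' b'. k' + a' + b' = length (l # ks) \<and> jet k a b (partial l f) = jet k' a' b' f"
  proof cases
    case 1
    have "jet k a b (partial 1 f) = (partial 1 ^^ k) (partial 1 ((partial 2 ^^ a) ((partial 3 ^^ b) f)))"
      by (simp only: jet_def partial_funpow_commute)
    then have "jet k a b (partial l f) = jet (Suc k) a b f" by (simp only: 1 jet_def s)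
    then show ?thesis using j(1) by (intro exI[of _ "Suc k"] exI[of _ a] exI[of _ b]) simp
  next
    case 2
    have "jet k a b (partial 2 f) = (partial 1 ^^ k) ((partial 2 ^^ a) (partial 2 ((partial 3 ^^ b) f)))"
      by (simp only: jet_def partial_funpow_commute)
    then have "jet k a b (partial l f) = jet k (Suc a) b f" by (simp only: 2 jet_def s)
    then show ?thesis using j(1) by (intro exI[of _ k] exI[of _ "Suc a"] exI[of _ b]) simp
  next
    case 3
    then have "jet k a b (partial l f) = jet k a (Suc b) f"
      by (simp only: jet_def s)
    then show ?thesis using j(1) by (intro exI[of _ k] exI[of _ a] exI[of _ "Suc b"]) simp
  qed
  then show ?case using j(2) by auto
qed

lemma jet_fold_partial: "jet k a b f = fold partial (replicate b 3 @ replicate a 2 @ replicate k 1) f"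
  by (simp add: jet_def fold_partial_replicate)

lemma vanishes_at_iff_jets:
  assumes "f \<in> coord_ring S" "homogeneous (int t) f" "\<And>k. k \<in> S \<Longrightarrow> x p $ k \<noteq> 0"
    "p \<in> {1..s}" "1 \<le> m p" "m p \<le> t"
  shows "vanishes_at (m p) (x p) f \<longleftrightarrow> (\<forall>a b. (p, a, b) \<in> jet_index s m \<longrightarrow> jet_value m x (p, a, b) f = 0)"
proof
  assume v: "vanishes_at (m p) (x p) f"
  show "\<forall>a b. (p, a, b) \<in> jet_index s m \<longrightarrow> jet_value m x (p, a, b) f = 0"
  proof (intro allI impI)
    fix a b assume "(p, a, b) \<in> jet_index s m"
    then have "a + b < m p" by (auto simp: jet_index_def)
    then show "jet_value m x (p, a, b) f = 0"
      unfolding jet_value_def prod.case jet_fold_partial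
      by (intro v[unfolded vanishes_at_def, rule_format]) simp
  qed
next
  assume j: "\<forall>a b. (p, a, b) \<in> jet_index s m \<longrightarrow> jet_value m x (p, a, b) f = 0"
  have "vanishes_at (Suc (m p - 1)) (x p) f"
  proof (rule vanishes_at_if_top[OF assms(2,1,3)])
    show "int (m p - 1) \<le> int t" using assms(6) by simp
    fix ks :: "3 list" assume ks: "length ks = m p - 1"
    obtain k a b where kab: "k + a + b = m p - 1" "fold partial ks f = jet k a b f"
      using fold_partial_jet[of ks f] ks by auto
    then have "(p, a, b) \<in> jet_index s m" using assms(4,5) by (auto simp: jet_index_def)
    moreover have "k = m p - 1 - a - b" using kab(1) by simp
    ultimately show "leval (fold partial ks f) (x p) = 0"
      using j unfolding kab(2) by (auto simp: jet_value_def)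
  qed
  then show "vanishes_at (m p) (x p) f" using assms(5) by simp
qed

lemma plane_monomial_form: "fst z + snd z \<le> t \<Longrightarrow> plane_monomial t z \<in> forms (int t)"
proof -
  assume z: "fst z + snd z \<le> t"
  have "0 \<le> plane_exponent t z $ k" for k using exhaust_3[of k] z by auto
  then show ?thesis
    by (auto simp: forms_def plane_monomial_def sum_3 intro!: coord_ring_single homogeneous_single)
qed

lemma forms_diff: "f \<in> forms d \<Longrightarrow> g \<in> forms d \<Longrightarrow> f - g \<in> forms d"
  and forms_lscale: "f \<in> forms d \<Longrightarrow> lscale c f \<in> forms d"
  and forms_sum: "(\<And>i. i \<in> A \<Longrightarrow> F i \<in> forms d) \<Longrightarrow> (\<Sum>i\<in>A. F i) \<in> forms d"
  by (auto simp: forms_def intro: coord_ring_diff homogeneous_diff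
    coord_ring_lscale homogeneous_lscale coord_ring_sum homogeneous_sum)

lemma jets_bijective_interpolated:
  assumes b: "jets_bijective s m t C x" and C: "\<And>z. z \<in> C \<Longrightarrow> fst z + snd z \<le> t"
    and m: "\<And>p. p \<in> {1..s} \<Longrightarrow> 1 \<le> m p" "\<And>p. p \<in> {1..s} \<Longrightarrow> m p \<le> t"
  shows "jets_interpolated (int t) s m x"
  unfolding jets_interpolated_def
proof (intro allI impI)
  fix G :: "nat \<Rightarrow> laurent" and \<iota>
  assume G: "\<forall>p\<in>{1..s}. G p \<in> coord_ring {\<iota> p} \<and> homogeneous (int t) (G p) \<and> x p $ \<iota> p \<noteq> 0"
  obtain u where u: "\<And>r. r \<in> jet_index s m \<Longrightarrow>
    jet_value m x r (\<Sum>z\<in>C. lscale (u z) (plane_monomial t z)) = jet_value m x r (G (fst r))"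
    using b unfolding jets_bijective_def by meson
  define h where "h = (\<Sum>z\<in>C. lscale (u z) (plane_monomial t z))"
  have h: "h \<in> forms (int t)"
    unfolding h_def by (intro forms_sum forms_lscale plane_monomial_form C)
  have "vanishes_at (m p) (x p) (h - G p)" if p: "p \<in> {1..s}" for p
  proof (subst vanishes_at_iff_jets)
    show "h - G p \<in> coord_ring {\<iota> p}" "homogeneous (int t) (h - G p)"
      using h G p coord_ring_mono[of "{}" "{\<iota> p}"]
      by (auto simp: forms_def intro: coord_ring_diff homogeneous_diff)
    show "\<forall>a b. (p, a, b) \<in> jet_index s m \<longrightarrow> jet_value m x (p, a, b) (h - G p) = 0"
      using u by (simp add: jet_value_diff h_def)
  qed (use G p m in auto)
  then show "\<exists>h\<in>forms (int t). \<forall>p\<in>{1..s}. vanishes_at (m p) (x p) (h - G p)" using h by blast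
qed

section \<open>Dimension of the linear system\<close>

definition lattice_triangle :: "nat \<Rightarrow> (nat \<times> nat) set" where
  "lattice_triangle t = Sigma {..t} (\<lambda>j. {..<t + 1 - j})"

lemma lattice_triangle_iff: "z \<in> lattice_triangle t \<longleftrightarrow> fst z + snd z \<le> t"
  by (cases z) (auto simp: lattice_triangle_def)

lemma finite_lattice_triangle: "finite (lattice_triangle t)"
  by (simp add: lattice_triangle_def)

lemma card_lattice_triangle: "card (lattice_triangle t) = (t + 2) choose 2"
proof -
  have "card (lattice_triangle t) = (\<Sum>j\<le>t. t + 1 - j)" by (simp add: lattice_triangle_def)
  also have "\<dots> = \<Sum>{1..t + 1}"
    by (rule sum.reindex_bij_witness[of _ "\<lambda>i. t + 1 - i" "\<lambda>i. t + 1 - i"]) auto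
  also have "\<dots> = (t + 2) choose 2"
    using gauss_sum_from_Suc_0[of "t + 1", where 'a=nat] by (simp add: choose_two mult.commute)
  finally show ?thesis .
qed

lemma plane_exponent_inject: "plane_exponent t z = plane_exponent t w \<longleftrightarrow> z = w"
proof
  assume "plane_exponent t z = plane_exponent t w"
  then have "plane_exponent t z $ 2 = plane_exponent t w $ 2" "plane_exponent t z $ 3 = plane_exponent t w $ 3"
    by (simp_all only:)
  then show "z = w" by (simp add: prod_eq_iff)
qed simp

lemma lcoeff_plane_monomial:
  "lcoeff (plane_monomial t z) (plane_exponent t w) = (if z = w then 1 else 0)"
  by (simp add: plane_monomial_def lookup_single when_def plane_exponent_inject)

lemma forms_plane_monomials:
  assumes "f \<in> forms (int t)"
  shows "f = (\<Sum>z\<in>lattice_triangle t. lscale (lcoeff f (plane_exponent t z)) (plane_monomial t z))"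
proof (rule poly_mapping_eqI)
  fix e
  have s: "lcoeff (\<Sum>z\<in>lattice_triangle t. lscale (lcoeff f (plane_exponent t z)) (plane_monomial t z)) e =
    (\<Sum>z\<in>lattice_triangle t. if e = plane_exponent t z then lcoeff f e else 0)"
    unfolding lookup_sum by (rule sum.cong) (auto simp: plane_monomial_def lookup_single when_def)
  show "lcoeff f e = lcoeff (\<Sum>z\<in>lattice_triangle t. lscale (lcoeff f (plane_exponent t z)) (plane_monomial t z)) e"
  proof (cases "\<exists>z\<in>lattice_triangle t. e = plane_exponent t z")
    case True
    then obtain z where z: "z \<in> lattice_triangle t" "e = plane_exponent t z" by blast
    then show ?thesis unfolding s by (simp add: plane_exponent_inject finite_lattice_triangle)
  next
    case False
    have "lcoeff f e = 0"
    proof (rule ccontr)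
      assume e: "lcoeff f e \<noteq> 0"
      then have nn: "0 \<le> e $ k" for k using assms by (auto simp: forms_def coord_ring_iff)
      have "e $ 1 + e $ 2 + e $ 3 = int t" using assms e by (auto simp: forms_def homogeneous_iff sum_3)
      moreover obtain a b where ab: "e $ 2 = int a" "e $ 3 = int b"
        using nn[of 2] nn[of 3] by (metis nonneg_int_cases)
      moreover have "e = plane_exponent t (b, a)"
        unfolding Finite_Cartesian_Product.vec_eq_iff forall_3 using calculation by simp
      ultimately show False using False nn[of 1] by (auto simp: lattice_triangle_iff)
    qed
    then show ?thesis unfolding s using False by (simp add: sum.neutral)
  qed
qed

text \<open>Each monomial outside \<open>C\<close> is corrected by the combination of monomials in
  \<open>C\<close> with the same jets. The corrected forms are independent by their coefficients
  outside \<open>C\<close>. They span, because a member of the system with all these coefficients 0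
  is zero by injectivity on \<open>C\<close>.\<close>

lemma system_dim_jets_bijective:
  assumes b: "jets_bijective s m t C x" and C: "C \<subseteq> lattice_triangle t"
    and x: "\<And>p. p \<in> {1..s} \<Longrightarrow> x p \<in> hcoords (P p)"
    and m: "\<And>p. p \<in> {1..s} \<Longrightarrow> 1 \<le> m p" "\<And>p. p \<in> {1..s} \<Longrightarrow> m p \<le> t"
  shows "laurent.dim (system_forms (int t) s m P) = card (lattice_triangle t) - card C"
proof -
  let ?V = "system_forms (int t) s m P" and ?D = "lattice_triangle t - C"
  have V: "?V = {f \<in> forms (int t). \<forall>r\<in>jet_index s m. jet_value m x r f = 0}"
  proof -
    have "(\<forall>p\<in>{1..s}. vanishes_to_order (m p) (P p) f) \<longleftrightarrow> (\<forall>r\<in>jet_index s m. jet_value m x r f = 0)"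
      if f: "f \<in> forms (int t)" for f
    proof -
      have "vanishes_to_order (m p) (P p) f \<longleftrightarrow> (\<forall>a b. (p, a, b) \<in> jet_index s m \<longrightarrow> jet_value m x (p, a, b) f = 0)"
        if p: "p \<in> {1..s}" for p
        using vanishes_to_order_iff[OF x[OF p]] vanishes_at_iff_jets[of f "{}" t x p s m] f p m
        by (auto simp: forms_def)
      moreover have "p \<in> {1..s}" if "(p, a, b) \<in> jet_index s m" for p a b
        using that by (simp add: jet_index_def)
      ultimately show ?thesis by fast
    qed
    then show ?thesis by (auto simp: system_forms_def)
  qed
  have fin: "finite C" "finite ?D" using C finite_lattice_triangle finite_subset by auto
  have "\<exists>u. \<forall>r\<in>jet_index s m. jet_value m x r (\<Sum>w\<in>C. lscale (u w) (plane_monomial t w)) =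
    jet_value m x r (plane_monomial t z)" for z
    using b[unfolded jets_bijective_def, THEN conjunct1, THEN spec, of "\<lambda>r. jet_value m x r (plane_monomial t z)"] .
  then obtain u where u: "\<And>z r. r \<in> jet_index s m \<Longrightarrow>
    jet_value m x r (\<Sum>w\<in>C. lscale (u z w) (plane_monomial t w)) = jet_value m x r (plane_monomial t z)" by metis
  define \<beta> where "\<beta> z = plane_monomial t z - (\<Sum>w\<in>C. lscale (u z w) (plane_monomial t w))" for z
  have \<beta>c: "lcoeff (\<beta> z) (plane_exponent t w) = (if z = w then 1 else 0)" if "w \<notin> C" for z w
    using that by (auto simp: \<beta>_def lookup_minus lookup_sum lcoeff_plane_monomial intro!: sum.neutral)
  have inj: "inj_on \<beta> ?D"
    by (rule inj_onI) (metis \<beta>c DiffD2 zero_neq_one)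
  have \<beta>V: "\<beta> z \<in> ?V" if "z \<in> ?D" for z
    unfolding V \<beta>_def using that C u
    by (auto simp: jet_value_diff lattice_triangle_iff intro!: forms_diff forms_sum forms_lscale plane_monomial_form)
  have "laurent.independent (\<beta> ` ?D)"
  proof
    assume "laurent.dependent (\<beta> ` ?D)"
    then obtain c z where c: "z \<in> ?D" "c (\<beta> z) \<noteq> 0" "(\<Sum>v\<in>\<beta> ` ?D. lscale (c v) v) = 0"
      using fin by (auto simp: laurent.dependent_finite)
    have "0 = (\<Sum>w\<in>?D. lcoeff (lscale (c (\<beta> w)) (\<beta> w)) (plane_exponent t z))"
    proof -
      have "(\<Sum>w\<in>?D. lscale (c (\<beta> w)) (\<beta> w)) = 0"
        using c(3) by (simp only: sum.reindex[OF inj] comp_def)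
      then show ?thesis by (simp only: lookup_sum[symmetric] lookup_zero)
    qed
    also have "\<dots> = (\<Sum>w\<in>?D. if w = z then c (\<beta> z) else 0)"
      by (rule sum.cong) (use c(1) \<beta>c in auto)
    also have "\<dots> = c (\<beta> z)" using c(1) fin by simp
    finally show False using c(2) by simp
  qed
  moreover have "?V \<subseteq> laurent.span (\<beta> ` ?D)"
  proof
    fix f assume f: "f \<in> ?V"
    define g where "g = f - (\<Sum>z\<in>?D. lscale (lcoeff f (plane_exponent t z)) (\<beta> z))"
    have g0: "jet_value m x r g = 0" if "r \<in> jet_index s m" for r
      using f \<beta>V that by (simp add: V g_def jet_value_diff jet_value_sum jet_value_lscale)
    have gf: "g \<in> forms (int t)"
      using f \<beta>V unfolding g_def V by (intro forms_diff forms_sum forms_lscale) auto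
    have gc: "lcoeff g (plane_exponent t z) = 0" if z: "z \<in> ?D" for z
    proof -
      have "(\<Sum>w\<in>?D. lcoeff f (plane_exponent t w) * lcoeff (\<beta> w) (plane_exponent t z)) =
        (\<Sum>w\<in>?D. if w = z then lcoeff f (plane_exponent t z) else 0)"
        by (rule sum.cong) (use z \<beta>c in auto)
      then show ?thesis using z fin by (simp add: g_def lookup_minus lookup_sum)
    qed
    have "g = (\<Sum>z\<in>lattice_triangle t. lscale (lcoeff g (plane_exponent t z)) (plane_monomial t z))"
      by (rule forms_plane_monomials[OF gf])
    also have "\<dots> = (\<Sum>z\<in>C. lscale (lcoeff g (plane_exponent t z)) (plane_monomial t z))"
      by (rule sum.mono_neutral_right) (use C gc finite_lattice_triangle in \<open>auto simp: lscale_def\<close>)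
    finally have g: "g = (\<Sum>z\<in>C. lscale (lcoeff g (plane_exponent t z)) (plane_monomial t z))" .
    have "\<forall>r\<in>jet_index s m. jet_value m x r (\<Sum>z\<in>C. lscale (lcoeff g (plane_exponent t z)) (plane_monomial t z)) = 0"
      using g0 unfolding g[symmetric] by blast
    then have "\<forall>z\<in>C. lcoeff g (plane_exponent t z) = 0"
      using b unfolding jets_bijective_def by meson
    then have "g = 0" by (subst g) (simp add: lscale_def)
    then have "f = (\<Sum>z\<in>?D. lscale (lcoeff f (plane_exponent t z)) (\<beta> z))" by (simp add: g_def)
    also have "\<dots> \<in> laurent.span (\<beta> ` ?D)"
      by (intro laurent.span_sum laurent.span_scale laurent.span_base imageI)
    finally show "f \<in> laurent.span (\<beta> ` ?D)" .
  qed
  moreover have "card (\<beta> ` ?D) = card (lattice_triangle t) - card C"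
    using card_image[OF inj] card_Diff_subset[OF fin(1) C] by simp
  ultimately show ?thesis using \<beta>V by (intro laurent.dim_unique[of "\<beta> ` ?D"]) auto
qed

section \<open>The degenerate configuration\<close>

definition affine_point :: "complex \<Rightarrow> complex \<Rightarrow> complex ^ 3" where
  "affine_point a b = (\<chi> k. if k = 1 then 1 else if k = 2 then a else b)"

lemma affine_point_nth [simp]: "affine_point a b $ 1 = 1" "affine_point a b $ 2 = a" "affine_point a b $ 3 = b"
  by (simp_all add: affine_point_def)

lemma affine_point_nonzero: "affine_point a b \<noteq> 0"
  using affine_point_nth(1)[of a b] by (metis zero_index zero_neq_one)

lemma mult_lscale: "f * lscale c g = lscale c (f * g)"
  by (simp add: lscale_def mult.left_commute)

text \<open>The operator \<open>y d/dy - r\<close> multiplies slice \<open>j\<close> by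
  \<open>j - r\<close> and costs at most one order of vanishing.\<close>

lemma vanishes_at_Euler_operators:
  assumes C: "C \<subseteq> lattice_triangle t" and "finite R"
    and v: "vanishes_at n w (\<Sum>z\<in>C. lscale (u z) (plane_monomial t z))"
  shows "vanishes_at (n - card R) w (\<Sum>z\<in>C. lscale ((\<Prod>r\<in>R. of_nat (fst z) - of_nat r) * u z) (plane_monomial t z))"
  using assms(2)
proof (induction R rule: finite_induct)
  case empty
  show ?case using v by simp
next
  case (insert r R)
  let ?f = "\<Sum>z\<in>C. lscale ((\<Prod>r\<in>R. of_nat (fst z) - of_nat r) * u z) (plane_monomial t z)"
  let ?g = "\<Sum>z\<in>C. lscale ((\<Prod>r\<in>insert r R. of_nat (fst z) - of_nat r) * u z) (plane_monomial t z)"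
  have f: "?f \<in> coord_ring {}"
    using C forms_sum[of C _ "int t"] plane_monomial_form[of _ t]
    by (auto simp: forms_def lattice_triangle_iff intro!: coord_ring_sum coord_ring_lscale)
  let ?q = "\<lambda>z. (\<Prod>r\<in>R. of_nat (fst z) - of_nat r) * u z :: complex"
  have E: "lmonom (axis 3 1) 1 * partial 3 (plane_monomial t z) = lscale (of_nat (fst z)) (plane_monomial t z)" for z
    by (simp add: plane_monomial_def partial_single mult_single lscale_def del: single_of_nat)
  have 1: "lmonom (axis 3 1) 1 * partial 3 ?f = (\<Sum>z\<in>C. lscale (?q z * of_nat (fst z)) (plane_monomial t z))"
    by (simp only: partial_sum partial_lscale sum_distrib_left mult_lscale E laurent.scale_scale)
  have 2: "lscale (of_nat r) ?f = (\<Sum>z\<in>C. lscale (of_nat r * ?q z) (plane_monomial t z))"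
    by (simp only: laurent.scale_sum_right laurent.scale_scale)
  have "?g = lmonom (axis 3 1) 1 * partial 3 ?f - lscale (of_nat r) ?f"
    unfolding 1 2 sum_subtractf[symmetric] laurent.scale_left_diff_distrib[symmetric]
    using insert(1,2) by (intro sum.cong refl arg_cong2[where f = lscale]) (simp add: algebra_simps)
  moreover have "vanishes_at (n - card (insert r R)) w (lmonom (axis 3 1) 1 * partial 3 ?f)"
  proof (cases "n - card R")
    case 0
    then show ?thesis using insert(1,2) by simp
  next
    case (Suc k)
    then have "vanishes_at k w (partial 3 ?f)" using insert.IH by (simp add: vanishes_at_Suc)
    moreover have "n - card (insert r R) = k" using Suc insert(1,2) by simp
    ultimately show ?thesis
      using vanishes_at_mult[of "lmonom (axis 3 1) 1" "{}" "partial 3 ?f" w 0 k k] f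
      by (simp add: coord_ring_partial)
  qed
  moreover have "vanishes_at (n - card (insert r R)) w (lscale (of_nat r) ?f)"
    by (rule vanishes_at_lscale[OF vanishes_at_mono[OF insert.IH]]) (use insert(1,2) in simp)
  ultimately show ?case by (simp only: vanishes_at_diff)
qed

lemma higher_pderiv_monom:
  "(pderiv ^^ i) (monom c l) = monom ((\<Prod>r<i. of_nat l - of_nat r) * c) (l - i)" for c :: complex
proof (induction i)
  case (Suc i)
  have "of_nat (l - i) * (\<Prod>r<i. of_nat l - of_nat r) = (\<Prod>r<Suc i. of_nat l - of_nat r :: complex)"
  proof (cases "i \<le> l")
    case False
    then have "(\<Prod>r<i. of_nat l - of_nat r) = (0 :: complex)" by (intro prod_zero) auto
    then show ?thesis by simp
  qed (simp add: of_nat_diff)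
  then show ?case by (simp add: Suc pderiv_monom mult.assoc[symmetric] del: prod.lessThan_Suc)
qed simp

text \<open>The Euler operators for \<open>R\<close> are followed by \<open>i\<close> derivatives in
  \<open>x_2\<close>, evaluated in the chart \<open>x_1 = 1\<close> with \<open>x = x_2\<close> and
  \<open>y = x_3\<close>.\<close>

lemma vanishes_at_imp_fat_point_conditions:
  assumes c: "\<And>j. c j \<le> t + 1 - j"
    and v: "vanishes_at n (affine_point a b) (\<Sum>z\<in>Sigma {..t} (\<lambda>j. {..<c j}). lscale (u z) (plane_monomial t z))"
  shows "fat_point_conditions t n a b (\<lambda>j. \<Sum>l<c j. monom (u (j, l)) l)"
  unfolding fat_point_conditions_def
proof (intro allI impI)
  fix i and R :: "nat set" assume R: "finite R" "i + card R < n"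
  let ?C = "Sigma {..t} (\<lambda>j. {..<c j})" and ?w = "affine_point a b"
  let ?q = "\<lambda>j. \<Prod>r\<in>R. of_nat j - of_nat r :: complex"
  have C: "?C \<subseteq> lattice_triangle t" unfolding lattice_triangle_def by (intro Sigma_mono) (use c in auto)
  have "i < n - card R" using R(2) by simp
  then have "leval ((partial 2 ^^ i) (\<Sum>z\<in>?C. lscale (?q (fst z) * u z) (plane_monomial t z))) ?w = 0"
    unfolding fold_partial_replicate[symmetric]
    by (intro vanishes_at_Euler_operators[OF C R(1) v, unfolded vanishes_at_def, rule_format]) simp
  also have "(partial 2 ^^ i) (\<Sum>z\<in>?C. lscale (?q (fst z) * u z) (plane_monomial t z)) =
    (\<Sum>z\<in>?C. lscale (?q (fst z) * u z) ((partial 2 ^^ i) (plane_monomial t z)))"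
  proof -
    have "(partial 2 ^^ i) (\<Sum>z\<in>A. F z) = (\<Sum>z\<in>A. (partial 2 ^^ i) (F z))" for A and F :: "nat \<times> nat \<Rightarrow> laurent"
      by (induction A rule: infinite_finite_induct) (simp_all add: funpow_partial_add)
    then show ?thesis by (simp add: funpow_partial_lscale)
  qed
  also have "leval \<dots> ?w = (\<Sum>z\<in>?C. ?q (fst z) * b ^ fst z * poly ((pderiv ^^ i) (monom (u z) (snd z))) a)"
    unfolding leval_sum
  proof (rule sum.cong[OF refl])
    fix z assume "z \<in> ?C"
    have p: "(partial 2 ^^ i) (plane_monomial t z) =
      lmonom (plane_exponent t z - axis 2 (int i)) (\<Prod>r<i. of_nat (snd z) - of_nat r)"
      by (simp add: plane_monomial_def funpow_partial_lmonom)
    show "leval (lscale (?q (fst z) * u z) ((partial 2 ^^ i) (plane_monomial t z))) ?w =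
      ?q (fst z) * b ^ fst z * poly ((pderiv ^^ i) (monom (u z) (snd z))) a"
    proof (cases "i \<le> snd z")
      case True
      then have i: "int (snd z) - int i = int (snd z - i)" by (simp add: of_nat_diff)
      have 3: "prod f (UNIV :: 3 set) = f 1 * f 2 * f 3" for f :: "3 \<Rightarrow> complex"
        unfolding UNIV_3 by (simp add: mult.assoc)
      have "(\<Prod>k\<in>UNIV. (?w $ k) powi ((plane_exponent t z - axis 2 (int i)) $ k)) = a ^ (snd z - i) * b ^ fst z"
        unfolding 3 by (simp add: axis_nth_if i)
      then show ?thesis
        unfolding p leval_lscale leval_single higher_pderiv_monom poly_monom
        by (simp only: mult_ac)
    next
      case False
      then have z0: "(\<Prod>r<i. of_nat (snd z) - of_nat r) = (0 :: complex)" by (intro prod_zero) auto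
      show ?thesis by (simp only: p higher_pderiv_monom z0) (simp add: lscale_def)
    qed
  qed
  also have "\<dots> = (\<Sum>j\<le>t. \<Sum>l<c j. ?q j * b ^ j * poly ((pderiv ^^ i) (monom (u (j, l)) l)) a)"
    by (subst sum.Sigma) (auto simp: case_prod_beta)
  also have "\<dots> = (\<Sum>j\<le>t. ?q j * b ^ j * poly ((pderiv ^^ i) (\<Sum>l<c j. monom (u (j, l)) l)) a)"
    by (simp only: linear_functional_sum[OF linear_functional_higher_pderiv] sum_distrib_left)
  finally show "(\<Sum>j\<le>t. ?q j * b ^ j * poly ((pderiv ^^ i) (\<Sum>l<c j. monom (u (j, l)) l)) a) = 0" .
qed

lemma card_jet_index: "card (jet_index s m) = (\<Sum>p = 1..s. Suc (m p) choose 2)"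
proof -
  have "(\<Sum>a<n. n - a) = Suc n choose 2" for n
  proof -
    have "(\<Sum>a<n. n - a) = \<Sum>{1..n}"
      by (rule sum.reindex_bij_witness[of _ "\<lambda>i. n - i" "\<lambda>i. n - i"]) auto
    then show ?thesis
      using gauss_sum_from_Suc_0[of n, where 'a=nat] by (simp add: choose_two mult.commute)
  qed
  then show ?thesis by (simp add: jet_index_def)
qed

text \<open>The points get the abscissas 1 to \<open>s\<close> and the heights provided by
  \<open>exact_points\<close> with \<open>g = 1\<close>. A combination of the chosen monomials with
  zero jets then has only zero slices, which is the injectivity that
  \<open>jets_bijective_open\<close> asks for.\<close>

lemma jets_bijective_if_exact:
  assumes ex: "exact c (map (\<lambda>p. m (Suc p)) [0..<s])" and c: "\<And>j. c j \<le> t + 1 - j"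
    and m: "\<And>p. p \<in> {1..s} \<Longrightarrow> 1 \<le> m p" "\<And>p. p \<in> {1..s} \<Longrightarrow> m p \<le> t"
  shows "\<exists>U. zariski_open s U \<and> U \<noteq> {} \<and>
    (\<forall>P\<in>U. \<exists>x. (\<forall>p\<in>{1..s}. x p \<in> hcoords (P p)) \<and> jets_bijective s m t (Sigma {..t} (\<lambda>j. {..<c j})) x)"
proof -
  let ?C = "Sigma {..t} (\<lambda>j. {..<c j})" and ?ms = "map (\<lambda>p. m (Suc p)) [0..<s]"
  let ?as = "map (\<lambda>p. of_nat (Suc p)) [0..<s] :: complex list"
  have c0: "c j = 0" if "t < j" for j using c[of j] that by simp
  have C: "fst z + snd z \<le> t" if z: "z \<in> ?C" for z
  proof -
    have "snd z < c (fst z)" "fst z \<le> t" using z by auto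
    then show ?thesis using c[of "fst z"] by linarith
  qed
  have "\<exists>bs. \<forall>h. (\<forall>j. pdeg (c j) (h j)) \<longrightarrow>
    (\<forall>p<length ?ms. fat_point_conditions t (?ms ! p) (?as ! p) (bs p) (\<lambda>j. 1 * h j)) \<longrightarrow> (\<forall>j. h j = 0)"
    by (rule exact_points[OF ex]) (use c0 in \<open>auto simp: distinct_map inj_on_def\<close>)
  then obtain bs where bs: "\<forall>h. (\<forall>j. pdeg (c j) (h j)) \<longrightarrow>
    (\<forall>p<s. fat_point_conditions t (m (Suc p)) (of_nat (Suc p)) (bs p) h) \<longrightarrow> (\<forall>j. h j = 0)"
    by (auto simp del: of_nat_Suc)
  \<comment> \<open>Points are numbered from 1, list positions from 0.\<close>
  define x0 where "x0 p = affine_point (of_nat p) (bs (p - 1))" for p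
  show ?thesis
  proof (rule jets_bijective_open)
    show "finite ?C" by simp
    show "fst z + snd z \<le> t" if "z \<in> ?C" for z using C that .
    have "card ?C = (\<Sum>m\<leftarrow>?ms. Suc m choose 2)"
      using exact_sum[OF ex c0] by simp
    also have "\<dots> = (\<Sum>p = 1..s. Suc (m p) choose 2)"
      by (simp add: comp_def sum_list_distinct_conv_sum_set sum.atLeast1_atMost_eq atLeast0LessThan del: binomial_Suc_Suc)
    finally show "card ?C = card (jet_index s m)" by (simp add: card_jet_index)
    show "x0 p \<noteq> 0" for p by (simp add: x0_def affine_point_nonzero)
  next
    fix u z assume u: "\<And>r. r \<in> jet_index s m \<Longrightarrow>
      jet_value m x0 r (\<Sum>z\<in>?C. lscale (u z) (plane_monomial t z)) = 0" and z: "z \<in> ?C"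
    let ?f = "\<Sum>z\<in>?C. lscale (u z) (plane_monomial t z)"
    define h where "h j = (\<Sum>l<c j. monom (u (j, l)) l)" for j
    have f: "?f \<in> forms (int t)"
      by (intro forms_sum forms_lscale plane_monomial_form C)
    have "h j = 0" for j
    proof (rule bs[rule_format])
      show "pdeg (c j) (h j)" for j
        by (auto simp: pdeg_def h_def coeff_sum coeff_monom intro!: sum.neutral)
      show "fat_point_conditions t (m (Suc p)) (of_nat (Suc p)) (bs p) h" if p: "p < s" for p
      proof -
        have "vanishes_at (m (Suc p)) (x0 (Suc p)) ?f"
          using u f p m by (subst vanishes_at_iff_jets[of _ "{}" t x0 "Suc p" s]) (auto simp: forms_def)
        then have "vanishes_at (m (Suc p)) (affine_point (of_nat (Suc p)) (bs p)) ?f"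
          by (simp only: x0_def diff_Suc_1)
        from vanishes_at_imp_fat_point_conditions[OF c this] show ?thesis
          by (simp only: h_def[abs_def])
      qed
    qed
    then have "coeff (h (fst z)) (snd z) = 0" by simp
    then show "u z = 0" using z by (auto simp: h_def coeff_sum coeff_monom)
  qed
qed

theorem theoremA:
  fixes s :: nat and m :: "nat \<Rightarrow> nat" and t :: int
  assumes "s \<ge> 4"
    and "\<And>i j. 1 \<le> i \<Longrightarrow> i \<le> j \<Longrightarrow> j \<le> s \<Longrightarrow> m j \<le> m i"
    and "\<And>i. 1 \<le> i \<Longrightarrow> i \<le> s \<Longrightarrow> 1 \<le> m i"
    and "t \<ge> int (m 1) + int (m 2)"
    and "real_of_int (vdim t s m) \<ge> (1 / 2) * (3 * real (m 4) ^ 2 - 7 * real (m 4) + 2)"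
  shows "\<exists>U. zariski_open s U \<and> U \<noteq> {} \<and>
    (\<forall>P\<in>U. h1_vanishes t s m P \<and> non_special t s m P)"
proof -
  define T where "T = nat t"
  define M where "M = m 4"
  define ms where "ms = map (\<lambda>p. m (Suc p)) [3..<s]"
  have m1: "1 \<le> m p" if "p \<in> {1..s}" for p using assms(3) that by simp
  have m12: "m 2 \<le> m 1" "m 3 \<le> m 2" "M \<le> m 3" "1 \<le> M"
    using assms(1) assms(2)[of 1 2] assms(2)[of 2 3] assms(2)[of 3 4] assms(3)[of 4] by (simp_all add: M_def)
  have t: "t = int T" "m 1 + m 2 \<le> T" using assms(4) by (auto simp: T_def)
  have mT: "m p \<le> T" if "p \<in> {1..s}" for p using assms(2)[of 1 p] that t(2) by simp
  have list: "map (\<lambda>p. m (Suc p)) [0..<s] = m 1 # m 2 # m 3 # ms"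
  proof -
    have "[0..<s] = 0 # 1 # 2 # [3..<s]"
      using assms(1) by (simp add: upt_conv_Cons numeral_eq_Suc)
    then show ?thesis by (simp add: ms_def numeral_eq_Suc)
  qed
  have choose: "2 * int (Suc n choose 2) = int n * (int n + 1)" for n
  proof -
    have "2 * (Suc n choose 2) = n * (n + 1)" by (simp add: choose_two mult.commute)
    then have "int (2 * (Suc n choose 2)) = int (n * (n + 1))" by (rule arg_cong)
    then show ?thesis unfolding of_nat_mult of_nat_add by simp
  qed
  have sum: "(\<Sum>p = 1..s. f (m p)) = (\<Sum>m\<leftarrow>m 1 # m 2 # m 3 # ms. f m)" for f :: "nat \<Rightarrow> int"
    unfolding list[symmetric]
    by (simp add: comp_def sum_list_distinct_conv_sum_set sum.atLeast1_atMost_eq atLeast0LessThan)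
  have vd: "vdim t s m = int (T + 2 choose 2) - (\<Sum>p = 1..s. int (Suc (m p) choose 2)) - 1"
  proof -
    have "nat (t + 2) = T + 2" by (simp add: t nat_add_distrib)
    then show ?thesis unfolding vdim_def by (simp only: Suc_eq_plus1)
  qed
  have "2 * vdim t s m = (int T + 1) * (int T + 2) - (\<Sum>m\<leftarrow>m 1 # m 2 # m 3 # ms. int m * (int m + 1)) - 2"
  proof -
    have "2 * vdim t s m = 2 * int (Suc (T + 1) choose 2) - (\<Sum>p = 1..s. 2 * int (Suc (m p) choose 2)) - 2"
      unfolding vd sum_distrib_left[symmetric] by (simp add: numeral_eq_Suc)
    then show ?thesis unfolding choose sum[of "\<lambda>m. int m * (int m + 1)"] by (simp add: algebra_simps)
  qed
  moreover have "3 * int M ^ 2 - 7 * int M + 2 \<le> 2 * vdim t s m"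
  proof -
    have "real_of_int (3 * int M ^ 2 - 7 * int M + 2) \<le> real_of_int (2 * vdim t s m)"
      using assms(5) by (simp add: M_def)
    then show ?thesis by (simp only: of_int_le_iff)
  qed
  \<comment> \<open>The hypothesis doubled; the constant 4 is its 2 plus twice the 1 subtracted in
    \<open>vdim\<close>.\<close>
  ultimately have total: "3 * int M ^ 2 + 4 + (\<Sum>m\<leftarrow>m 1 # m 2 # m 3 # ms. int m * (int m + 1))
      \<le> (int T + 1) * (int T + 2) + 7 * int M" by linarith
  have "1 \<le> k \<and> k \<le> M" if "k \<in> set ms" for k
    using that assms(2)[of 4] assms(3) by (auto simp: ms_def M_def)
  then have "reducible (\<lambda>j. T + 1 - j) (map (\<lambda>p. m (Suc p)) [0..<s])"
    unfolding list by (intro triangle_reducible[OF m12 t(2) _ total])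
  then obtain c where c: "exact c (map (\<lambda>p. m (Suc p)) [0..<s])" "\<And>j. c j \<le> T + 1 - j"
    using reducible_exact by blast
  let ?C = "Sigma {..T} (\<lambda>j. {..<c j})"
  have C: "?C \<subseteq> lattice_triangle T"
    unfolding lattice_triangle_def using c(2) by (intro Sigma_mono) auto
  obtain U where U: "zariski_open s U" "U \<noteq> {}"
    "\<And>P. P \<in> U \<Longrightarrow> \<exists>x. (\<forall>p\<in>{1..s}. x p \<in> hcoords (P p)) \<and> jets_bijective s m T ?C x"
    using jets_bijective_if_exact[OF c m1 mT] by blast
  have cC: "card ?C = (\<Sum>p = 1..s. Suc (m p) choose 2)"
  proof -
    have "c j = 0" if "T < j" for j using c(2)[of j] that by simp
    then have "card ?C = (\<Sum>m\<leftarrow>map (\<lambda>p. m (Suc p)) [0..<s]. Suc m choose 2)"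
      using exact_sum[OF c(1)] by simp
    then show ?thesis
      by (simp add: comp_def sum_list_distinct_conv_sum_set sum.atLeast1_atMost_eq atLeast0LessThan
        del: binomial_Suc_Suc)
  qed
  have "card ?C \<le> card (lattice_triangle T)" by (rule card_mono[OF finite_lattice_triangle C])
  moreover have "vdim t s m = int (card (lattice_triangle T)) - int (card ?C) - 1"
    unfolding vd cC card_lattice_triangle of_nat_sum ..
  \<comment> \<open>The set of chosen monomials fits into the triangle, hence the virtual dimension
    is at least -1 and equals the expected one.\<close>
  ultimately have dim: "int (card (lattice_triangle T) - card ?C) - 1 = vdim t s m" "-1 \<le> vdim t s m"
    by linarith+
  have "h1_vanishes t s m P \<and> non_special t s m P" if P: "P \<in> U" for P
  proof -
    obtain x where x: "\<And>p. p \<in> {1..s} \<Longrightarrow> x p \<in> hcoords (P p)" "jets_bijective s m T ?C x"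
      using U(3)[OF P] by blast
    have I: "jets_interpolated t s m x"
      unfolding t(1) by (rule jets_bijective_interpolated[OF x(2) _ m1 mT]) (use C lattice_triangle_iff in auto)
    have "h1_vanishes t s m P"
      by (rule h1_vanishes_if_interpolated[OF I x(1)], assumption)
        (rule jets_interpolated_distinct[OF I _ m1 x(1)], simp_all add: t)
    moreover have "non_special t s m P"
      using system_dim_jets_bijective[OF x(2) C x(1) m1 mT] dim
      by (simp add: non_special_def system_dim_def edim_def t)
    ultimately show ?thesis by blast
  qed
  then show ?thesis using U(1,2) by blast
qed

end
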